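(* For every fixed finite set of denial constraints $F$ and every fixed closed query $Q$: $\mathcal G$-preferred repair checking, i.e. the decision problem $$\mathcal B_F^{\mathcal G}=\{(I,\succ,I') : I'\in\mathcal{G}\mathit{Rep}(I,F,\succ)\},$$ is in coNP, and $\mathcal G$-preferred consistent query answering, i.e. the decision problem $$\mathcal D_{F,Q}^{\mathcal G}=\{(I,\succ) : \forall I'\in\mathcal{G}\mathit{Rep}(I,F,\succ).\ I'\models Q\},$$ is in $\Pi_2^p$.
   Context: A database schema is a set of relation names of fixed positive arity; each attribute ranges over one of two disjoint infinite domains: the rationals $\mathbb{Q}$ (with built-in predicates $=,\neq,<,\le,>,\ge$) or a set $D$ of uninterpreted constants (with built-in predicates $=,\neq$). A fact is an expression $R(t)$ with $R$ a relation name and $t$ a tuple of constants of the right arity and types. A database instance is a finite set of facts. A closed query is a first-order sentence over the relation names and built-in predicates. A denial constraint is a sentence $\forall\bar x.\ \neg[R_1(\bar x_1)\wedge\dots\wedge R_n(\bar x_n)\wedge\varphi(\bar x)]$ with $n>0$, $\bar x_1\cup\dots\cup\bar x_n=\bar x$, and $\varphi$ a quantifier-free formula using only built-in predicates. A set of facts $\{R_1(t_1),\dots,R_n(t_n)\}\subseteq I$ is a conflict in $I$ w.r.t. $F$ if for some denial constraint $\forall\bar x.\ \neg[R_1(\bar x_1)\wedge\dots\wedge R_n(\bar x_n)\wedge\varphi(\bar x)]$ in $F$ there is a substitution $\rho$ of constants for $\bar x$ such that $\varphi(\rho(\bar x))$ is true and $\rho(\bar x_i)=t_i$ for all $i$;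 an instance is consistent with $F$ iff it satisfies $F$, i.e. iff it contains no conflict. A repair of $I$ w.r.t. $F$ is a maximal (under inclusion) subset of $I$ consistent with $F$. Two facts of $I$ are neighbors if some conflict contains both. A priority of $I$ w.r.t. $F$ is an acyclic binary relation $\succ$ on $I$ such that $x\succ y$ implies that $x$ and $y$ are neighbors. A set $I'\subseteq I$ is globally optimal w.r.t. $\succ$ and $F$ if there are no nonempty $X\subseteq I'$ and $Y\subseteq I\setminus I'$ such that $\forall x\in X.\ \exists y\in Y.\ y\succ x$ and $(I'\setminus X)\cup Y$ is consistent with $F$. $\mathcal{G}\mathit{Rep}(I,F,\succ)$ is the set of all repairs of $I$ w.r.t. $F$ that are globally optimal w.r.t. $\succ$ and $F$. Complexity is data complexity: $F$ and $Q$ are fixed, and inputs consist of instances $I,I'$ and a priority $\succ$ of $I$ w.r.t. $F$. *)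

theory Defs
  imports Complex_Main "HOL-Computational_Algebra.Polynomial"
begin

section \<open>Polynomial time and the polynomial hierarchy\<close>

text \<open>
  Deterministic multi-tape Turing machines. States and tape symbols are initial segments of
  the natural numbers; symbol 0 is the blank, 1 and 2 stand for the input bits. The machine
  has two-way infinite tapes, and tape 0 carries the input.
\<close>

type_synonym lang = "bool list set"

datatype dir = MoveLeft | Stay | MoveRight

record tm =
  num_tapes :: nat
  num_states :: nat
  num_syms :: nat
  start :: nat
  acc :: nat
  rej :: nat
  delta :: "nat \<Rightarrow> nat list \<Rightarrow> nat \<times> (nat \<times> dir) list"

definition wf_tm :: "tm \<Rightarrow> bool" where
  "wf_tm M \<longleftrightarrow>
     num_tapes M \<ge> 1 \<and> num_syms M \<ge> 3 \<and>
     start M < num_states M \<and> acc M < num_states M \<and> rej M < num_states M \<and> acc M \<noteq> rej M \<and>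
     (\<forall>q ss. q < num_states M \<longrightarrow> length ss = num_tapes M \<longrightarrow> set ss \<subseteq> {..<num_syms M} \<longrightarrow>
        fst (delta M q ss) < num_states M \<and>
        length (snd (delta M q ss)) = num_tapes M \<and>
        fst ` set (snd (delta M q ss)) \<subseteq> {..<num_syms M})"

type_synonym tape = "(int \<Rightarrow> nat) \<times> int"  \<comment> \<open>cell contents and head position\<close>
type_synonym config = "nat \<times> tape list"

fun read :: "tape \<Rightarrow> nat" where
  "read (c, h) = c h"

fun shift :: "dir \<Rightarrow> int \<Rightarrow> int" where
  "shift MoveLeft h = h - 1"
| "shift Stay h = h"
| "shift MoveRight h = h + 1"

fun act :: "nat \<times> dir \<Rightarrow> tape \<Rightarrow> tape" where
  "act (s, d) (c, h) = (c(h := s), shift d h)"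

text \<open>The accepting and the rejecting configurations are halting, hence fixed points of a step.\<close>

fun step :: "tm \<Rightarrow> config \<Rightarrow> config" where
  "step M (q, ts) =
     (if q = acc M \<or> q = rej M then (q, ts)
      else (let (q', as) = delta M q (map read ts) in (q', map2 act as ts)))"

definition input_tape :: "bool list \<Rightarrow> tape" where
  "input_tape w =
     ((\<lambda>i. if 0 \<le> i \<and> i < int (length w) then (if w ! nat i then 2 else 1) else 0), 0)"

definition init_config :: "tm \<Rightarrow> bool list \<Rightarrow> config" where
  "init_config M w = (start M, input_tape w # replicate (num_tapes M - 1) (input_tape []))"

text \<open>Because halting configurations persist, this says that \<open>M\<close> halts within \<open>t (length w)\<close> steps.\<close>

definition decides_in_time :: "tm \<Rightarrow> lang \<Rightarrow> (nat \<Rightarrow> nat) \<Rightarrow> bool" where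
  "decides_in_time M L t \<longleftrightarrow>
     (\<forall>w. fst ((step M ^^ t (length w)) (init_config M w)) = (if w \<in> L then acc M else rej M))"

definition P_class :: "lang set" where
  "P_class = {L. \<exists>M (p :: nat poly). wf_tm M \<and> decides_in_time M L (poly p)}"

text \<open>
  Self-delimiting codes: a list is written as its coded elements, each preceded by the marker
  \<open>True\<close>, and closed by \<open>False\<close>.
\<close>

definition enc_list :: "('a \<Rightarrow> bool list) \<Rightarrow> 'a list \<Rightarrow> bool list" where
  "enc_list e xs = concat (map (\<lambda>x. True # e x) xs) @ [False]"

definition enc_str :: "bool list \<Rightarrow> bool list" where
  "enc_str = enc_list (\<lambda>b. [b])"

definition enc_pair :: "bool list \<Rightarrow> bool list \<Rightarrow> bool list" where
  "enc_pair x y = enc_str x @ enc_str y"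

text \<open>
  The levels of the polynomial hierarchy in the certificate formulation: languages
  \<open>{x. \<exists>y. |y| \<le> p(|x|) \<and> \<langle>x,y\<rangle> \<in> V}\<close> with \<open>p\<close> a polynomial and \<open>V\<close> in a given class.
\<close>

definition poly_ex :: "lang set \<Rightarrow> lang set" where
  "poly_ex C = {L. \<exists>V\<in>C. \<exists>p :: nat poly.
     L = {x. \<exists>y. length y \<le> poly p (length x) \<and> enc_pair x y \<in> V}}"

definition co_class :: "lang set \<Rightarrow> lang set" where
  "co_class C = {L. - L \<in> C}"

definition NP_class :: "lang set" where
  "NP_class = poly_ex P_class"

definition coNP_class :: "lang set" where
  "coNP_class = co_class NP_class"

definition Sigma2_class :: "lang set" where
  "Sigma2_class = poly_ex coNP_class"

definition Pi2_class :: "lang set" where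
  "Pi2_class = co_class Sigma2_class"


section \<open>Databases, queries and denial constraints\<close>

text \<open>
  The uninterpreted constants are bit strings, so that they can occur in the input of a
  machine. Relation names are natural numbers; a schema maps each of its names to the list of
  the sorts of its attributes.
\<close>

datatype sort = SQ | SD

datatype cst = Num rat | Name "bool list"

fun sort_of :: "cst \<Rightarrow> sort" where
  "sort_of (Num _) = SQ"
| "sort_of (Name _) = SD"

type_synonym fact = "nat \<times> cst list"
type_synonym schema = "nat \<Rightarrow> sort list option"

definition wf_schema :: "schema \<Rightarrow> bool" where
  "wf_schema S \<longleftrightarrow> finite (dom S) \<and> [] \<notin> ran S"

definition is_fact :: "schema \<Rightarrow> fact \<Rightarrow> bool" where
  "is_fact S f \<longleftrightarrow> S (fst f) = Some (map sort_of (snd f))"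

definition is_instance :: "schema \<Rightarrow> fact set \<Rightarrow> bool" where
  "is_instance S I \<longleftrightarrow> finite I \<and> (\<forall>f\<in>I. is_fact S f)"

type_synonym var = "sort \<times> nat"  \<comment> \<open>a variable carries its sort\<close>

datatype trm = Var var | Const cst

datatype cmp = Eq | Neq | Lt | Le | Gt | Ge

datatype fmla =
    Top
  | Rel nat "trm list"
  | Cmp cmp trm trm
  | Neg fmla
  | Conj fmla fmla
  | Disj fmla fmla
  | Exists var fmla
  | Forall var fmla

fun sort_trm :: "trm \<Rightarrow> sort" where
  "sort_trm (Var v) = fst v"
| "sort_trm (Const c) = sort_of c"

fun wf_fmla :: "schema \<Rightarrow> fmla \<Rightarrow> bool" where
  "wf_fmla S Top \<longleftrightarrow> True"
| "wf_fmla S (Rel R ts) \<longleftrightarrow> S R = Some (map sort_trm ts)"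
| "wf_fmla S (Cmp b t u) \<longleftrightarrow> sort_trm t = sort_trm u \<and> (sort_trm t = SD \<longrightarrow> b \<in> {Eq, Neq})"
| "wf_fmla S (Neg \<phi>) \<longleftrightarrow> wf_fmla S \<phi>"
| "wf_fmla S (Conj \<phi> \<psi>) \<longleftrightarrow> wf_fmla S \<phi> \<and> wf_fmla S \<psi>"
| "wf_fmla S (Disj \<phi> \<psi>) \<longleftrightarrow> wf_fmla S \<phi> \<and> wf_fmla S \<psi>"
| "wf_fmla S (Exists v \<phi>) \<longleftrightarrow> wf_fmla S \<phi>"
| "wf_fmla S (Forall v \<phi>) \<longleftrightarrow> wf_fmla S \<phi>"

fun fv_trm :: "trm \<Rightarrow> var set" where
  "fv_trm (Var v) = {v}"
| "fv_trm (Const c) = {}"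

fun fv :: "fmla \<Rightarrow> var set" where
  "fv Top = {}"
| "fv (Rel R ts) = (\<Union>t\<in>set ts. fv_trm t)"
| "fv (Cmp b t u) = fv_trm t \<union> fv_trm u"
| "fv (Neg \<phi>) = fv \<phi>"
| "fv (Conj \<phi> \<psi>) = fv \<phi> \<union> fv \<psi>"
| "fv (Disj \<phi> \<psi>) = fv \<phi> \<union> fv \<psi>"
| "fv (Exists v \<phi>) = fv \<phi> - {v}"
| "fv (Forall v \<phi>) = fv \<phi> - {v}"

definition closed_query :: "schema \<Rightarrow> fmla \<Rightarrow> bool" where
  "closed_query S Q \<longleftrightarrow> wf_fmla S Q \<and> fv Q = {}"

text \<open>Quantifier-free, and without relation names.\<close>

fun builtin_qf :: "fmla \<Rightarrow> bool" where
  "builtin_qf Top \<longleftrightarrow> True"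
| "builtin_qf (Rel R ts) \<longleftrightarrow> False"
| "builtin_qf (Cmp b t u) \<longleftrightarrow> True"
| "builtin_qf (Neg \<phi>) \<longleftrightarrow> builtin_qf \<phi>"
| "builtin_qf (Conj \<phi> \<psi>) \<longleftrightarrow> builtin_qf \<phi> \<and> builtin_qf \<psi>"
| "builtin_qf (Disj \<phi> \<psi>) \<longleftrightarrow> builtin_qf \<phi> \<and> builtin_qf \<psi>"
| "builtin_qf (Exists v \<phi>) \<longleftrightarrow> False"
| "builtin_qf (Forall v \<phi>) \<longleftrightarrow> False"

type_synonym valuation = "var \<Rightarrow> cst"

definition wf_val :: "valuation \<Rightarrow> bool" where
  "wf_val \<rho> \<longleftrightarrow> (\<forall>v. sort_of (\<rho> v) = fst v)"

fun eval_trm :: "valuation \<Rightarrow> trm \<Rightarrow> cst" where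
  "eval_trm \<rho> (Var v) = \<rho> v"
| "eval_trm \<rho> (Const c) = c"

text \<open>The last equation only concerns order comparisons that are not well-sorted.\<close>

fun eval_cmp :: "cmp \<Rightarrow> cst \<Rightarrow> cst \<Rightarrow> bool" where
  "eval_cmp Eq x y \<longleftrightarrow> x = y"
| "eval_cmp Neq x y \<longleftrightarrow> x \<noteq> y"
| "eval_cmp Lt (Num a) (Num b) \<longleftrightarrow> a < b"
| "eval_cmp Le (Num a) (Num b) \<longleftrightarrow> a \<le> b"
| "eval_cmp Gt (Num a) (Num b) \<longleftrightarrow> a > b"
| "eval_cmp Ge (Num a) (Num b) \<longleftrightarrow> a \<ge> b"
| "eval_cmp _ _ _ \<longleftrightarrow> False"

text \<open>Quantifiers range over the whole infinite domain of the sort of the bound variable.\<close>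

fun sat :: "fact set \<Rightarrow> valuation \<Rightarrow> fmla \<Rightarrow> bool" where
  "sat I \<rho> Top \<longleftrightarrow> True"
| "sat I \<rho> (Rel R ts) \<longleftrightarrow> (R, map (eval_trm \<rho>) ts) \<in> I"
| "sat I \<rho> (Cmp b t u) \<longleftrightarrow> eval_cmp b (eval_trm \<rho> t) (eval_trm \<rho> u)"
| "sat I \<rho> (Neg \<phi>) \<longleftrightarrow> \<not> sat I \<rho> \<phi>"
| "sat I \<rho> (Conj \<phi> \<psi>) \<longleftrightarrow> sat I \<rho> \<phi> \<and> sat I \<rho> \<psi>"
| "sat I \<rho> (Disj \<phi> \<psi>) \<longleftrightarrow> sat I \<rho> \<phi> \<or> sat I \<rho> \<psi>"
| "sat I \<rho> (Exists v \<phi>) \<longleftrightarrow> (\<exists>c. sort_of c = fst v \<and> sat I (\<rho>(v := c)) \<phi>)"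
| "sat I \<rho> (Forall v \<phi>) \<longleftrightarrow> (\<forall>c. sort_of c = fst v \<longrightarrow> sat I (\<rho>(v := c)) \<phi>)"

text \<open>For a closed query the choice of the valuation is immaterial.\<close>

definition models :: "fact set \<Rightarrow> fmla \<Rightarrow> bool"  (infix "\<Turnstile>" 50) where
  "I \<Turnstile> Q \<longleftrightarrow> (\<forall>\<rho>. wf_val \<rho> \<longrightarrow> sat I \<rho> Q)"

text \<open>
  A denial constraint \<open>\<forall>x. \<not> (R\<^sub>1(x\<^sub>1) \<and> \<dots> \<and> R\<^sub>n(x\<^sub>n) \<and> \<phi>)\<close> is given by the list of its relational
  atoms and by \<open>\<phi>\<close>.
\<close>

type_synonym denial = "(nat \<times> var list) list \<times> fmla"

definition wf_denial :: "schema \<Rightarrow> denial \<Rightarrow> bool" where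
  "wf_denial S d \<longleftrightarrow> (case d of (as, \<phi>) \<Rightarrow>
     as \<noteq> [] \<and> (\<forall>(R, xs)\<in>set as. S R = Some (map fst xs)) \<and>
     builtin_qf \<phi> \<and> wf_fmla S \<phi> \<and> fv \<phi> \<subseteq> (\<Union>(R, xs)\<in>set as. set xs))"

definition inst_atom :: "valuation \<Rightarrow> nat \<times> var list \<Rightarrow> fact" where
  "inst_atom \<rho> a = (fst a, map \<rho> (snd a))"

text \<open>The truth of \<open>\<phi>\<close>, which has no relational atoms, is independent of the instance.\<close>

definition satisfies_denial :: "fact set \<Rightarrow> denial \<Rightarrow> bool" where
  "satisfies_denial I d \<longleftrightarrow> (case d of (as, \<phi>) \<Rightarrow>
     \<forall>\<rho>. wf_val \<rho> \<longrightarrow> \<not> ((\<forall>a\<in>set as. inst_atom \<rho> a \<in> I) \<and> sat I \<rho> \<phi>))"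

definition consistent :: "denial set \<Rightarrow> fact set \<Rightarrow> bool" where
  "consistent F I \<longleftrightarrow> (\<forall>d\<in>F. satisfies_denial I d)"

definition conflict :: "denial set \<Rightarrow> fact set \<Rightarrow> fact set \<Rightarrow> bool" where
  "conflict F I C \<longleftrightarrow> C \<subseteq> I \<and>
     (\<exists>(as, \<phi>)\<in>F. \<exists>\<rho>. wf_val \<rho> \<and> sat I \<rho> \<phi> \<and> C = inst_atom \<rho> ` set as)"

lemma consistent_iff_no_conflict: "consistent F I \<longleftrightarrow> (\<nexists>C. conflict F I C)"
proof
  assume "consistent F I"
  then show "\<nexists>C. conflict F I C"
    by (fastforce simp: consistent_def satisfies_denial_def conflict_def)
next
  assume *: "\<nexists>C. conflict F I C"
  have False
    if d: "(as, \<phi>) \<in> F" and \<rho>: "wf_val \<rho>" "\<forall>a\<in>set as. inst_atom \<rho> a \<in> I" "sat I \<rho> \<phi>" for as \<phi> \<rho>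
  proof -
    have "conflict F I (inst_atom \<rho> ` set as)"
      unfolding conflict_def
      by (intro conjI bexI[OF _ d]) (use \<rho> in auto)
    with * show False by simp
  qed
  then show "consistent F I"
    unfolding consistent_def satisfies_denial_def by (auto split: prod.split)
qed

definition neighbors :: "denial set \<Rightarrow> fact set \<Rightarrow> fact \<Rightarrow> fact \<Rightarrow> bool" where
  "neighbors F I x y \<longleftrightarrow> (\<exists>C. conflict F I C \<and> x \<in> C \<and> y \<in> C)"

definition is_repair :: "denial set \<Rightarrow> fact set \<Rightarrow> fact set \<Rightarrow> bool" where
  "is_repair F I I' \<longleftrightarrow>
     I' \<subseteq> I \<and> consistent F I' \<and> (\<forall>J. I' \<subset> J \<and> J \<subseteq> I \<longrightarrow> \<not> consistent F J)"

text \<open>\<open>(x, y) \<in> pr\<close> means that \<open>x\<close> is preferred to \<open>y\<close>.\<close>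

definition is_priority :: "denial set \<Rightarrow> fact set \<Rightarrow> (fact \<times> fact) set \<Rightarrow> bool" where
  "is_priority F I pr \<longleftrightarrow>
     pr \<subseteq> I \<times> I \<and> acyclic pr \<and> (\<forall>(x, y)\<in>pr. neighbors F I x y)"

definition globally_optimal ::
  "denial set \<Rightarrow> fact set \<Rightarrow> (fact \<times> fact) set \<Rightarrow> fact set \<Rightarrow> bool" where
  "globally_optimal F I pr I' \<longleftrightarrow> I' \<subseteq> I \<and>
     \<not> (\<exists>X Y. X \<noteq> {} \<and> Y \<noteq> {} \<and> X \<subseteq> I' \<and> Y \<subseteq> I - I' \<and>
           (\<forall>x\<in>X. \<exists>y\<in>Y. (y, x) \<in> pr) \<and> consistent F ((I' - X) \<union> Y))"

definition GRep ::
  "denial set \<Rightarrow> fact set \<Rightarrow> (fact \<times> fact) set \<Rightarrow> fact set set" where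
  "GRep F I pr = {I'. is_repair F I I' \<and> globally_optimal F I pr I'}"


section \<open>The decision problems and their encoding\<close>

definition repair_checking ::
  "schema \<Rightarrow> denial set \<Rightarrow> (fact set \<times> (fact \<times> fact) set \<times> fact set) set" where
  "repair_checking S F =
     {(I, pr, I'). is_instance S I \<and> is_priority F I pr \<and> I' \<in> GRep F I pr}"

definition consistent_answering ::
  "schema \<Rightarrow> denial set \<Rightarrow> fmla \<Rightarrow> (fact set \<times> (fact \<times> fact) set) set" where
  "consistent_answering S F Q =
     {(I, pr). is_instance S I \<and> is_priority F I pr \<and> (\<forall>I'\<in>GRep F I pr. I' \<Turnstile> Q)}"

text \<open>Numbers are written in binary, least significant bit first; rationals in lowest terms.\<close>

fun bits :: "nat \<Rightarrow> bool list" where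
  "bits n = (if n = 0 then [] else odd n # bits (n div 2))"

declare bits.simps [simp del]

definition enc_nat :: "nat \<Rightarrow> bool list" where
  "enc_nat n = enc_str (bits n)"

definition enc_int :: "int \<Rightarrow> bool list" where
  "enc_int i = (i < 0) # enc_nat (nat \<bar>i\<bar>)"

definition enc_rat :: "rat \<Rightarrow> bool list" where
  "enc_rat r = (case quotient_of r of (a, b) \<Rightarrow> enc_int a @ enc_nat (nat b))"

fun enc_constant :: "cst \<Rightarrow> bool list" where
  "enc_constant (Num r) = False # enc_rat r"
| "enc_constant (Name s) = True # enc_str s"

definition enc_fact :: "fact \<Rightarrow> bool list" where
  "enc_fact f = enc_nat (fst f) @ enc_list enc_constant (snd f)"

definition enc_fact_pair :: "fact \<times> fact \<Rightarrow> bool list" where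
  "enc_fact_pair p = enc_fact (fst p) @ enc_fact (snd p)"

text \<open>
  A finite set is presented to a machine by listing its elements without repetition, in any
  order; a set therefore has several codes, but a code determines the set.
\<close>

definition set_codes :: "('a \<Rightarrow> bool list) \<Rightarrow> 'a set \<Rightarrow> lang" where
  "set_codes e A = {enc_list e xs | xs. distinct xs \<and> set xs = A}"

definition repair_checking_lang :: "schema \<Rightarrow> denial set \<Rightarrow> lang" where
  "repair_checking_lang S F =
     {u @ v @ w | u v w I pr I'. (I, pr, I') \<in> repair_checking S F \<and>
        u \<in> set_codes enc_fact I \<and> v \<in> set_codes enc_fact_pair pr \<and> w \<in> set_codes enc_fact I'}"

definition consistent_answering_lang :: "schema \<Rightarrow> denial set \<Rightarrow> fmla \<Rightarrow> lang" where
  "consistent_answering_lang S F Q =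
     {u @ v | u v I pr. (I, pr) \<in> consistent_answering S F Q \<and>
        u \<in> set_codes enc_fact I \<and> v \<in> set_codes enc_fact_pair pr}"

text \<open>The encoding is unambiguous.\<close>

definition prefix_code :: "('a \<Rightarrow> bool list) \<Rightarrow> bool" where
  "prefix_code e \<longleftrightarrow> (\<forall>x y u v. e x @ u = e y @ v \<longrightarrow> x = y \<and> u = v)"

lemma prefix_codeD: "prefix_code e \<Longrightarrow> e x @ u = e y @ v \<Longrightarrow> x = y \<and> u = v"
  unfolding prefix_code_def by blast

lemma prefix_code_list:
  assumes "prefix_code e"
  shows "prefix_code (enc_list e)"
proof -
  have "xs = ys \<and> u = v" if "enc_list e xs @ u = enc_list e ys @ v" for xs ys u v
    using that
  proof (induction xs arbitrary: ys)
    case Nil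
    then show ?case by (cases ys) (auto simp: enc_list_def)
  next
    case (Cons x xs)
    then obtain y ys' where ys: "ys = y # ys'" by (cases ys) (auto simp: enc_list_def)
    with Cons.prems have "e x @ (enc_list e xs @ u) = e y @ (enc_list e ys' @ v)"
      by (simp add: enc_list_def)
    from prefix_codeD[OF assms this] Cons.IH ys show ?case by simp
  qed
  then show ?thesis unfolding prefix_code_def by blast
qed

lemma prefix_code_str: "prefix_code enc_str"
  unfolding enc_str_def by (rule prefix_code_list) (simp add: prefix_code_def)

lemma bits_inj: "bits m = bits n \<Longrightarrow> m = n"
proof (induction m arbitrary: n rule: less_induct)
  case (less m)
  show ?case
  proof (cases "m = 0 \<or> n = 0")
    case True
    then show ?thesis using less.prems bits.simps[of m] bits.simps[of n]
      by (auto split: if_splits)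
  next
    case False
    then have "odd m = odd n" "bits (m div 2) = bits (n div 2)"
      using less.prems bits.simps[of m] bits.simps[of n] by auto
    moreover have "m div 2 < m" using False by simp
    ultimately have "m div 2 = n div 2" "odd m = odd n" using less.IH by auto
    then show ?thesis by (metis div_mult_mod_eq odd_iff_mod_2_eq_one even_iff_mod_2_eq_zero)
  qed
qed

lemma prefix_code_nat: "prefix_code enc_nat"
  unfolding prefix_code_def enc_nat_def
  by (meson prefix_codeD[OF prefix_code_str] bits_inj)

lemma prefix_code_int: "prefix_code enc_int"
  unfolding prefix_code_def
proof (intro allI impI)
  fix x y u v
  assume "enc_int x @ u = enc_int y @ v"
  then have s: "(x < 0) = (y < 0)" and "enc_nat (nat \<bar>x\<bar>) @ u = enc_nat (nat \<bar>y\<bar>) @ v"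
    by (auto simp: enc_int_def)
  from prefix_codeD[OF prefix_code_nat this(2)] s show "x = y \<and> u = v" by linarith
qed

lemma prefix_code_rat: "prefix_code enc_rat"
  unfolding prefix_code_def
proof (intro allI impI)
  fix x y u v
  assume eq: "enc_rat x @ u = enc_rat y @ v"
  obtain a b c d where q: "quotient_of x = (a, b)" "quotient_of y = (c, d)" by fastforce
  from eq have "enc_int a @ (enc_nat (nat b) @ u) = enc_int c @ (enc_nat (nat d) @ v)"
    by (simp add: enc_rat_def q)
  from prefix_codeD[OF prefix_code_int this] have "a = c"
    and "enc_nat (nat b) @ u = enc_nat (nat d) @ v" by auto
  moreover from prefix_codeD[OF prefix_code_nat this(2)] have "nat b = nat d" "u = v" by auto
  moreover have "b > 0" "d > 0" using q quotient_of_denom_pos by auto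
  ultimately have "quotient_of x = quotient_of y" "u = v" using q by auto
  then show "x = y \<and> u = v" by (simp add: quotient_of_inject)
qed

lemma prefix_code_constant: "prefix_code enc_constant"
  unfolding prefix_code_def
proof (intro allI impI)
  fix x y u v
  assume "enc_constant x @ u = enc_constant y @ v"
  then show "x = y \<and> u = v"
    by (cases x; cases y)
      (auto dest: prefix_codeD[OF prefix_code_rat] prefix_codeD[OF prefix_code_str])
qed

lemma prefix_code_fact: "prefix_code enc_fact"
  unfolding prefix_code_def
proof (intro allI impI)
  fix x y u v
  assume "enc_fact x @ u = enc_fact y @ v"
  then have eq: "enc_nat (fst x) @ (enc_list enc_constant (snd x) @ u) =
      enc_nat (fst y) @ (enc_list enc_constant (snd y) @ v)"
    by (simp add: enc_fact_def)
  note 1 = prefix_codeD[OF prefix_code_nat eq]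
  note 2 = prefix_codeD[OF prefix_code_list[OF prefix_code_constant] conjunct2[OF 1]]
  from 1 2 show "x = y \<and> u = v" by (simp add: prod_eq_iff)
qed

lemma prefix_code_fact_pair: "prefix_code enc_fact_pair"
  unfolding prefix_code_def
proof (intro allI impI)
  fix x y u v
  assume "enc_fact_pair x @ u = enc_fact_pair y @ v"
  then have eq: "enc_fact (fst x) @ (enc_fact (snd x) @ u) =
      enc_fact (fst y) @ (enc_fact (snd y) @ v)"
    by (simp add: enc_fact_pair_def)
  note 1 = prefix_codeD[OF prefix_code_fact eq]
  note 2 = prefix_codeD[OF prefix_code_fact conjunct2[OF 1]]
  from 1 2 show "x = y \<and> u = v" by (simp add: prod_eq_iff)
qed

lemma set_codes_unambiguous:
  assumes "prefix_code e" "x \<in> set_codes e A" "y \<in> set_codes e B" "x @ u = y @ v"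
  shows "A = B \<and> u = v"
proof -
  from assms(2,3) obtain xs ys where
    xs: "set xs = A" "x = enc_list e xs" and ys: "set ys = B" "y = enc_list e ys"
    unfolding set_codes_def by auto
  from prefix_codeD[OF prefix_code_list[OF assms(1)]] assms(4) have "xs = ys \<and> u = v"
    unfolding xs ys .
  with xs ys show ?thesis by simp
qed

lemma repair_checking_lang_iff:
  assumes "u \<in> set_codes enc_fact I" "v \<in> set_codes enc_fact_pair pr" "w \<in> set_codes enc_fact I'"
  shows "u @ v @ w \<in> repair_checking_lang S F \<longleftrightarrow> (I, pr, I') \<in> repair_checking S F"
proof
  assume "u @ v @ w \<in> repair_checking_lang S F"
  then obtain u1 v1 w1 J qr J' where
    eq: "u @ (v @ w) = u1 @ (v1 @ w1)" and mem: "(J, qr, J') \<in> repair_checking S F" and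
    c: "u1 \<in> set_codes enc_fact J" "v1 \<in> set_codes enc_fact_pair qr" "w1 \<in> set_codes enc_fact J'"
    unfolding repair_checking_lang_def by auto
  from set_codes_unambiguous[OF prefix_code_fact assms(1) c(1) eq]
  have 1: "I = J" "v @ w = v1 @ w1" by auto
  from set_codes_unambiguous[OF prefix_code_fact_pair assms(2) c(2) 1(2)]
  have 2: "pr = qr" "w @ [] = w1 @ []" by auto
  from set_codes_unambiguous[OF prefix_code_fact assms(3) c(3) 2(2)] have "I' = J'" by simp
  with 1 2 mem show "(I, pr, I') \<in> repair_checking S F" by simp
next
  assume "(I, pr, I') \<in> repair_checking S F"
  with assms show "u @ v @ w \<in> repair_checking_lang S F"
    unfolding repair_checking_lang_def mem_Collect_eq
    by (intro exI[of _ u] exI[of _ v] exI[of _ w] exI[of _ I] exI[of _ pr] exI[of _ I'] conjI refl)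
qed

lemma consistent_answering_lang_iff:
  assumes "u \<in> set_codes enc_fact I" "v \<in> set_codes enc_fact_pair pr"
  shows "u @ v \<in> consistent_answering_lang S F Q \<longleftrightarrow> (I, pr) \<in> consistent_answering S F Q"
proof
  assume "u @ v \<in> consistent_answering_lang S F Q"
  then obtain u1 v1 J qr where
    eq: "u @ v = u1 @ v1" and mem: "(J, qr) \<in> consistent_answering S F Q" and
    c: "u1 \<in> set_codes enc_fact J" "v1 \<in> set_codes enc_fact_pair qr"
    unfolding consistent_answering_lang_def by auto
  from set_codes_unambiguous[OF prefix_code_fact assms(1) c(1) eq]
  have 1: "I = J" "v @ [] = v1 @ []" by auto
  from set_codes_unambiguous[OF prefix_code_fact_pair assms(2) c(2) 1(2)] have "pr = qr" by simp
  with 1 mem show "(I, pr) \<in> consistent_answering S F Q" by simp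
next
  assume "(I, pr) \<in> consistent_answering S F Q"
  with assms show "u @ v \<in> consistent_answering_lang S F Q"
    unfolding consistent_answering_lang_def mem_Collect_eq
    by (intro exI[of _ u] exI[of _ v] exI[of _ I] exI[of _ pr] conjI refl)
qed

end

theory Submission
  imports Defs
begin

text \<open>
  Polynomial time is reached through a small stack language: a structured program on four stacks
  becomes a Turing machine whose states are the continuations of the program, and a function on
  coded data (binary trees, serialised on a stack) is polynomial-time if such a program computes
  it. These functions are closed under bounded recursion over lists, which gives binary
  arithmetic, the parsing of inputs, and the tests for instances, priorities and repairs.

  A query over the infinite ordered domain is evaluated with finitely many symbolic values: up to
  the built-in predicates, a quantified variable takes an old value, or a new one immediately
  below or above an old one. Consistency and neighborhood are queries, too. What remains is a
  guess of a subset \<open>Z\<close> of \<open>I\<close>, one bit per fact: \<open>X = Z \<inter> I'\<close> and \<open>Y = Z - I'\<close> refute global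
  optimality, and for query answering \<open>I'\<close> itself is guessed in the same way.
\<close>

section \<open>Structured stack programs on Turing machines\<close>

text \<open>The classes are defined by machines on raw bit strings, so malformed words belong to the
  complement of each language and have to be recognised. Codes list facts without repetition and
  write rationals in lowest terms: this is where coprimality must be decided in polynomial time.
  Multiplication enters through the comparison of fractions.

  Polynomial-time functions compose, but iterating one of them may double the size of the data in
  every round. Recursion is therefore a \<open>fold\<close> with a polynomial bound on all
  intermediate accumulators, and most closure lemmas amount to finding that bound.

  Data complexity enters in the query evaluator: it recurses on the fixed formula, so a quantifier
  contributes one polynomial search and the quantifier depth only affects the polynomial.

  Consistency is inherited by subsets, hence the maximality of a repair can be tested by adding
  single facts. What remains exponential is a search over subsets of \<open>I\<close>: one subset
  refutes a preferred repair, and for query answering one subset is proposed as a counterexample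
  while a second one challenges it. These are the two levels.\<close>

datatype prog =
    PUSH nat nat
  | PUT nat nat
  | POP nat
  | SKIP
  | SEQ prog prog
  | IF nat "nat set" prog prog
  | WHILE nat "nat set" prog

type_synonym store = "nat \<Rightarrow> nat list"

definition top_of :: "nat list \<Rightarrow> nat" where
  "top_of u = (case u of [] \<Rightarrow> 0 | x # _ \<Rightarrow> x)"

lemma top_of_simps [simp]: "top_of [] = 0" "top_of (x # u) = x"
  by (simp_all add: top_of_def)

text \<open>
  \<open>PUT\<close> has no rule: it only occurs as the second half of the execution of a \<open>PUSH\<close>. The time
  counts exactly the steps of the machine constructed below.
\<close>

inductive exec :: "prog \<Rightarrow> store \<Rightarrow> nat \<Rightarrow> store \<Rightarrow> bool" where
  "i < 4 \<Longrightarrow> x < 3 \<Longrightarrow> exec (PUSH i x) s 2 (s(i := x # s i))"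
| "i < 4 \<Longrightarrow> exec (POP i) s 1 (s(i := tl (s i)))"
| "exec SKIP s 1 s"
| "exec p s t1 s1 \<Longrightarrow> exec q s1 t2 s2 \<Longrightarrow> exec (SEQ p q) s (Suc (t1 + t2)) s2"
| "i < 4 \<Longrightarrow> top_of (s i) \<in> A \<Longrightarrow> exec p s t s' \<Longrightarrow> exec (IF i A p q) s (Suc t) s'"
| "i < 4 \<Longrightarrow> top_of (s i) \<notin> A \<Longrightarrow> exec q s t s' \<Longrightarrow> exec (IF i A p q) s (Suc t) s'"
| "i < 4 \<Longrightarrow> top_of (s i) \<notin> A \<Longrightarrow> exec (WHILE i A p) s 1 s"
| "i < 4 \<Longrightarrow> top_of (s i) \<in> A \<Longrightarrow> exec p s t1 s1 \<Longrightarrow> exec (WHILE i A p) s1 t2 s2 \<Longrightarrow>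
    exec (WHILE i A p) s (Suc (t1 + t2)) s2"

text \<open>A step pushes at most one symbol. Through this lemma every time bound is also a bound on
  the size of the result.\<close>

lemma exec_length: "exec p s t s' \<Longrightarrow> length (s' i) \<le> length (s i) + t"
  by (induction rule: exec.induct) auto

section \<open>Continuations as the finite control\<close>

fun conts :: "prog \<Rightarrow> prog list \<Rightarrow> prog list set" where
  "conts (PUSH i x) K = {PUSH i x # K, PUT i x # K}"
| "conts (PUT i x) K = {PUT i x # K}"
| "conts (POP i) K = {POP i # K}"
| "conts SKIP K = {SKIP # K}"
| "conts (SEQ p q) K = insert (SEQ p q # K) (conts p (q # K) \<union> conts q K)"
| "conts (IF i A p q) K = insert (IF i A p q # K) (conts p K \<union> conts q K)"
| "conts (WHILE i A p) K = insert (WHILE i A p # K) (conts p (WHILE i A p # K))"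

fun next_cont :: "prog list \<Rightarrow> nat list \<Rightarrow> prog list" where
  "next_cont [] ss = []"
| "next_cont (PUSH i x # K) ss = PUT i x # K"
| "next_cont (SEQ p q # K) ss = p # q # K"
| "next_cont (IF i A p q # K) ss = (if ss ! i \<in> A then p # K else q # K)"
| "next_cont (WHILE i A p # K) ss = (if ss ! i \<in> A then p # WHILE i A p # K else K)"
| "next_cont (_ # K) ss = K"

text \<open>A pop moves the head without erasing, since cells to the left of the head carry no
  meaning; a push moves left and lets \<open>PUT\<close> overwrite whatever is there. Writing
  \<open>x mod 3\<close> keeps the symbol in the alphabet for every program, while
  \<open>exec\<close> pushes only symbols below 3.\<close>

fun head_action :: "prog list \<Rightarrow> nat \<Rightarrow> nat \<Rightarrow> nat \<times> dir" where
  "head_action (PUSH i x # K) j a = (a, if j = i then MoveLeft else Stay)"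
| "head_action (PUT i x # K) j a = (if j = i then x mod 3 else a, Stay)"
| "head_action (POP i # K) j a = (a, if j = i then MoveRight else Stay)"
| "head_action _ j a = (a, Stay)"

lemma finite_conts: "finite (conts p K)"
  by (induction p arbitrary: K) auto

lemma conts_self: "p # K \<in> conts p K"
  by (cases p) auto

text \<open>A loop puts itself back on the list of pending programs, so no new continuation ever
  arises except \<open>K\<close>, when the program is done. Together with the empty continuation
  these finitely many lists can serve as states.\<close>

lemma conts_closed: "K' \<in> conts p K \<Longrightarrow> next_cont K' ss \<in> insert K (conts p K)"
proof (induction p arbitrary: K)
  case (SEQ p q)
  from SEQ.prems consider "K' = SEQ p q # K" | "K' \<in> conts p (q # K)" | "K' \<in> conts q K"
    by auto
  then show ?case
  proof cases
    case 1
    then show ?thesis using conts_self[of p "q # K"] by auto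
  next
    case 2
    then show ?thesis using SEQ.IH(1)[of "q # K"] conts_self[of q K] by auto
  next
    case 3
    then show ?thesis using SEQ.IH(2)[of K] by auto
  qed
next
  case (IF i A p q)
  from IF.prems consider "K' = IF i A p q # K" | "K' \<in> conts p K" | "K' \<in> conts q K"
    by auto
  then show ?case
  proof cases
    case 1
    then show ?thesis using conts_self[of p K] conts_self[of q K] by auto
  next
    case 2
    then show ?thesis using IF.IH(1)[of K] by auto
  next
    case 3
    then show ?thesis using IF.IH(2)[of K] by auto
  qed
next
  case (WHILE i A p)
  from WHILE.prems consider "K' = WHILE i A p # K" | "K' \<in> conts p (WHILE i A p # K)"
    by auto
  then show ?case
  proof cases
    case 1
    then show ?thesis using conts_self[of p "WHILE i A p # K"] by auto
  next
    case 2
    then show ?thesis using WHILE.IH[of "WHILE i A p # K"] by auto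
  qed
qed auto

text \<open>The top of a stack is under the head, and the stack extends to the right.\<close>

fun tape_rep :: "tape \<Rightarrow> nat list \<Rightarrow> bool" where
  "tape_rep (c, h) u \<longleftrightarrow> (\<forall>j. c (h + int j) = (if j < length u then u ! j else 0))"

definition store_rep :: "tape list \<Rightarrow> store \<Rightarrow> bool" where
  "store_rep ts s \<longleftrightarrow> length ts = 4 \<and> (\<forall>i<4. tape_rep (ts ! i) (s i))"

lemma tape_rep_read: "tape_rep t u \<Longrightarrow> read t = top_of u"
  by (cases t; cases u) (auto dest: spec[of _ 0])

lemma tape_rep_stay: "act (read t, Stay) t = t"
  by (cases t) auto

lemma tape_rep_pop:
  assumes "tape_rep t u"
  shows "tape_rep (act (read t, MoveRight) t) (tl u)"
proof (cases t)
  case (Pair c h)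
  have "c (h + 1 + int j) = (if j < length (tl u) then tl u ! j else 0)" for j
    using assms[unfolded Pair tape_rep.simps, rule_format, of "Suc j"]
    by (cases u) (auto simp: algebra_simps)
  then show ?thesis by (simp add: Pair)
qed

lemma tape_rep_push:
  assumes "tape_rep t u"
  shows "tape_rep (act (x, Stay) (act (read t, MoveLeft) t)) (x # u)"
proof (cases t)
  case (Pair c h)
  have "(c(h - 1 := x)) (h - 1 + int j) = (if j < length (x # u) then (x # u) ! j else 0)" for j
    using assms[unfolded Pair tape_rep.simps, rule_format, of "j - 1"]
    by (cases j) (auto simp: algebra_simps)
  then show ?thesis by (simp add: Pair)
qed

definition symbol :: "bool \<Rightarrow> nat" where
  "symbol b = (if b then 2 else 1)"

lemma tape_rep_input: "tape_rep (input_tape w) (map symbol w)"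
  by (auto simp: input_tape_def symbol_def)

lemma tape_rep_act_stay:
  assumes "tape_rep t u" and "a = top_of u"
  shows "tape_rep (act (a, Stay) t) u"
  using assms tape_rep_read[OF assms(1)] tape_rep_stay[of t] by simp

section \<open>The compiled machine and its simulation of programs\<close>

definition init_store :: "nat list \<Rightarrow> store" where
  "init_store u = (\<lambda>_. [])(0 := u)"

text \<open>States 0 and 1 give the verdict; \<open>e\<close> numbers the continuations from 2 on.
  The empty continuation makes one more step, which inspects the top of stack 0: symbol 2 accepts,
  because the serialisation of a node, hence of \<open>True\<close>, starts with 2 and that of a
  leaf with 1.\<close>

definition stack_tm :: "prog \<Rightarrow> (prog list \<Rightarrow> nat) \<Rightarrow> prog list set \<Rightarrow> tm" where
  "stack_tm P e CS =
     \<lparr> num_tapes = 4, num_states = 2 + card CS, num_syms = 3, start = e [P], acc = 0, rej = 1,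
       delta = (\<lambda>q ss.
         if q < 2 then (q, map (\<lambda>a. (a, Stay)) ss)
         else let K = the_inv_into CS e q in
           (if K = [] then (if ss ! 0 = 2 then 0 else 1) else e (next_cont K ss),
            map (\<lambda>j. head_action K j (ss ! j)) [0..<4])) \<rparr>"

locale stack_machine =
  fixes P :: prog and e :: "prog list \<Rightarrow> nat" and CS :: "prog list set"
  assumes CS: "CS = insert [] (conts P [])" and e: "bij_betw e CS {2..<2 + card CS}"
begin

abbreviation "M \<equiv> stack_tm P e CS"

lemma inv_e: "K \<in> CS \<Longrightarrow> the_inv_into CS e (e K) = K"
  using e by (auto simp: bij_betw_def the_inv_into_f_f)

lemma e_range: "K \<in> CS \<Longrightarrow> 2 \<le> e K \<and> e K < 2 + card CS"
  using e by (auto simp: bij_betw_def)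

lemma inv_e_in: "2 \<le> q \<Longrightarrow> q < 2 + card CS \<Longrightarrow> the_inv_into CS e q \<in> CS"
  using e unfolding bij_betw_def by (intro the_inv_into_into) auto

lemma CS_closed: "K \<in> CS \<Longrightarrow> next_cont K ss \<in> CS"
  using conts_closed[of K P "[]" ss] unfolding CS by auto

lemma wf_machine: "wf_tm M"
proof -
  have hd: "fst (head_action K j a) < 3" if "a < 3" for K j a
    using that by (induction K j a rule: head_action.induct) auto
  have P_in: "[P] \<in> CS" using conts_self[of P "[]"] by (simp add: CS)
  have "fst (delta M q ss) < num_states M"
      "fst ` set (snd (delta M q ss)) \<subseteq> {..<3}" "length (snd (delta M q ss)) = 4"
    if q: "q < num_states M" and ss: "length ss = 4" "set ss \<subseteq> {..<3}" for q ss
  proof -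
    have nth: "ss ! j < 3" if "j < 4" for j
      using ss that by (metis lessThan_iff nth_mem subsetD)
    show "fst ` set (snd (delta M q ss)) \<subseteq> {..<3}"
      using ss(2) by (auto simp: stack_tm_def Let_def simp del: upt_rec_numeral intro!: hd nth)
    show "length (snd (delta M q ss)) = 4"
      using ss(1) by (simp add: stack_tm_def Let_def)
    show "fst (delta M q ss) < num_states M"
    proof (cases "q < 2")
      case False
      then have "the_inv_into CS e q \<in> CS"
        using q by (intro inv_e_in) (auto simp: stack_tm_def)
      then show ?thesis
        using False CS_closed[of "the_inv_into CS e q" ss] e_range
        by (auto simp: stack_tm_def Let_def)
    qed (auto simp: stack_tm_def)
  qed
  moreover have "e [P] < 2 + card CS" using e_range[OF P_in] by simp
  ultimately show ?thesis unfolding wf_tm_def by (auto simp: stack_tm_def)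
qed

lemma step_machine:
  assumes "K \<in> CS" "K \<noteq> []" "store_rep ts s"
  shows "step M (e K, ts) =
    (e (next_cont K (map (\<lambda>i. top_of (s i)) [0..<4])),
     map (\<lambda>j. act (head_action K j (top_of (s j))) (ts ! j)) [0..<4])"
proof -
  have reads: "map read ts = map (\<lambda>i. top_of (s i)) [0..<4]"
    using assms(3) by (intro nth_equalityI) (auto simp: store_rep_def tape_rep_read)
  have len: "length ts = 4" using assms(3) by (simp add: store_rep_def)
  have q: "e K \<noteq> 0" "e K \<noteq> 1" "\<not> e K < 2" using e_range[OF assms(1)] by auto
  have dl: "delta M (e K) (map read ts) =
    (e (next_cont K (map (\<lambda>i. top_of (s i)) [0..<4])),
     map (\<lambda>j. head_action K j (top_of (s j))) [0..<4])"
    using q assms(2) inv_e[OF assms(1)] reads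
    by (simp add: stack_tm_def Let_def del: upt_rec_numeral)
  have "map2 act (map (\<lambda>j. head_action K j (top_of (s j))) [0..<4]) ts =
      map (\<lambda>j. act (head_action K j (top_of (s j))) (ts ! j)) [0..<4]"
    using len by (intro nth_equalityI) (auto simp del: upt_rec_numeral)
  with q dl show ?thesis by (simp add: stack_tm_def del: upt_rec_numeral)
qed

lemma step_machine_idle:
  assumes "K \<in> CS" "K \<noteq> []" "store_rep ts s" "\<And>j a. head_action K j a = (a, Stay)"
  shows "step M (e K, ts) = (e (next_cont K (map (\<lambda>i. top_of (s i)) [0..<4])), ts)"
proof -
  have "map (\<lambda>j. act (head_action K j (top_of (s j))) (ts ! j)) [0..<4] = ts"
  proof (intro nth_equalityI)
    fix i assume "i < length (map (\<lambda>j. act (head_action K j (top_of (s j))) (ts ! j)) [0..<4])"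
    then have "i < 4" by simp
    then have "top_of (s i) = read (ts ! i)"
      using assms(3) tape_rep_read[of "ts ! i" "s i"] by (simp add: store_rep_def)
    with \<open>i < 4\<close>
    show "map (\<lambda>j. act (head_action K j (top_of (s j))) (ts ! j)) [0..<4] ! i = ts ! i"
      by (simp add: assms(4) tape_rep_stay del: upt_rec_numeral)
  qed (use assms(3) in \<open>auto simp: store_rep_def\<close>)
  with step_machine[OF assms(1-3)] show ?thesis by simp
qed

text \<open>The costs in \<open>exec\<close> were chosen as the exact numbers of machine steps, so
  the induction over \<open>exec\<close> can count steps without slack. The hypotheses on
  \<open>CS\<close> keep every intermediate continuation inside the numbering, where
  \<open>the_inv_into\<close> recovers it.\<close>

lemma exec_simulation:
  assumes "exec p s t s'" "conts p K \<subseteq> CS" "K \<in> CS" "store_rep ts s"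
  shows "\<exists>ts'. (step M ^^ t) (e (p # K), ts) = (e K, ts') \<and> store_rep ts' s'"
  using assms
proof (induction arbitrary: K ts rule: exec.induct)
  case (1 i x s)
  let ?ts = "map (\<lambda>j. act (head_action (PUSH i x # K) j (top_of (s j))) (ts ! j)) [0..<4]"
  let ?ts' = "map (\<lambda>j. act (head_action (PUT i x # K) j (read (?ts ! j))) (?ts ! j)) [0..<4]"
  have in1: "PUSH i x # K \<in> CS" and in2: "PUT i x # K \<in> CS" using 1 by auto
  have rd: "top_of (s j) = read (ts ! j)" if "j < 4" for j
    using 1(5) that tape_rep_read[of "ts ! j" "s j"] by (simp add: store_rep_def)
  have s1: "step M (e (PUSH i x # K), ts) = (e (PUT i x # K), ?ts)"
    using step_machine[OF in1 _ 1(5)] by simp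
  have q: "e (PUT i x # K) \<noteq> 0" "e (PUT i x # K) \<noteq> 1" "\<not> e (PUT i x # K) < 2"
    using e_range[OF in2] by auto
  have "map2 act (map (\<lambda>j. head_action (PUT i x # K) j (map read ?ts ! j)) [0..<4]) ?ts = ?ts'"
    by (intro nth_equalityI) (auto simp del: upt_rec_numeral)
  then have s2: "step M (e (PUT i x # K), ?ts) = (e K, ?ts')"
    using q inv_e[OF in2] by (simp add: stack_tm_def Let_def del: upt_rec_numeral)
  have "tape_rep (?ts' ! j) ((s(i := x # s i)) j)" if j: "j < 4" for j
  proof (cases "j = i")
    case True
    have "tape_rep (act (x mod 3, Stay) (act (read (ts ! i), MoveLeft) (ts ! i))) (x mod 3 # s i)"
      using 1 by (intro tape_rep_push) (auto simp: store_rep_def)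
    then show ?thesis using True j rd 1(2) by (simp del: upt_rec_numeral)
  next
    case False
    have "tape_rep (ts ! j) (s j)" using 1(5) j by (simp add: store_rep_def)
    then show ?thesis using False j rd by (simp add: tape_rep_stay del: upt_rec_numeral)
  qed
  then have "store_rep ?ts' (s(i := x # s i))"
    by (simp add: store_rep_def del: upt_rec_numeral)
  moreover have "(step M ^^ 2) (e (PUSH i x # K), ts) = (e K, ?ts')"
    by (simp only: numeral_2_eq_2 funpow.simps o_apply id_apply s1 s2)
  ultimately show ?case by blast
next
  case (2 i s)
  let ?ts = "map (\<lambda>j. act (head_action (POP i # K) j (top_of (s j))) (ts ! j)) [0..<4]"
  have in1: "POP i # K \<in> CS" using 2 by auto
  have s1: "step M (e (POP i # K), ts) = (e K, ?ts)"
    using step_machine[OF in1 _ 2(4)] by simp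
  have "tape_rep (?ts ! j) ((s(i := tl (s i))) j)" if j: "j < 4" for j
  proof -
    have r: "tape_rep (ts ! j) (s j)" using 2(4) j by (simp add: store_rep_def)
    show ?thesis
      using j tape_rep_pop[OF r] tape_rep_read[OF r] tape_rep_act_stay[OF r] r
      by (auto simp del: upt_rec_numeral)
  qed
  then have "store_rep ?ts (s(i := tl (s i)))"
    by (simp add: store_rep_def del: upt_rec_numeral)
  moreover have "(step M ^^ 1) (e (POP i # K), ts) = (e K, ?ts)"
    by (simp only: One_nat_def funpow.simps o_apply id_apply s1)
  ultimately show ?case by blast
next
  case (3 s)
  have "step M (e (SKIP # K), ts) = (e K, ts)"
    using step_machine_idle[OF _ _ 3(3), of "SKIP # K"] 3 by simp
  with 3 show ?case by auto
next
  case (4 p s t1 s1 q t2 s2)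
  have in1: "SEQ p q # K \<in> CS" and in2: "q # K \<in> CS"
    using 4(5) conts_self[of q K] by auto
  have a: "step M (e (SEQ p q # K), ts) = (e (p # q # K), ts)"
    using step_machine_idle[OF in1 _ 4(7)] by simp
  obtain ts1 where b: "(step M ^^ t1) (e (p # q # K), ts) = (e (q # K), ts1)" "store_rep ts1 s1"
    using "4.IH"(1)[OF _ in2 "4.prems"(3)] "4.prems"(1) by auto
  obtain ts2 where c: "(step M ^^ t2) (e (q # K), ts1) = (e K, ts2)" "store_rep ts2 s2"
    using "4.IH"(2)[OF _ "4.prems"(2) b(2)] "4.prems"(1) by auto
  have "(step M ^^ Suc (t1 + t2)) (e (SEQ p q # K), ts) = (step M ^^ (t2 + t1)) (e (p # q # K), ts)"
    using a by (simp add: funpow_swap1 add.commute del: step.simps)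
  with b c show ?case by (auto simp: funpow_add simp del: step.simps)
next
  case (5 i s A p t s' q)
  have in1: "IF i A p q # K \<in> CS" using 5 by auto
  have a: "step M (e (IF i A p q # K), ts) = (e (p # K), ts)"
    using step_machine_idle[OF in1 _ 5(7)] 5(1,2) by (simp del: upt_rec_numeral)
  obtain ts1 where "(step M ^^ t) (e (p # K), ts) = (e K, ts1)" "store_rep ts1 s'"
    using "5.IH"[OF _ "5.prems"(2,3)] "5.prems"(1) by auto
  with a show ?case by (auto simp: funpow_swap1 simp del: step.simps)
next
  case (6 i s A q t s' p)
  have in1: "IF i A p q # K \<in> CS" using 6 by auto
  have a: "step M (e (IF i A p q # K), ts) = (e (q # K), ts)"
    using step_machine_idle[OF in1 _ 6(7)] 6(1,2) by (simp del: upt_rec_numeral)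
  obtain ts1 where "(step M ^^ t) (e (q # K), ts) = (e K, ts1)" "store_rep ts1 s'"
    using "6.IH"[OF _ "6.prems"(2,3)] "6.prems"(1) by auto
  with a show ?case by (auto simp: funpow_swap1 simp del: step.simps)
next
  case (7 i s A p)
  have in1: "WHILE i A p # K \<in> CS" using 7 by auto
  have "step M (e (WHILE i A p # K), ts) = (e K, ts)"
    using step_machine_idle[OF in1 _ 7(5)] 7(1,2) by (simp del: upt_rec_numeral)
  with 7 show ?case by auto
next
  case (8 i s A p t1 s1 t2 s2)
  let ?W = "WHILE i A p"
  have in1: "?W # K \<in> CS" using 8 by auto
  have a: "step M (e (?W # K), ts) = (e (p # ?W # K), ts)"
    using step_machine_idle[OF in1 _ 8(9)] 8(1,2) by (simp del: upt_rec_numeral)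
  obtain ts1 where b: "(step M ^^ t1) (e (p # ?W # K), ts) = (e (?W # K), ts1)" "store_rep ts1 s1"
    using "8.IH"(1)[OF _ in1 "8.prems"(3)] "8.prems"(1) by auto
  obtain ts2 where c: "(step M ^^ t2) (e (?W # K), ts1) = (e K, ts2)" "store_rep ts2 s2"
    using "8.IH"(2)[OF "8.prems"(1,2) b(2)] by auto
  have "(step M ^^ Suc (t1 + t2)) (e (?W # K), ts) = (step M ^^ (t2 + t1)) (e (p # ?W # K), ts)"
    using a by (simp add: funpow_swap1 add.commute del: step.simps)
  with b c show ?case by (auto simp: funpow_add simp del: step.simps)
qed

text \<open>The strict inequality leaves room for the step that leaves the empty continuation; after
  it the machine has halted and the verdict persists.\<close>

lemma machine_run:
  assumes "exec P (init_store (map symbol w)) t s'" "t < T"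
  shows "fst ((step M ^^ T) (init_config M w)) = (if top_of (s' 0) = 2 then acc M else rej M)"
proof -
  have rep: "store_rep (snd (init_config M w)) (init_store (map symbol w))"
  proof -
    have "tape_rep ((input_tape w # replicate 3 (input_tape [])) ! i) (init_store (map symbol w) i)"
      if "i < 4" for i
      using that tape_rep_input[of w] tape_rep_input[of "[]"]
      by (cases i) (auto simp: init_store_def)
    then show ?thesis by (simp add: store_rep_def init_config_def stack_tm_def)
  qed
  have st: "init_config M w = (e [P], snd (init_config M w))"
    by (simp add: init_config_def stack_tm_def)
  obtain ts' where ts': "(step M ^^ t) (init_config M w) = (e [], ts')" "store_rep ts' s'"
    using exec_simulation[OF assms(1) _ _ rep, of "[]"] st by (auto simp: CS)
  have nil: "[] \<in> CS" by (simp add: CS)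
  have q: "e [] \<noteq> 0" "e [] \<noteq> 1" "\<not> e [] < 2" using e_range[OF nil] by auto
  have rd: "map read ts' ! 0 = top_of (s' 0)"
    using ts'(2) tape_rep_read by (simp add: store_rep_def)
  define fin where "fin = (if top_of (s' 0) = 2 then acc M else rej M)"
  have fst_fin: "fst (step M (e [], ts')) = fin"
    using q inv_e[OF nil] rd
    by (simp add: fin_def stack_tm_def Let_def split_beta)
  have stay: "fst ((step M ^^ n) c) = fin" if "fst c = fin" for n c
  proof (induction n)
    case (Suc n)
    then have "step M ((step M ^^ n) c) = (step M ^^ n) c"
      by (cases "(step M ^^ n) c") (auto simp: fin_def split: if_splits)
    with Suc show ?case by simp
  qed (use that in simp)
  obtain n where "T = n + Suc t" using assms(2) less_iff_Suc_add by (metis add.commute add_Suc_right)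
  then have "(step M ^^ T) (init_config M w) = (step M ^^ n) (step M (e [], ts'))"
    by (simp only: funpow_add funpow.simps o_apply ts'(1))
  with stay[OF fst_fin] show ?thesis by (simp add: fin_def)
qed

end

lemma P_class_prog:
  assumes "\<And>w. \<exists>t s'. exec P (init_store (map symbol w)) t s' \<and> t \<le> poly q (length w) \<and>
    (top_of (s' 0) = 2 \<longleftrightarrow> w \<in> L)"
  shows "L \<in> P_class"
proof -
  define CS where "CS = insert [] (conts P [])"
  have "finite CS" by (simp add: CS_def finite_conts)
  then obtain e where "bij_betw e CS {0..<card CS}" using ex_bij_betw_finite_nat by blast
  moreover have "bij_betw (\<lambda>n. n + 2) {0..<card CS} {2..<2 + card CS}"
    by (rule bij_betw_byWitness[where f' = "\<lambda>n. n - 2"]) auto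
  ultimately have "bij_betw ((\<lambda>n. n + 2) \<circ> e) CS {2..<2 + card CS}" by (rule bij_betw_trans)
  then interpret stack_machine P "(\<lambda>n. n + 2) \<circ> e" CS
    by unfold_locales (simp_all add: CS_def)
  \<comment> \<open>The added 1 turns the bound on \<open>t\<close> into the strict one that the
    verdict step requires.\<close>
  have "decides_in_time M L (poly (q + 1))"
    unfolding decides_in_time_def
  proof
    fix w
    obtain t s' where *: "exec P (init_store (map symbol w)) t s'" "t \<le> poly q (length w)"
      "top_of (s' 0) = 2 \<longleftrightarrow> w \<in> L" using assms by blast
    show "fst ((step M ^^ poly (q + 1) (length w)) (init_config M w)) = (if w \<in> L then acc M else rej M)"
      using machine_run[OF *(1), of "poly (q + 1) (length w)"] *(2,3) by simp
  qed
  with wf_machine show ?thesis unfolding P_class_def by blast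
qed

section \<open>Polynomial-time functions on trees\<close>

datatype tree = Lf | Nd tree tree

fun ser :: "tree \<Rightarrow> nat list" where
  "ser Lf = [1]"
| "ser (Nd a b) = 2 # ser a @ ser b"

lemma ser_prefix: "ser x @ u = ser y @ v \<Longrightarrow> x = y \<and> u = v"
proof (induction x arbitrary: y u v)
  case Lf
  then show ?case by (cases y) auto
next
  case (Nd a b)
  from Nd.prems obtain c d where y: "y = Nd c d" by (cases y) auto
  from Nd.prems y have "ser a @ (ser b @ u) = ser c @ (ser d @ v)" by simp
  from Nd.IH(1)[OF this] have "a = c" "ser b @ u = ser d @ v" by auto
  with Nd.IH(2) y show ?case by blast
qed

lemma ser_inj: "ser x = ser y \<longleftrightarrow> x = y"
  using ser_prefix[of x "[]" y "[]"] by auto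

lemma set_ser: "set (ser x) \<subseteq> {1, 2}"
  by (induction x) auto

lemma poly_nat_mono: "m \<le> n \<Longrightarrow> poly (p :: nat poly) m \<le> poly p n"
  by (induction p) (auto intro!: add_mono mult_mono)

text \<open>Exact times matter only for the simulation; from here on costs may be rounded
  up.\<close>

definition runs :: "prog \<Rightarrow> store \<Rightarrow> nat \<Rightarrow> store \<Rightarrow> bool" where
  "runs p s t s' \<longleftrightarrow> (\<exists>t'\<le>t. exec p s t' s')"

lemma runs_mono: "runs p s t s' \<Longrightarrow> t \<le> t' \<Longrightarrow> runs p s t' s'"
  unfolding runs_def using le_trans by blast

lemma runs_PUSH: "i < 4 \<Longrightarrow> x < 3 \<Longrightarrow> runs (PUSH i x) s 2 (s(i := x # s i))"
  unfolding runs_def using exec.intros(1) by blast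

lemma runs_POP: "i < 4 \<Longrightarrow> runs (POP i) s 1 (s(i := tl (s i)))"
  unfolding runs_def using exec.intros(2) by blast

lemma runs_SKIP: "runs SKIP s 1 s"
  unfolding runs_def using exec.intros(3) by blast

lemma runs_SEQ: "runs p s t1 s1 \<Longrightarrow> runs q s1 t2 s2 \<Longrightarrow> runs (SEQ p q) s (Suc (t1 + t2)) s2"
  unfolding runs_def using exec.intros(4) by (meson Suc_le_mono add_mono)

lemma runs_IF:
  "i < 4 \<Longrightarrow> (top_of (s i) \<in> A \<Longrightarrow> runs p s t s') \<Longrightarrow> (top_of (s i) \<notin> A \<Longrightarrow> runs q s t s') \<Longrightarrow>
    runs (IF i A p q) s (Suc t) s'"
  unfolding runs_def by (cases "top_of (s i) \<in> A") (auto intro: exec.intros)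

lemma runs_WHILE_end: "i < 4 \<Longrightarrow> top_of (s i) \<notin> A \<Longrightarrow> runs (WHILE i A p) s 1 s"
  unfolding runs_def using exec.intros(7) by blast

lemma runs_WHILE_step:
  "i < 4 \<Longrightarrow> top_of (s i) \<in> A \<Longrightarrow> runs p s t1 s1 \<Longrightarrow> runs (WHILE i A p) s1 t2 s2 \<Longrightarrow>
    runs (WHILE i A p) s (Suc (t1 + t2)) s2"
  unfolding runs_def using exec.intros(8) by (meson Suc_le_mono add_mono)

lemma runs_eq: "runs p s t s1 \<Longrightarrow> t \<le> t' \<Longrightarrow> s1 = s2 \<Longrightarrow> runs p s t' s2"
  using runs_mono by blast

definition stores :: "nat list \<Rightarrow> nat list \<Rightarrow> nat list \<Rightarrow> nat list \<Rightarrow> store" where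
  "stores a b c d = (\<lambda>_. [])(0 := a, 1 := b, 2 := c, 3 := d)"

lemma stores_apply [simp]:
  "stores a b c d 0 = a" "stores a b c d (Suc 0) = b" "stores a b c d 2 = c" "stores a b c d 3 = d"
  by (simp_all add: stores_def)

lemma stores_upd [simp]:
  "(stores a b c d)(0 := x) = stores x b c d" "(stores a b c d)(Suc 0 := x) = stores a x c d"
  "(stores a b c d)(2 := x) = stores a b x d" "(stores a b c d)(3 := x) = stores a b c x"
  by (auto simp: stores_def)

lemma init_store_eq: "init_store u = stores u [] [] []"
  by (auto simp: init_store_def stores_def)

subsection \<open>Moving trees between stacks\<close>

definition MOVE :: "nat \<Rightarrow> nat \<Rightarrow> prog" where
  "MOVE i j = WHILE i {1, 2}
     (IF i {2} (SEQ (POP i) (PUSH j 2)) (SEQ (POP i) (PUSH j 1)))"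

text \<open>Six steps per symbol: one each for \<open>WHILE\<close>, \<open>IF\<close>,
  \<open>SEQ\<close> and \<open>POP\<close>, two for \<open>PUSH\<close>. One more step leaves the
  loop.\<close>

lemma runs_MOVE:
  assumes "i < 4" "j < 4" "i \<noteq> j" "set (s i) \<subseteq> {1, 2}"
  shows "runs (MOVE i j) s (6 * length (s i) + 1) (s(i := [], j := rev (s i) @ s j))"
  using assms(4)
proof (induction "s i" arbitrary: s)
  case Nil
  then have eq: "s = s(i := [], j := rev (s i) @ s j)" by auto
  have "runs (MOVE i j) s 1 s"
    unfolding MOVE_def by (rule runs_WHILE_end) (use Nil(1)[symmetric] assms in auto)
  then show ?case by (rule runs_eq[OF _ _ eq]) simp
next
  case (Cons x u)
  let ?s = "s(i := u, j := x # s j)"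
  have x: "x = 1 \<or> x = 2" and u: "set u \<subseteq> {1, 2}" using Cons(3) unfolding Cons(2)[symmetric] by auto
  have pp: "runs (SEQ (POP i) (PUSH j x)) s 4 ?s"
    by (rule runs_eq[OF runs_SEQ[OF runs_POP runs_PUSH]])
      (use assms x Cons(2)[symmetric] in auto)
  have body: "runs (IF i {2} (SEQ (POP i) (PUSH j 2)) (SEQ (POP i) (PUSH j 1))) s 5 ?s"
    by (rule runs_eq[OF runs_IF[where t = 4]]) (use x pp assms Cons(2)[symmetric] in auto)
  have rest: "runs (MOVE i j) ?s (6 * length (?s i) + 1) (?s(i := [], j := rev (?s i) @ ?s j))"
    by (rule Cons(1)) (use assms u in auto)
  have "runs (MOVE i j) s (Suc (5 + (6 * length (?s i) + 1))) (?s(i := [], j := rev (?s i) @ ?s j))"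
    unfolding MOVE_def
    by (rule runs_WHILE_step[OF _ _ body])
      (use rest x assms Cons(2)[symmetric] in \<open>auto simp: MOVE_def\<close>)
  then show ?case
    by (rule runs_eq) (use assms Cons(2)[symmetric] in auto)
qed

text \<open>
  Stack 2 counts, in unary, the trees that remain to be read: a node adds one and a leaf
  subtracts one.
\<close>

definition TAKE_loop :: "nat \<Rightarrow> prog \<Rightarrow> prog \<Rightarrow> prog" where
  "TAKE_loop i p1 p2 = WHILE 2 {1} (IF i {2} (SEQ (POP i) (SEQ p2 (PUSH 2 1)))
     (SEQ (POP i) (SEQ p1 (POP 2))))"

text \<open>Reading a subtree does not end the loop, so an induction on \<open>x\<close> cannot
  speak of complete runs of the loop. The lemma goes backwards instead: a run that starts behind
  \<open>x\<close> is extended to one that starts before \<open>x\<close>. At a node the right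
  subtree is put in front first, then the left one. The programs \<open>p1\<close> and
  \<open>p2\<close> stay abstract to cover both copying and discarding.\<close>

lemma runs_TAKE_loop:
  assumes i: "i < 4" "i \<noteq> 2" "i \<noteq> j" "j \<noteq> 2"
    and p1: "\<And>s. runs p1 s 2 (s(j := f 1 (s j)))" and p2: "\<And>s. runs p2 s 2 (s(j := f 2 (s j)))"
    and "s i = ser x @ r" "s 2 = replicate (Suc m) 1"
    and "runs (TAKE_loop i p1 p2) (s(i := r, j := fold f (ser x) (s j), 2 := replicate m 1)) t s'"
  shows "runs (TAKE_loop i p1 p2) s (t + 9 * length (ser x)) s'"
  using assms(7-)
proof (induction x arbitrary: s r m t)
  case Lf
  let ?s = "s(i := r, j := f 1 (s j), 2 := replicate m 1)"
  have "runs (SEQ (POP i) (SEQ p1 (POP 2))) s 6 ?s"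
    by (rule runs_eq[OF runs_SEQ[OF runs_POP[OF i(1)] runs_SEQ[OF p1 runs_POP]]])
      (use i Lf in \<open>auto simp: fun_eq_iff\<close>)
  then have "runs (IF i {2} (SEQ (POP i) (SEQ p2 (PUSH 2 1))) (SEQ (POP i) (SEQ p1 (POP 2)))) s (Suc 6) ?s"
    by (rule runs_IF[rotated 2]) (use i Lf in auto)
  moreover have "runs (TAKE_loop i p1 p2) ?s t s'"
    using Lf.prems(3) by (simp del: fun_upd_apply)
  ultimately have "runs (TAKE_loop i p1 p2) s (Suc (Suc 6 + t)) s'"
    unfolding TAKE_loop_def by (intro runs_WHILE_step) (use Lf.prems(2) in auto)
  then show ?case by (rule runs_mono) simp
next
  case (Nd a b)
  let ?s = "s(i := ser a @ ser b @ r, j := f 2 (s j), 2 := replicate (Suc (Suc m)) 1)"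
  let ?u = "?s(i := ser b @ r, j := fold f (ser a) (?s j), 2 := replicate (Suc m) 1)"
  have "runs (SEQ (POP i) (SEQ p2 (PUSH 2 1))) s 7 ?s"
    by (rule runs_eq[OF runs_SEQ[OF runs_POP[OF i(1)] runs_SEQ[OF p2 runs_PUSH]]])
      (use i Nd in \<open>auto simp: fun_eq_iff\<close>)
  then have body: "runs (IF i {2} (SEQ (POP i) (SEQ p2 (PUSH 2 1))) (SEQ (POP i) (SEQ p1 (POP 2)))) s (Suc 7) ?s"
    by (rule runs_IF[rotated 1]) (use i Nd in auto)
  have 1: "?u(i := r, j := fold f (ser b) (?u j), 2 := replicate m 1) =
    s(i := r, j := fold f (ser (Nd a b)) (s j), 2 := replicate m 1)"
    using i by (auto simp: fun_eq_iff)
  have "runs (TAKE_loop i p1 p2) ?u (t + 9 * length (ser b)) s'"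
  proof (rule Nd.IH(2)[where r = r and m = m])
    show "runs (TAKE_loop i p1 p2) (?u(i := r, j := fold f (ser b) (?u j), 2 := replicate m 1)) t s'"
      unfolding 1 by (rule Nd.prems(3))
  qed (use i in auto)
  then have "runs (TAKE_loop i p1 p2) ?s (t + 9 * length (ser b) + 9 * length (ser a)) s'"
    by (rule Nd.IH(1)[rotated 2]) (use i in auto)
  then have "runs (TAKE_loop i p1 p2) s (Suc (Suc 7 + (t + 9 * length (ser b) + 9 * length (ser a)))) s'"
    unfolding TAKE_loop_def
    by (intro runs_WHILE_step[OF _ _ body]) (use Nd.prems(2) in auto)
  then show ?case by (rule runs_mono) simp
qed

lemma runs_TAKE:
  assumes "i < 4" "i \<noteq> 2" "i \<noteq> j" "j \<noteq> 2"
    and "\<And>s. runs p1 s 2 (s(j := f 1 (s j)))" and "\<And>s. runs p2 s 2 (s(j := f 2 (s j)))"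
    and "s i = ser x @ r" "s 2 = []"
  shows "runs (SEQ (PUSH 2 1) (TAKE_loop i p1 p2)) s (9 * length (ser x) + 4)
    (s(i := r, j := fold f (ser x) (s j)))"
proof -
  let ?s = "s(2 := [1])" and ?s' = "s(i := r, j := fold f (ser x) (s j))"
  have "runs (TAKE_loop i p1 p2) ?s' 1 ?s'"
    unfolding TAKE_loop_def by (rule runs_WHILE_end) (use assms in auto)
  moreover have "?s(i := r, j := fold f (ser x) (?s j), 2 := replicate 0 1) = ?s'"
    using assms by (auto simp: fun_eq_iff)
  ultimately have "runs (TAKE_loop i p1 p2) ?s (1 + 9 * length (ser x)) ?s'"
    by (intro runs_TAKE_loop[where m = 0 and r = r and f = f and j = j]) (use assms in auto)
  moreover have "runs (PUSH 2 1) s 2 ?s"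
    by (rule runs_eq[OF runs_PUSH]) (use assms in auto)
  ultimately show ?thesis by (intro runs_eq[OF runs_SEQ]) auto
qed

definition TAKE :: "nat \<Rightarrow> prog" where
  "TAKE j = SEQ (PUSH 2 1) (TAKE_loop 0 (PUSH j 1) (PUSH j 2))"

definition DROP :: prog where
  "DROP = SEQ (PUSH 2 1) (TAKE_loop 0 SKIP SKIP)"

lemma fold_Cons_rev: "fold (#) u v = rev u @ v"
  by (induction u arbitrary: v) auto

lemma runs_TAKE1:
  "runs (TAKE 1) (stores (ser x @ r) b [] d) (9 * length (ser x) + 4) (stores r (rev (ser x) @ b) [] d)"
  unfolding TAKE_def
  by (rule runs_eq[OF runs_TAKE[where r = r and f = "(#)" and x = x and j = 1]])
    (auto simp: fold_Cons_rev intro!: runs_PUSH)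

lemma runs_TAKE3:
  "runs (TAKE 3) (stores (ser x @ r) b [] d) (9 * length (ser x) + 4) (stores r b [] (rev (ser x) @ d))"
  unfolding TAKE_def
  by (rule runs_eq[OF runs_TAKE[where r = r and f = "(#)" and x = x and j = 3]])
    (auto simp: fold_Cons_rev intro!: runs_PUSH)

lemma runs_DROP: "runs DROP (init_store (ser x @ r)) (9 * length (ser x) + 4) (init_store r)"
proof -
  have f: "fold (\<lambda>_ u. u) v w = w" for v :: "nat list" and w :: "nat list"
    by (induction v) auto
  have "runs SKIP s 2 (s(3 := s 3))" for s
    by (rule runs_eq[OF runs_SKIP]) auto
  then show ?thesis unfolding DROP_def
    by (intro runs_eq[OF runs_TAKE[where r = r and f = "\<lambda>_ u. u" and x = x and j = 3]])
      (auto simp: f init_store_eq)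
qed

definition SWAP :: prog where
  "SWAP = SEQ (TAKE 1) (SEQ (TAKE 3) (SEQ (MOVE 1 0) (MOVE 3 0)))"

lemma runs_SWAP:
  "runs SWAP (init_store (ser x @ ser y @ r)) (15 * (length (ser x) + length (ser y)) + 13)
     (init_store (ser y @ ser x @ r))"
proof -
  have 1: "runs (TAKE 1) (init_store (ser x @ ser y @ r)) (9 * length (ser x) + 4)
      (stores (ser y @ r) (rev (ser x)) [] [])"
    unfolding init_store_eq by (rule runs_eq[OF runs_TAKE1]) auto
  have 2: "runs (TAKE 3) (stores (ser y @ r) (rev (ser x)) [] []) (9 * length (ser y) + 4)
      (stores r (rev (ser x)) [] (rev (ser y)))"
    by (rule runs_eq[OF runs_TAKE3]) auto
  have 3: "runs (MOVE 1 0) (stores r (rev (ser x)) [] (rev (ser y))) (6 * length (ser x) + 1)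
      (stores (ser x @ r) [] [] (rev (ser y)))"
    by (rule runs_eq[OF runs_MOVE]) (use set_ser[of x] in \<open>auto\<close>)
  have 4: "runs (MOVE 3 0) (stores (ser x @ r) [] [] (rev (ser y))) (6 * length (ser y) + 1)
      (init_store (ser y @ ser x @ r))"
    unfolding init_store_eq
    by (rule runs_eq[OF runs_MOVE]) (use set_ser[of y] in \<open>auto\<close>)
  show ?thesis unfolding SWAP_def
    by (rule runs_eq[OF runs_SEQ[OF 1 runs_SEQ[OF 2 runs_SEQ[OF 3 4]]]]) auto
qed

definition COPY :: prog where
  "COPY = WHILE 1 {1, 2} (IF 1 {2} (SEQ (POP 1) (SEQ (PUSH 0 2) (PUSH 2 2)))
     (SEQ (POP 1) (SEQ (PUSH 0 1) (PUSH 2 1))))"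

lemma runs_COPY:
  assumes "set u \<subseteq> {1, 2}"
  shows "runs COPY (stores a u c d) (9 * length u + 1) (stores (rev u @ a) [] (rev u @ c) d)"
  using assms
proof (induction u arbitrary: a c)
  case Nil
  show ?case unfolding COPY_def by (rule runs_eq[OF runs_WHILE_end]) auto
next
  case (Cons x u)
  let ?s = "stores (x # a) u (x # c) d"
  have x: "x = 1 \<or> x = 2" using Cons.prems by auto
  have pp: "runs (SEQ (POP 1) (SEQ (PUSH 0 x) (PUSH 2 x))) (stores a (x # u) c d) 7 ?s"
    by (rule runs_eq[OF runs_SEQ[OF runs_POP runs_SEQ[OF runs_PUSH runs_PUSH]]])
      (use x in \<open>auto\<close>)
  have "runs (IF 1 {2} (SEQ (POP 1) (SEQ (PUSH 0 2) (PUSH 2 2))) (SEQ (POP 1) (SEQ (PUSH 0 1) (PUSH 2 1))))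
      (stores a (x # u) c d) 8 ?s"
    by (rule runs_eq[OF runs_IF[where t = 7]]) (use x pp in auto)
  then have "runs COPY (stores a (x # u) c d) (Suc (8 + (9 * length u + 1)))
      (stores (rev u @ x # a) [] (rev u @ x # c) d)"
    unfolding COPY_def
    by (rule runs_WHILE_step[rotated 2])
      (use Cons.IH[of "x # a" "x # c"] x Cons.prems in \<open>auto simp: COPY_def\<close>)
  then show ?case by (rule runs_eq) auto
qed

definition DUP :: prog where
  "DUP = SEQ (TAKE 1) (SEQ COPY (SEQ (MOVE 2 1) (MOVE 1 0)))"

lemma runs_DUP:
  "runs DUP (init_store (ser x @ r)) (30 * length (ser x) + 10) (init_store (ser x @ ser x @ r))"
proof -
  have s: "set (ser x) \<subseteq> {1, 2}" "set (rev (ser x)) \<subseteq> {1, 2}" using set_ser[of x] by auto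
  have 1: "runs (TAKE 1) (init_store (ser x @ r)) (9 * length (ser x) + 4)
      (stores r (rev (ser x)) [] [])"
    unfolding init_store_eq by (rule runs_eq[OF runs_TAKE1]) auto
  have 2: "runs COPY (stores r (rev (ser x)) [] []) (9 * length (ser x) + 1)
      (stores (ser x @ r) [] (ser x) [])"
    by (rule runs_eq[OF runs_COPY[OF s(2)]]) auto
  have 3: "runs (MOVE 2 1) (stores (ser x @ r) [] (ser x) []) (6 * length (ser x) + 1)
      (stores (ser x @ r) (rev (ser x)) [] [])"
    by (rule runs_eq[OF runs_MOVE]) (use s in \<open>auto\<close>)
  have 4: "runs (MOVE 1 0) (stores (ser x @ r) (rev (ser x)) [] []) (6 * length (ser x) + 1)
      (init_store (ser x @ ser x @ r))"
    unfolding init_store_eq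
    by (rule runs_eq[OF runs_MOVE]) (use s in \<open>auto\<close>)
  show ?thesis unfolding DUP_def
    by (rule runs_eq[OF runs_SEQ[OF 1 runs_SEQ[OF 2 runs_SEQ[OF 3 4]]]]) auto
qed

text \<open>
  Equality compares the reversed serialisations on stacks 1 and 3; every mismatch leaves a mark
  on stack 2.
\<close>

definition COMPARE :: prog where
  "COMPARE = WHILE 1 {1, 2}
     (SEQ (IF 1 {1} (IF 3 {1} SKIP (PUSH 2 1)) (IF 3 {2} SKIP (PUSH 2 1))) (SEQ (POP 1) (POP 3)))"

definition mark :: "bool \<Rightarrow> nat list \<Rightarrow> bool" where
  "mark b m \<longleftrightarrow> set m \<subseteq> {1} \<and> (b \<longleftrightarrow> m = [])"

text \<open>If stack 3 runs out first, its top reads 0, which differs from both symbols, so a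
  missing symbol leaves a mark like any other mismatch. A longer stack 3 is not noticed here; its
  rest is returned.\<close>

lemma runs_COMPARE:
  assumes "set u \<subseteq> {1, 2}" "set m \<subseteq> {1}"
  shows "\<exists>m'. runs COMPARE (stores a u m v) (9 * length u + 1) (stores a [] m' (drop (length u) v)) \<and>
    mark (m = [] \<and> take (length u) v = u) m' \<and> length m' \<le> length m + length u"
  using assms
proof (induction u arbitrary: m v)
  case Nil
  have "runs COMPARE (stores a [] m v) 1 (stores a [] m v)"
    unfolding COMPARE_def by (rule runs_WHILE_end) auto
  with Nil show ?case by (auto simp: mark_def)
next
  case (Cons x u)
  have x: "x = 1 \<or> x = 2" using Cons.prems by auto
  define n where "n = (if top_of v = x then m else 1 # m)"
  have i1: "runs (IF 3 {x} SKIP (PUSH 2 1)) (stores a (x # u) m v) 3 (stores a (x # u) n v)"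
    by (rule runs_eq[OF runs_IF[where t = 2]])
      (auto simp: n_def intro: runs_eq[OF runs_PUSH] runs_eq[OF runs_SKIP])
  have i2: "runs (IF 1 {1} (IF 3 {1} SKIP (PUSH 2 1)) (IF 3 {2} SKIP (PUSH 2 1))) (stores a (x # u) m v) 4
      (stores a (x # u) n v)"
    by (rule runs_eq[OF runs_IF[where t = 3]]) (use i1 x in auto)
  have i3: "runs (SEQ (IF 1 {1} (IF 3 {1} SKIP (PUSH 2 1)) (IF 3 {2} SKIP (PUSH 2 1))) (SEQ (POP 1) (POP 3)))
      (stores a (x # u) m v) 8 (stores a u n (tl v))"
    by (rule runs_eq[OF runs_SEQ[OF i2 runs_SEQ[OF runs_POP runs_POP]]]) (auto)
  have un: "set u \<subseteq> {1, 2}" "set n \<subseteq> {1}"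
    using Cons.prems by (auto simp: n_def split: if_splits)
  obtain m' where m': "runs COMPARE (stores a u n (tl v)) (9 * length u + 1)
        (stores a [] m' (drop (length u) (tl v)))"
      "mark (n = [] \<and> take (length u) (tl v) = u) m'" "length m' \<le> length n + length u"
    using Cons.IH[OF un] by blast
  have "runs COMPARE (stores a (x # u) m v) (Suc (8 + (9 * length u + 1)))
      (stores a [] m' (drop (length u) (tl v)))"
    unfolding COMPARE_def
    by (rule runs_WHILE_step[OF _ _ i3]) (use m'(1) x in \<open>auto simp: COMPARE_def\<close>)
  moreover have "(n = [] \<and> take (length u) (tl v) = u) = (m = [] \<and> take (length (x # u)) v = x # u)"
    using x by (cases v) (auto simp: n_def)
  moreover have "drop (length u) (tl v) = drop (length (x # u)) v"
    by (simp add: drop_Suc)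
  moreover have "length n \<le> Suc (length m)" by (simp add: n_def)
  ultimately show ?case using m'(2,3) by (intro exI[of _ m']) (auto elim: runs_eq)
qed

definition CLEAR :: "nat \<Rightarrow> prog" where
  "CLEAR i = WHILE i {1, 2} (POP i)"

lemma runs_CLEAR:
  assumes "i < 4" "set (s i) \<subseteq> {1, 2}"
  shows "runs (CLEAR i) s (2 * length (s i) + 1) (s(i := []))"
  using assms(2)
proof (induction "s i" arbitrary: s)
  case Nil
  then show ?case unfolding CLEAR_def
    by (intro runs_eq[OF runs_WHILE_end]) (use Nil(1)[symmetric] assms in auto)
next
  case (Cons x u)
  have x: "x = 1 \<or> x = 2" "set u \<subseteq> {1, 2}" using Cons(3) unfolding Cons(2)[symmetric] by auto
  have "runs (CLEAR i) (s(i := u)) (2 * length u + 1) (s(i := []))"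
    using Cons(1)[of "s(i := u)"] x(2) by simp
  moreover have "runs (POP i) s 1 (s(i := u))"
    using runs_POP[OF assms(1), of s] Cons(2)[symmetric] by simp
  ultimately have "runs (CLEAR i) s (Suc (1 + (2 * length u + 1))) (s(i := []))"
    unfolding CLEAR_def by (intro runs_WHILE_step) (use assms x Cons(2)[symmetric] in auto)
  then show ?case by (rule runs_eq) (use Cons(2)[symmetric] in auto)
qed

definition EQUAL :: prog where
  "EQUAL = SEQ (TAKE 1) (SEQ (TAKE 3) (SEQ COMPARE (SEQ (IF 3 {1, 2} (PUSH 2 1) SKIP)
     (SEQ (CLEAR 3) (SEQ (PUSH 0 1)
       (IF 2 {1} (CLEAR 2) (SEQ (PUSH 0 1) (PUSH 0 2))))))))"

lemma runs_EQUAL: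
  "runs EQUAL (init_store (ser x @ ser y @ r)) (30 * (length (ser x) + length (ser y)) + 40)
     (init_store (ser (if x = y then Nd Lf Lf else Lf) @ r))"
proof -
  let ?u = "rev (ser x)" and ?v = "rev (ser y)"
  have s: "set ?u \<subseteq> {1, 2}" "set ?v \<subseteq> {1, 2}" using set_ser[of x] set_ser[of y] by auto
  have 1: "runs (TAKE 1) (init_store (ser x @ ser y @ r)) (9 * length (ser x) + 4)
      (stores (ser y @ r) ?u [] [])"
    unfolding init_store_eq by (rule runs_eq[OF runs_TAKE1]) auto
  have 2: "runs (TAKE 3) (stores (ser y @ r) ?u [] []) (9 * length (ser y) + 4)
      (stores r ?u [] ?v)"
    by (rule runs_eq[OF runs_TAKE3]) auto
  obtain m where m: "runs COMPARE (stores r ?u [] ?v) (9 * length ?u + 1) (stores r [] m (drop (length ?u) ?v))"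
      "mark (take (length ?u) ?v = ?u) m" "length m \<le> length ?u"
    using runs_COMPARE[OF s(1), of "[]"] by auto
  define w where "w = drop (length ?u) ?v"
  \<comment> \<open>A nonempty rest on stack 3 means that \<open>ser y\<close> is longer than
    \<open>ser x\<close>; it counts as one more mismatch.\<close>
  define m' where "m' = (if w = [] then m else 1 # m)"
  have w: "set w \<subseteq> {1, 2}" using s(2) unfolding w_def by (meson dual_order.trans set_drop_subset)
  have lw: "length w \<le> length (ser y)" by (simp add: w_def)
  have m'1: "set m' \<subseteq> {1}" "length m' \<le> Suc (length (ser x))"
    using m(2,3) by (auto simp: m'_def mark_def)
  have "m' = [] \<longleftrightarrow> ?u = ?v"
  proof
    assume "m' = []"
    then have "w = []" "take (length ?u) ?v = ?u" using m(2) by (auto simp: m'_def mark_def split: if_splits)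
    then show "?u = ?v" by (metis append_Nil2 append_take_drop_id w_def)
  next
    assume "?u = ?v"
    then show "m' = []" using m(2) by (auto simp: m'_def mark_def w_def)
  qed
  then have m'2: "m' = [] \<longleftrightarrow> x = y" by (simp add: ser_inj)
  have 4: "runs (IF 3 {1, 2} (PUSH 2 1) SKIP) (stores r [] m w) 3 (stores r [] m' w)"
    by (rule runs_eq[OF runs_IF[where t = 2]])
      (use w in \<open>auto simp: m'_def top_of_def intro: runs_eq[OF runs_PUSH] runs_eq[OF runs_SKIP]
        split: list.splits\<close>)
  have 5: "runs (CLEAR 3) (stores r [] m' w) (2 * length (ser y) + 1) (stores r [] m' [])"
    by (rule runs_eq[OF runs_CLEAR]) (use w lw in \<open>auto\<close>)
  have 6: "runs (PUSH 0 1) (stores r [] m' []) 2 (stores (1 # r) [] m' [])"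
    by (rule runs_eq[OF runs_PUSH]) (auto)
  \<comment> \<open>The leaf pushed just before already codes \<open>False\<close>; for
    \<open>True\<close> it becomes the right leaf of a node.\<close>
  have 7: "runs (IF 2 {1} (CLEAR 2) (SEQ (PUSH 0 1) (PUSH 0 2))) (stores (1 # r) [] m' [])
      (2 * length (ser x) + 9) (init_store (ser (if x = y then Nd Lf Lf else Lf) @ r))"
  proof (cases "x = y")
    case True
    then have "m' = []" using m'2 by simp
    have "runs (SEQ (PUSH 0 1) (PUSH 0 2)) (stores (1 # r) [] m' []) 5 (init_store (2 # 1 # 1 # r))"
      by (rule runs_eq[OF runs_SEQ[OF runs_PUSH runs_PUSH]])
        (use \<open>m' = []\<close> in \<open>auto simp: init_store_eq\<close>)
    with True \<open>m' = []\<close> show ?thesis by (intro runs_eq[OF runs_IF[where t = 5]]) auto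
  next
    case False
    then obtain n where n: "m' = 1 # n" using m'2 m'1(1) by (cases m') auto
    have "set m' \<subseteq> {1, 2}" using m'1 by auto
    then have "runs (CLEAR 2) (stores (1 # r) [] m' []) (2 * length (ser x) + 3) (init_store (1 # r))"
      by (intro runs_eq[OF runs_CLEAR]) (use m'1 in \<open>auto simp: init_store_eq\<close>)
    with False n show ?thesis
      by (intro runs_eq[OF runs_IF[where t = "2 * length (ser x) + 3"]]) auto
  qed
  show ?thesis unfolding EQUAL_def
    by (rule runs_eq[OF runs_SEQ[OF 1 runs_SEQ[OF 2 runs_SEQ[OF m(1)[folded w_def]
          runs_SEQ[OF 4 runs_SEQ[OF 5 runs_SEQ[OF 6 7]]]]]]]) auto
qed

section \<open>Loading an input word as a tree\<close>

fun tree_of_bits :: "bool list \<Rightarrow> tree" where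
  "tree_of_bits [] = Lf"
| "tree_of_bits (b # w) = Nd (if b then Nd Lf Lf else Lf) (tree_of_bits w)"

definition LOAD_loop :: prog where
  "LOAD_loop = WHILE 1 {1, 2} (SEQ (IF 1 {2} (SEQ (PUSH 0 1) (SEQ (PUSH 0 1) (PUSH 0 2))) (PUSH 0 1))
     (SEQ (PUSH 0 2) (POP 1)))"

definition LOAD :: prog where
  "LOAD = SEQ (MOVE 0 1) (SEQ (PUSH 0 1) LOAD_loop)"

text \<open>Stack 1 holds the word reversed, so the coded list grows from its last bit to its first,
  which is why the induction removes bits at the end.\<close>

lemma runs_LOAD_loop:
  "runs LOAD_loop (stores (ser (tree_of_bits w)) (map symbol (rev v)) [] []) (15 * length v + 1)
     (init_store (ser (tree_of_bits (v @ w))))"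
proof (induction v arbitrary: w rule: rev_induct)
  case Nil
  show ?case unfolding LOAD_loop_def
    by (rule runs_eq[OF runs_WHILE_end]) (auto simp: init_store_eq)
next
  case (snoc b v)
  let ?s = "stores (ser (tree_of_bits w)) (map symbol (rev (v @ [b]))) [] []"
  let ?c = "ser (if b then Nd Lf Lf else Lf)"
  let ?a = "?c @ ser (tree_of_bits w)"
  have T: "runs (SEQ (PUSH 0 1) (SEQ (PUSH 0 1) (PUSH 0 2))) ?s 8 (stores ?a (map symbol (rev (v @ [b]))) [] [])"
    if b
    by (rule runs_eq[OF runs_SEQ[OF runs_PUSH runs_SEQ[OF runs_PUSH runs_PUSH]]])
      (use that in \<open>auto\<close>)
  have F: "runs (PUSH 0 1) ?s 8 (stores ?a (map symbol (rev (v @ [b]))) [] [])" if "\<not> b"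
    by (rule runs_eq[OF runs_PUSH]) (use that in \<open>auto\<close>)
  have i: "runs (IF 1 {2} (SEQ (PUSH 0 1) (SEQ (PUSH 0 1) (PUSH 0 2))) (PUSH 0 1)) ?s 9
      (stores ?a (map symbol (rev (v @ [b]))) [] [])"
    by (rule runs_eq[OF runs_IF[where t = 8]]) (use T F in \<open>auto simp: symbol_def split: if_splits\<close>)
  have body: "runs (SEQ (IF 1 {2} (SEQ (PUSH 0 1) (SEQ (PUSH 0 1) (PUSH 0 2))) (PUSH 0 1))
      (SEQ (PUSH 0 2) (POP 1))) ?s 14 (stores (ser (tree_of_bits (b # w))) (map symbol (rev v)) [] [])"
    by (rule runs_eq[OF runs_SEQ[OF i runs_SEQ[OF runs_PUSH runs_POP]]]) (auto)
  have "runs LOAD_loop ?s (Suc (14 + (15 * length v + 1))) (init_store (ser (tree_of_bits (v @ b # w))))"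
    unfolding LOAD_loop_def
  proof (rule runs_WHILE_step[OF _ _ body])
    show "top_of (?s 1) \<in> {1, 2}" by (simp add: symbol_def)
  qed (use snoc[of "b # w"] in \<open>simp_all add: LOAD_loop_def\<close>)
  then show ?case by (rule runs_eq) auto
qed

lemma runs_LOAD:
  "runs LOAD (init_store (map symbol w)) (21 * length w + 8) (init_store (ser (tree_of_bits w)))"
proof -
  have 1: "runs (MOVE 0 1) (init_store (map symbol w)) (6 * length w + 1)
      (stores [] (map symbol (rev w)) [] [])"
    unfolding init_store_eq
    by (rule runs_eq[OF runs_MOVE]) (auto simp: symbol_def rev_map)
  have 2: "runs (PUSH 0 1) (stores [] (map symbol (rev w)) [] []) 2
      (stores (ser (tree_of_bits [])) (map symbol (rev w)) [] [])"
    by (rule runs_eq[OF runs_PUSH]) (auto)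
  show ?thesis unfolding LOAD_def
    by (rule runs_eq[OF runs_SEQ[OF 1 runs_SEQ[OF 2 runs_LOAD_loop]]]) auto
qed

section \<open>Polynomial-time functions on coded data\<close>

text \<open>Functions below some polynomial are easier to combine than polynomials: the rules
  \<open>pb\<close> follow the shape of a time bound, and no coefficients have to be
  exhibited.\<close>

definition polybd :: "(nat \<Rightarrow> nat) \<Rightarrow> bool" where
  "polybd T \<longleftrightarrow> (\<exists>q. \<forall>n. T n \<le> poly q n)"

named_theorems pb

lemma polybd_poly: "polybd (poly q)"
  unfolding polybd_def by blast

lemma polybd_const [pb]: "polybd (\<lambda>_. c)"
  unfolding polybd_def by (intro exI[of _ "[:c:]"]) simp

lemma polybd_id [pb]: "polybd (\<lambda>n. n)"
  unfolding polybd_def by (intro exI[of _ "[:0, 1:]"]) simp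

lemma polybd_add [pb]: "polybd S \<Longrightarrow> polybd T \<Longrightarrow> polybd (\<lambda>n. S n + T n)"
  unfolding polybd_def by (metis add_mono poly_add)

lemma polybd_mult [pb]: "polybd S \<Longrightarrow> polybd T \<Longrightarrow> polybd (\<lambda>n. S n * T n)"
  unfolding polybd_def by (metis mult_le_mono poly_mult)

lemma polybd_Suc [pb]: "polybd S \<Longrightarrow> polybd (\<lambda>n. Suc (S n))"
  using polybd_add[OF polybd_const[of 1]] by simp

lemma polybd_compose [pb]: "polybd T \<Longrightarrow> polybd (\<lambda>n. poly q (T n))"
  unfolding polybd_def by (metis poly_nat_mono poly_pcompose)

section \<open>Data types coded by trees\<close>

class encodable =
  fixes tree_of :: "'a \<Rightarrow> tree"
  assumes tree_of_inj: "tree_of x = tree_of y \<Longrightarrow> x = y"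

lemma tree_of_eq_iff: "tree_of x = tree_of y \<longleftrightarrow> x = y"
  using tree_of_inj by blast

instantiation bool :: encodable
begin
definition tree_of_bool :: "bool \<Rightarrow> tree" where "tree_of_bool b = (if b then Nd Lf Lf else Lf)"
instance by standard (simp add: tree_of_bool_def split: if_splits)
end

instantiation prod :: (encodable, encodable) encodable
begin
definition tree_of_prod :: "'a \<times> 'b \<Rightarrow> tree" where "tree_of_prod p = Nd (tree_of (fst p)) (tree_of (snd p))"
instance by standard (auto simp: tree_of_prod_def tree_of_eq_iff prod_eq_iff)
end

instantiation list :: (encodable) encodable
begin
fun tree_of_list_tree :: "'a list \<Rightarrow> tree" where
  "tree_of_list_tree [] = Lf"
| "tree_of_list_tree (x # xs) = Nd (tree_of x) (tree_of_list_tree xs)"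
definition tree_of_list :: "'a list \<Rightarrow> tree" where "tree_of_list = tree_of_list_tree"
instance
proof
  fix x y :: "'a list"
  show "tree_of x = tree_of y \<Longrightarrow> x = y"
    unfolding tree_of_list_def
  proof (induction x arbitrary: y)
    case Nil
    then show ?case by (cases y) auto
  next
    case (Cons a x)
    then show ?case by (cases y) (auto simp: tree_of_eq_iff)
  qed
qed
end

instantiation option :: (encodable) encodable
begin
text \<open>\<open>Some x\<close> receives the code of the list \<open>[x]\<close>, so options
  inherit the operations on lists.\<close>

fun tree_of_option :: "'a option \<Rightarrow> tree" where
  "tree_of_option None = Lf"
| "tree_of_option (Some x) = Nd (tree_of x) Lf"
instance
proof
  fix x y :: "'a option"
  show "tree_of x = tree_of y \<Longrightarrow> x = y" by (cases x; cases y) (auto simp: tree_of_eq_iff)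
qed
end

lemma tree_of_simps [simp]:
  "tree_of True = Nd Lf Lf" "tree_of False = Lf" "tree_of (x, y) = Nd (tree_of x) (tree_of y)"
  "tree_of ([] :: 'a :: encodable list) = Lf" "tree_of (z # zs) = Nd (tree_of z) (tree_of zs)"
  by (simp_all add: tree_of_bool_def tree_of_prod_def tree_of_list_def)

definition esize :: "'a :: encodable \<Rightarrow> nat" where
  "esize x = length (ser (tree_of x))"

lemma esize_simps [simp]:
  "esize True = 3" "esize False = 1" "esize (x, y) = Suc (esize x + esize y)"
  "esize ([] :: 'a :: encodable list) = 1" "esize (z # zs) = Suc (esize z + esize zs)"
  "esize None = 1" "esize (Some u) = Suc (Suc (esize u))"
  by (simp_all add: esize_def)

lemma esize_pos: "1 \<le> esize x"
  unfolding esize_def by (cases "tree_of x") auto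

lemma esize_bool: "esize (b :: bool) \<le> 3"
  by (cases b) auto

lemma esize_fst_snd: "esize (fst p) \<le> esize p" "esize (snd p) \<le> esize p"
  by (cases p; simp)+

lemma esize_append: "esize (xs @ ys) + 1 = esize xs + esize ys"
  by (induction xs) auto

lemma esize_rev [simp]: "esize (rev xs) = esize xs"
proof (induction xs)
  case (Cons x xs)
  then show ?case using esize_append[of "rev xs" "[x]"] by simp
qed simp

lemma esize_take_drop: "esize (take k xs) \<le> esize xs" "esize (drop k xs) \<le> esize xs"
  using esize_append[of "take k xs" "drop k xs"] esize_pos[of "take k xs"] esize_pos[of "drop k xs"]
  by simp_all

lemma length_le_esize: "length xs < esize xs"
  by (induction xs) (auto simp: less_Suc_eq_le)

lemma esize_mem: "x \<in> set xs \<Longrightarrow> esize x < esize xs"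
  by (induction xs) auto

lemma esize_filter: "esize (filter P xs) \<le> esize xs"
  by (induction xs) auto

lemma esize_bits: "esize (w :: bool list) \<le> 4 * length w + 1"
proof (induction w)
  case (Cons b w)
  then show ?case using esize_bool[of b] by simp
qed simp

lemma esize_list_bound:
  assumes "\<And>x. x \<in> set xs \<Longrightarrow> esize x \<le> B"
  shows "esize xs \<le> Suc (length xs * Suc B)"
  using assms
proof (induction xs)
  case (Cons x xs)
  then have "esize x \<le> B" "esize xs \<le> Suc (length xs * Suc B)" by auto
  then show ?case by simp
qed simp

text \<open>The arbitrary rest \<open>r\<close> allows other data to wait below the argument on
  stack 0. This is how a copy of the argument survives while a function runs on top of it.\<close>

definition polytime :: "('a :: encodable \<Rightarrow> 'b :: encodable) \<Rightarrow> bool" where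
  "polytime f \<longleftrightarrow> (\<exists>P q. \<forall>x r. runs P (init_store (ser (tree_of x) @ r)) (poly q (esize x))
     (init_store (ser (tree_of (f x)) @ r)))"

lemma polytimeI:
  assumes "polybd T"
    and "\<And>x r. runs P (init_store (ser (tree_of x) @ r)) (T (esize x)) (init_store (ser (tree_of (f x)) @ r))"
  shows "polytime f"
proof -
  obtain q where "\<And>n. T n \<le> poly q n" using assms(1) unfolding polybd_def by blast
  then show ?thesis unfolding polytime_def using runs_mono[OF assms(2)] by blast
qed

text \<open>By \<open>exec_length\<close> the result exceeds the argument by at most the running
  time, so a size bound on the output comes for free and composition stays polynomial.\<close>

lemma polytimeE:
  assumes "polytime f"
  obtains P q where "\<And>x r. runs P (init_store (ser (tree_of x) @ r)) (poly q (esize x))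
      (init_store (ser (tree_of (f x)) @ r))"
    and "\<And>x. esize (f x) \<le> esize x + poly q (esize x)"
proof -
  from assms obtain P q where *: "\<And>x r. runs P (init_store (ser (tree_of x) @ r)) (poly q (esize x))
      (init_store (ser (tree_of (f x)) @ r))"
    unfolding polytime_def by blast
  have "esize (f x) \<le> esize x + poly q (esize x)" for x
  proof -
    from *[of x "[]"] obtain t where "t \<le> poly q (esize x)"
      "exec P (init_store (ser (tree_of x))) t (init_store (ser (tree_of (f x))))"
      unfolding runs_def by auto
    with exec_length[OF this(2), of 0] show ?thesis by (simp add: esize_def init_store_eq)
  qed
  with * that show ?thesis by blast
qed

lemma polytime_size:
  assumes "polytime f"
  shows "\<exists>q. \<forall>x. esize (f x) \<le> poly q (esize x)"
proof -
  obtain q where "\<And>x. esize (f x) \<le> esize x + poly q (esize x)"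
    using polytimeE[OF assms] by metis
  then show ?thesis by (intro exI[of _ "[:0, 1:] + q"]) simp
qed

section \<open>Closure under composition, pairing and case distinction\<close>

named_theorems pt

text \<open>Only codes matter, and \<open>f\<close> and \<open>g\<close> may have different result
  types. Conversions between types with common codes are thus free of cost.\<close>

lemma pt_cong:
  assumes "\<And>x. tree_of (f x) = tree_of (g x)" "polytime g"
  shows "polytime f"
  using assms unfolding polytime_def by simp

lemma pt_id [pt]: "polytime (\<lambda>x. x)"
  by (rule polytimeI[OF polybd_const[of 1]]) (rule runs_SKIP)

lemma pt_comp: "polytime f \<Longrightarrow> polytime g \<Longrightarrow> polytime (\<lambda>x. f (g x))"
proof -
  assume f: "polytime f" and g: "polytime g"
  obtain P q
    where f: "\<And>x r. runs P (init_store (ser (tree_of x) @ r)) (poly q (esize x)) (init_store (ser (tree_of (f x)) @ r))"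
      and sf: "\<And>x. esize (f x) \<le> esize x + poly q (esize x)"
    using f by (rule polytimeE) (rule that)
  obtain P' q'
    where g: "\<And>x r. runs P' (init_store (ser (tree_of x) @ r)) (poly q' (esize x)) (init_store (ser (tree_of (g x)) @ r))"
      and sg: "\<And>x. esize (g x) \<le> esize x + poly q' (esize x)"
    using g by (rule polytimeE) (rule that)
  show ?thesis
  proof (rule polytimeI)
    show "polybd (\<lambda>n. Suc (poly q' n + poly q (n + poly q' n)))"
      by (intro pb polybd_poly)
    show "runs (SEQ P' P) (init_store (ser (tree_of x) @ r))
        (Suc (poly q' (esize x) + poly q (esize x + poly q' (esize x))))
        (init_store (ser (tree_of (f (g x))) @ r))" for x r
      by (rule runs_SEQ[OF g runs_mono[OF f poly_nat_mono[OF sg]]])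
  qed
qed

lemma runs_PUSHES:
  "\<exists>P. \<forall>r. runs P (init_store r) (9 * length (ser t)) (init_store (ser t @ r))"
proof (induction t)
  case Lf
  have "runs (PUSH 0 1) (init_store r) 9 (init_store (ser Lf @ r))" for r
    by (rule runs_eq[OF runs_PUSH]) (auto simp: init_store_eq)
  then show ?case by (auto intro!: exI[of _ "PUSH 0 1"])
next
  case (Nd a b)
  then obtain P P' where P: "\<And>r. runs P (init_store r) (9 * length (ser a)) (init_store (ser a @ r))"
    and P': "\<And>r. runs P' (init_store r) (9 * length (ser b)) (init_store (ser b @ r))" by blast
  have p: "runs (PUSH 0 2) (init_store r) 2 (init_store (2 # r))" for r
    by (rule runs_eq[OF runs_PUSH]) (auto simp: init_store_eq)
  have "runs (SEQ P' (SEQ P (PUSH 0 2))) (init_store r) (9 * length (ser (Nd a b)))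
      (init_store (ser (Nd a b) @ r))" for r
    by (rule runs_eq[OF runs_SEQ[OF P' runs_SEQ[OF P p]]]) auto
  then show ?case by blast
qed

lemma pt_const [pt]:
  fixes c :: "'b :: encodable"
  shows "polytime (\<lambda>_ :: 'a :: encodable. c)"
proof -
  obtain P where P: "\<And>r. runs P (init_store r) (9 * length (ser (tree_of c))) (init_store (ser (tree_of c) @ r))"
    using runs_PUSHES by blast
  show ?thesis
  proof (rule polytimeI)
    show "polybd (\<lambda>n. Suc (9 * n + 4 + 9 * esize c))" by (intro pb)
    show "runs (SEQ DROP P) (init_store (ser (tree_of x) @ r)) (Suc (9 * esize x + 4 + 9 * esize c))
        (init_store (ser (tree_of c) @ r))" for x :: 'a and r
      unfolding esize_def by (rule runs_SEQ[OF runs_DROP P])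
  qed
qed

lemma runs_PUSH0: "x < 3 \<Longrightarrow> runs (PUSH 0 x) (init_store r) 2 (init_store (x # r))"
  by (rule runs_eq[OF runs_PUSH]) (auto simp: init_store_eq)

lemma runs_POP0: "runs (POP 0) (init_store (x # r)) 1 (init_store r)"
  by (rule runs_eq[OF runs_POP]) (auto simp: init_store_eq)

lemma pt_pair [pt]: "polytime f \<Longrightarrow> polytime g \<Longrightarrow> polytime (\<lambda>x. (f x, g x))"
proof -
  assume f: "polytime f" and g: "polytime g"
  obtain P q
    where f: "\<And>x r. runs P (init_store (ser (tree_of x) @ r)) (poly q (esize x)) (init_store (ser (tree_of (f x)) @ r))"
      and sf: "\<And>x. esize (f x) \<le> esize x + poly q (esize x)"
    using f by (rule polytimeE) (rule that)
  obtain P' q'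
    where g: "\<And>x r. runs P' (init_store (ser (tree_of x) @ r)) (poly q' (esize x)) (init_store (ser (tree_of (g x)) @ r))"
      and sg: "\<And>x. esize (g x) \<le> esize x + poly q' (esize x)"
    using g by (rule polytimeE) (rule that)
  let ?P = "SEQ DUP (SEQ P (SEQ SWAP (SEQ P' (SEQ SWAP (PUSH 0 2)))))"
  let ?a = "\<lambda>n. n + poly q n" and ?b = "\<lambda>n. n + poly q' n"
  show ?thesis
  proof (rule polytimeI)
    let ?T = "\<lambda>n. (30 * n + 10) + poly q n + (15 * (?a n + n) + 13) + poly q' n +
      (15 * (?b n + ?a n) + 13) + 20"
    show "polybd ?T" by (intro pb polybd_poly)
    show "runs ?P (init_store (ser (tree_of x) @ r)) (?T (esize x)) (init_store (ser (tree_of (f x, g x)) @ r))" for x r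
      by (rule runs_eq[OF runs_SEQ[OF runs_DUP runs_SEQ[OF f runs_SEQ[OF runs_SWAP runs_SEQ[OF g
            runs_SEQ[OF runs_SWAP runs_PUSH0]]]]]])
        (use sf[of x] sg[of x] in \<open>auto simp: esize_def\<close>)
  qed
qed

lemma pt_fst_base: "polytime (fst :: 'a :: encodable \<times> 'b :: encodable \<Rightarrow> 'a)"
proof (rule polytimeI)
  show "polybd (\<lambda>n. 24 * n + 30)" by (intro pb)
  show "runs (SEQ (POP 0) (SEQ SWAP DROP)) (init_store (ser (tree_of x) @ r)) (24 * esize x + 30)
      (init_store (ser (tree_of (fst x)) @ r))" for x :: "'a \<times> 'b" and r
    by (cases x)
      (auto simp: esize_def intro!: runs_eq[OF runs_SEQ[OF runs_POP0 runs_SEQ[OF runs_SWAP runs_DROP]]])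
qed

lemma pt_snd_base: "polytime (snd :: 'a :: encodable \<times> 'b :: encodable \<Rightarrow> 'b)"
proof (rule polytimeI)
  show "polybd (\<lambda>n. 24 * n + 30)" by (intro pb)
  show "runs (SEQ (POP 0) DROP) (init_store (ser (tree_of x) @ r)) (24 * esize x + 30)
      (init_store (ser (tree_of (snd x)) @ r))" for x :: "'a \<times> 'b" and r
    by (cases x)
      (auto simp: esize_def intro!: runs_eq[OF runs_SEQ[OF runs_POP0 runs_DROP]])
qed

lemma pt_fst [pt]: "polytime f \<Longrightarrow> polytime (\<lambda>x. fst (f x))"
  by (rule pt_comp[OF pt_fst_base])

lemma pt_snd [pt]: "polytime f \<Longrightarrow> polytime (\<lambda>x. snd (f x))"
  by (rule pt_comp[OF pt_snd_base])

lemma pt_eq [pt]: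
  assumes "polytime f" "polytime g"
  shows "polytime (\<lambda>x. f x = g x)"
proof -
  have "polytime (\<lambda>p :: 'b \<times> 'b. fst p = snd p)"
  proof (rule polytimeI)
    show "polybd (\<lambda>n. 30 * n + 50)" by (intro pb)
    show "runs (SEQ (POP 0) EQUAL) (init_store (ser (tree_of p) @ r)) (30 * esize p + 50)
        (init_store (ser (tree_of (fst p = snd p)) @ r))" for p :: "'b \<times> 'b" and r
      by (cases p)
        (auto simp: esize_def tree_of_bool_def tree_of_eq_iff intro!: runs_eq[OF runs_SEQ[OF runs_POP0 runs_EQUAL]])
  qed
  from pt_comp[OF this pt_pair[OF assms]] show ?thesis by simp
qed

lemma pt_if [pt]:
  assumes "polytime b" "polytime f" "polytime g"
  shows "polytime (\<lambda>x. if b x then f x else g x)"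
proof -
  obtain B p
    where b: "\<And>x r. runs B (init_store (ser (tree_of x) @ r)) (poly p (esize x)) (init_store (ser (tree_of (b x)) @ r))"
      and sb: "\<And>x. esize (b x) \<le> esize x + poly p (esize x)"
    using assms(1) by (rule polytimeE) (rule that)
  obtain P q
    where f: "\<And>x r. runs P (init_store (ser (tree_of x) @ r)) (poly q (esize x)) (init_store (ser (tree_of (f x)) @ r))"
      and sf: "\<And>x. esize (f x) \<le> esize x + poly q (esize x)"
    using assms(2) by (rule polytimeE) (rule that)
  obtain P' q'
    where g: "\<And>x r. runs P' (init_store (ser (tree_of x) @ r)) (poly q' (esize x)) (init_store (ser (tree_of (g x)) @ r))"
      and sg: "\<And>x. esize (g x) \<le> esize x + poly q' (esize x)"
    using assms(3) by (rule polytimeE) (rule that)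
  let ?P = "SEQ DUP (SEQ B (IF 0 {2} (SEQ DROP P) (SEQ DROP P')))"
  show ?thesis
  proof (rule polytimeI)
    let ?T = "\<lambda>n. (30 * n + 10) + poly p n + poly q n + poly q' n + 50"
    show "polybd ?T" by (intro pb polybd_poly)
    fix x r
    let ?s = "init_store (ser (tree_of (b x)) @ ser (tree_of x) @ r)"
    let ?s' = "init_store (ser (tree_of (if b x then f x else g x)) @ r)"
    have 1: "runs (SEQ DROP P) ?s (40 + poly q (esize x) + poly q' (esize x)) ?s'" if "b x"
      by (rule runs_eq[OF runs_SEQ[OF runs_DROP f]]) (use that in auto)
    have 2: "runs (SEQ DROP P') ?s (40 + poly q (esize x) + poly q' (esize x)) ?s'" if "\<not> b x"
      by (rule runs_eq[OF runs_SEQ[OF runs_DROP g]]) (use that in auto)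
    have 3: "runs (IF 0 {2} (SEQ DROP P) (SEQ DROP P')) ?s
        (Suc (40 + poly q (esize x) + poly q' (esize x))) ?s'"
      by (rule runs_IF) (use 1 2 in \<open>auto simp: init_store_eq tree_of_bool_def split: if_splits\<close>)
    show "runs ?P (init_store (ser (tree_of x) @ r)) (?T (esize x)) ?s'"
      by (rule runs_eq[OF runs_SEQ[OF runs_DUP runs_SEQ[OF b 3]]]) (auto simp: esize_def)
  qed
qed

text \<open>A nonempty list has the same code as the pair of its head and its tail. After a swap, a
  single \<open>PUSH 0 2\<close> therefore assembles the argument \<open>(x, a, as)\<close> of the
  second branch; for the empty list the code is one leaf, which \<open>POP 0\<close>
  removes.\<close>

lemma pt_case_list [pt]:
  assumes "polytime l" "polytime n" "polytime (\<lambda>p. c (fst p) (fst (snd p)) (snd (snd p)))"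
  shows "polytime (\<lambda>x. case l x of [] \<Rightarrow> n x | a # as \<Rightarrow> c x a as)"
proof -
  let ?c = "\<lambda>p. c (fst p) (fst (snd p)) (snd (snd p))"
  obtain B p
    where l: "\<And>x r. runs B (init_store (ser (tree_of x) @ r)) (poly p (esize x)) (init_store (ser (tree_of (l x)) @ r))"
      and sl: "\<And>x. esize (l x) \<le> esize x + poly p (esize x)"
    using assms(1) by (rule polytimeE) (rule that)
  obtain P q
    where n: "\<And>x r. runs P (init_store (ser (tree_of x) @ r)) (poly q (esize x)) (init_store (ser (tree_of (n x)) @ r))"
      and sn: "\<And>x. esize (n x) \<le> esize x + poly q (esize x)"
    using assms(2) by (rule polytimeE) (rule that)
  obtain P' q'
    where c: "\<And>x r. runs P' (init_store (ser (tree_of x) @ r)) (poly q' (esize x)) (init_store (ser (tree_of (?c x)) @ r))"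
      and sc: "\<And>x. esize (?c x) \<le> esize x + poly q' (esize x)"
    using assms(3) by (rule polytimeE) (rule that)
  let ?P1 = "SEQ SWAP (SEQ (PUSH 0 2) P')" and ?P2 = "SEQ (POP 0) P"
  let ?P = "SEQ DUP (SEQ B (IF 0 {2} ?P1 ?P2))"
  show ?thesis
  proof (rule polytimeI)
    let ?T = "\<lambda>n. (30 * n + 10) + poly p n + (poly q n + 15 * (n + poly p n + n) + 40 + poly q' (Suc (n + (n + poly p n))))"
    show "polybd ?T" by (intro pb polybd_poly)
    fix x r
    let ?s = "init_store (ser (tree_of (l x)) @ ser (tree_of x) @ r)"
    let ?s' = "init_store (ser (tree_of (case l x of [] \<Rightarrow> n x | a # as \<Rightarrow> c x a as)) @ r)"
    define t where "t = poly q (esize x) + 15 * (esize x + poly p (esize x) + esize x) + 30 +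
      poly q' (Suc (esize x + (esize x + poly p (esize x))))"
    have "runs ?P2 (init_store (1 # ser (tree_of x) @ r)) t (init_store (ser (tree_of (n x)) @ r))"
      by (rule runs_eq[OF runs_SEQ[OF runs_POP0 n]]) (auto simp: t_def)
    then have 1: "runs ?P2 ?s t ?s'" if "l x = []" using that by simp
    have 2: "runs ?P1 ?s t ?s'" if lx: "l x = a # as" for a as
    proof -
      have s: "esize (x, a, as) \<le> Suc (esize x + (esize x + poly p (esize x)))"
        using sl[of x] lx by simp
      have e: "ser (tree_of (x, a, as)) @ r = 2 # ser (tree_of x) @ ser (tree_of (a, as)) @ r" by simp
      have c': "runs P' (init_store (2 # ser (tree_of x) @ ser (tree_of (a, as)) @ r))
          (poly q' (Suc (esize x + (esize x + poly p (esize x))))) (init_store (ser (tree_of (c x a as)) @ r))"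
        using runs_mono[OF c[of "(x, a, as)" r] poly_nat_mono[OF s]] unfolding e by simp
      have "runs ?P1 (init_store (ser (tree_of (a, as)) @ ser (tree_of x) @ r)) t
          (init_store (ser (tree_of (c x a as)) @ r))"
        by (rule runs_eq[OF runs_SEQ[OF runs_SWAP runs_SEQ[OF runs_PUSH0 c']]])
          (use sl[of x] lx in \<open>auto simp: t_def esize_def\<close>)
      with lx show ?thesis by simp
    qed
    have 3: "runs (IF 0 {2} ?P1 ?P2) ?s (Suc t) ?s'"
      by (rule runs_IF) (use 1 2 in \<open>auto simp: init_store_eq split: list.splits\<close>)
    show "runs ?P (init_store (ser (tree_of x) @ r)) (?T (esize x)) ?s'"
      by (rule runs_eq[OF runs_SEQ[OF runs_DUP runs_SEQ[OF l 3]]]) (auto simp: esize_def t_def)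
  qed
qed

lemma pt_Cons [pt]: "polytime f \<Longrightarrow> polytime g \<Longrightarrow> polytime (\<lambda>x. f x # g x)"
  by (rule pt_cong[OF _ pt_pair[of f g]]) auto

lemma pt_Some [pt]: "polytime f \<Longrightarrow> polytime (\<lambda>x. Some (f x))"
  by (rule pt_cong[of _ "\<lambda>x. [f x]"]) (auto intro: pt)

lemma pt_case_option [pt]:
  assumes "polytime l" "polytime n" "polytime (\<lambda>p. c (fst p) (snd p))"
  shows "polytime (\<lambda>x. case l x of None \<Rightarrow> n x | Some a \<Rightarrow> c x a)"
proof -
  let ?l = "\<lambda>x. case l x of None \<Rightarrow> [] | Some a \<Rightarrow> [a]"
  have "polytime ?l"
    by (rule pt_cong[OF _ assms(1)]) (auto split: option.splits)
  moreover have "polytime (\<lambda>p. c (fst p) (fst (snd p)))"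
    using pt_comp[OF assms(3), of "\<lambda>p. (fst p, fst (snd p))"] by (simp add: pt)
  ultimately have "polytime (\<lambda>x. case ?l x of [] \<Rightarrow> n x | a # as \<Rightarrow> c x a)"
    by (intro pt assms)
  then show ?thesis by (rule pt_cong[rotated]) (auto split: option.splits)
qed

lemma pt_not [pt]: "polytime b \<Longrightarrow> polytime (\<lambda>x. \<not> b x)"
  by (rule pt_cong[of _ "\<lambda>x. if b x then False else True"], simp, intro pt)

lemma pt_conj [pt]: "polytime a \<Longrightarrow> polytime b \<Longrightarrow> polytime (\<lambda>x. a x \<and> b x)"
  by (rule pt_cong[of _ "\<lambda>x. if a x then b x else False"], simp, intro pt)

lemma pt_disj [pt]: "polytime a \<Longrightarrow> polytime b \<Longrightarrow> polytime (\<lambda>x. a x \<or> b x)"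
  by (rule pt_cong[of _ "\<lambda>x. if a x then True else b x"], simp, intro pt)

lemma pt_imp [pt]: "polytime a \<Longrightarrow> polytime b \<Longrightarrow> polytime (\<lambda>x. a x \<longrightarrow> b x)"
  by (rule pt_cong[of _ "\<lambda>x. if a x then b x else True"], simp, intro pt)

subsection \<open>Bounded recursion over lists\<close>

text \<open>The bound concerns the accumulator after every prefix of the list, since repeated
  polynomial growth would not stay polynomial. A round runs \<open>g\<close> on the triple of
  remaining list, parameter and accumulator. Between rounds the outermost node symbol is taken off,
  so that the loop test sees directly whether the remaining list is empty.\<close>

lemma polytime_fold:
  fixes h :: "'x :: encodable \<Rightarrow> 'a :: encodable \<Rightarrow> 's :: encodable \<Rightarrow> 's"
  assumes h: "polytime (\<lambda>p. h (fst p) (fst (snd p)) (snd (snd p)))"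
    and l: "polytime l" and s0: "polytime s0"
    and bnd: "polybd b"
      "\<And>x k. k \<le> length (l x) \<Longrightarrow> esize (fold (h x) (take k (l x)) (s0 x)) \<le> b (esize x)"
  shows "polytime (\<lambda>x. fold (h x) (l x) (s0 x))"
proof -
  define g :: "'a list \<times> 'x \<times> 's \<Rightarrow> 'a list \<times> 'x \<times> 's" where
    "g = (\<lambda>p. case fst p of [] \<Rightarrow> p
       | a # as \<Rightarrow> (as, fst (snd p), h (fst (snd p)) a (snd (snd p))))"
  have "polytime (\<lambda>p :: ('a list \<times> 'x \<times> 's) \<times> 'a \<times> 'a list.
      h (fst (snd (fst p))) (fst (snd p)) (snd (snd (fst p))))"
    using pt_comp[OF h, of "\<lambda>p. (fst (snd (fst p)), fst (snd p), snd (snd (fst p)))"]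
    by (simp add: pt)
  then have "polytime g" unfolding g_def by (intro pt)
  then obtain G q
    where g: "\<And>x r. runs G (init_store (ser (tree_of x) @ r)) (poly q (esize x)) (init_store (ser (tree_of (g x)) @ r))"
      and sg: "\<And>x. esize (g x) \<le> esize x + poly q (esize x)"
    by (rule polytimeE) (rule that)
  let ?W = "WHILE 0 {2} (SEQ (PUSH 0 2) (SEQ G (POP 0)))"
  have loop: "runs ?W (init_store (ser (tree_of u) @ ser (tree_of (x, s)) @ r)) (length u * (T + 6) + 1)
      (init_store (ser Lf @ ser (tree_of (x, fold (h x) u s)) @ r))"
    if "\<And>k. k \<le> length u \<Longrightarrow> poly q (esize (drop k u, x, fold (h x) (take k u) s)) \<le> T"
    for u x s r T
    using that
  proof (induction u arbitrary: s)
    case Nil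
    show ?case by (rule runs_eq[OF runs_WHILE_end]) (auto simp: init_store_eq)
  next
    case (Cons a u)
    have g': "runs G (init_store (2 # ser (tree_of (a # u)) @ ser (tree_of (x, s)) @ r)) T
        (init_store (2 # ser (tree_of u) @ ser (tree_of (x, h x a s)) @ r))"
    proof -
      have "poly q (esize (a # u, x, s)) \<le> T" using Cons.prems[of 0] by simp
      from runs_mono[OF g[of "(a # u, x, s)" r] this] show ?thesis by (simp add: g_def)
    qed
    have body: "runs (SEQ (PUSH 0 2) (SEQ G (POP 0))) (init_store (ser (tree_of (a # u)) @ ser (tree_of (x, s)) @ r))
        (T + 5) (init_store (ser (tree_of u) @ ser (tree_of (x, h x a s)) @ r))"
      by (rule runs_eq[OF runs_SEQ[OF runs_PUSH0 runs_SEQ[OF g' runs_POP0]]]) auto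
    have IH: "runs ?W (init_store (ser (tree_of u) @ ser (tree_of (x, h x a s)) @ r)) (length u * (T + 6) + 1)
        (init_store (ser Lf @ ser (tree_of (x, fold (h x) u (h x a s))) @ r))"
      by (rule Cons.IH) (use Cons.prems[of "Suc k" for k] in auto)
    have "runs ?W (init_store (ser (tree_of (a # u)) @ ser (tree_of (x, s)) @ r))
        (Suc ((T + 5) + (length u * (T + 6) + 1))) (init_store (ser Lf @ ser (tree_of (x, fold (h x) (a # u) s)) @ r))"
      by (rule runs_WHILE_step[OF _ _ body]) (use IH in \<open>auto simp: init_store_eq\<close>)
    then show ?case by (rule runs_mono) simp
  qed
  have "polytime (\<lambda>x. (l x, x, s0 x))" by (intro pt l s0)
  then obtain I q' where i: "\<And>x r. runs I (init_store (ser (tree_of x) @ r)) (poly q' (esize x))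
      (init_store (ser (tree_of (l x, x, s0 x)) @ r))"
    and si: "\<And>x. esize (l x, x, s0 x) \<le> esize x + poly q' (esize x)" by (rule polytimeE) (rule that)
  obtain E q'' where e: "\<And>(x :: 'x \<times> 's) r. runs E (init_store (ser (tree_of x) @ r)) (poly q'' (esize x))
      (init_store (ser (tree_of (snd x)) @ r))"
    and se: "\<And>x :: 'x \<times> 's. esize (snd x) \<le> esize x + poly q'' (esize x)"
    using pt_snd_base by (rule polytimeE) (rule that)
  obtain qb where qb: "\<And>n. b n \<le> poly qb n" using bnd(1) unfolding polybd_def by blast
  let ?P = "SEQ I (SEQ (POP 0) (SEQ ?W (SEQ (POP 0) E)))"
  let ?a = "\<lambda>n. n + poly q' n"
  \<comment> \<open>A bound for the triple in every round: the rest of the list, the parameter, the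
    accumulator and two node symbols.\<close>
  let ?B = "\<lambda>n. ?a n + n + poly qb n + 2"
  show ?thesis
  proof (rule polytimeI)
    let ?T = "\<lambda>n. poly q' n + (?a n * (poly q (?B n) + 6) + 1) + poly q'' (?B n) + 10"
    show "polybd ?T" by (intro pb polybd_poly)
    fix x r
    have B: "esize (drop k (l x), x, fold (h x) (take k (l x)) (s0 x)) \<le> ?B (esize x)"
      if "k \<le> length (l x)" for k
      using esize_take_drop(2)[of k "l x"] si[of x] bnd(2)[OF that] qb[of "esize x"] by simp
    have T: "poly q (esize (drop k (l x), x, fold (h x) (take k (l x)) (s0 x))) \<le> poly q (?B (esize x))"
      if "k \<le> length (l x)" for k
      using poly_nat_mono[OF B[OF that]] .
    have len: "length (l x) \<le> ?a (esize x)"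
      using length_le_esize[of "l x"] si[of x] by simp
    have i': "runs I (init_store (ser (tree_of x) @ r)) (poly q' (esize x))
        (init_store (2 # ser (tree_of (l x)) @ ser (tree_of (x, s0 x)) @ r))"
      using i[of x r] by simp
    have w: "runs ?W (init_store (ser (tree_of (l x)) @ ser (tree_of (x, s0 x)) @ r))
        (?a (esize x) * (poly q (?B (esize x)) + 6) + 1)
        (init_store (1 # ser (tree_of (x, fold (h x) (l x) (s0 x))) @ r))"
    proof -
      have *: "runs ?W (init_store (ser (tree_of (l x)) @ ser (tree_of (x, s0 x)) @ r))
          (length (l x) * (poly q (?B (esize x)) + 6) + 1)
          (init_store (ser Lf @ ser (tree_of (x, fold (h x) (l x) (s0 x))) @ r))"
        by (rule loop) (rule T)
      have "length (l x) * (poly q (?B (esize x)) + 6) \<le> ?a (esize x) * (poly q (?B (esize x)) + 6)"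
        by (rule mult_le_mono1[OF len])
      then show ?thesis by (intro runs_eq[OF *]) simp_all
    qed
    have "esize (x, fold (h x) (l x) (s0 x)) \<le> ?B (esize x)"
      using B[of "length (l x)"] by simp
    then have e': "runs E (init_store (ser (tree_of (x, fold (h x) (l x) (s0 x))) @ r)) (poly q'' (?B (esize x)))
        (init_store (ser (tree_of (fold (h x) (l x) (s0 x))) @ r))"
      using runs_mono[OF e[of "(x, fold (h x) (l x) (s0 x))" r] poly_nat_mono] by simp
    show "runs ?P (init_store (ser (tree_of x) @ r)) (?T (esize x))
        (init_store (ser (tree_of (fold (h x) (l x) (s0 x))) @ r))"
      by (rule runs_mono[OF runs_SEQ[OF i' runs_SEQ[OF runs_POP0 runs_SEQ[OF w runs_SEQ[OF runs_POP0 e']]]]]) simp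
  qed
qed

lemma polybd_size: "polytime f \<Longrightarrow> \<exists>b. polybd b \<and> mono b \<and> (\<forall>x. esize (f x) \<le> b (esize x))"
  using polytime_size polybd_poly poly_nat_mono by (metis monoI)

text \<open>The same principle in a handier form: the bound may refer to the sizes of
  \<open>l x\<close> and \<open>s0 x\<close>, which are themselves polynomial in the size of
  \<open>x\<close>.\<close>

lemma pt_fold:
  fixes h :: "'x :: encodable \<Rightarrow> 'a :: encodable \<Rightarrow> 's :: encodable \<Rightarrow> 's"
  assumes h: "polytime (\<lambda>p. h (fst p) (fst (snd p)) (snd (snd p)))"
    and l: "polytime l" and s0: "polytime s0"
    and bnd: "polybd b"
      "\<And>x as bs. l x = as @ bs \<Longrightarrow> esize (fold (h x) as (s0 x)) \<le> b (esize x + esize (l x) + esize (s0 x))"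
    and "mono b"
  shows "polytime (\<lambda>x. fold (h x) (l x) (s0 x))"
proof -
  obtain c d where c: "polybd c" "\<And>x. esize (l x) \<le> c (esize x)"
    and d: "polybd d" "\<And>x. esize (s0 x) \<le> d (esize x)"
    using polybd_size[OF l] polybd_size[OF s0] by blast
  obtain q where q: "\<And>n. b n \<le> poly q n" using bnd(1) unfolding polybd_def by blast
  show ?thesis
  proof (rule polytime_fold[OF h l s0])
    show "polybd (\<lambda>n. poly q (n + c n + d n))" by (intro pb c d)
    fix x k
    have "esize (fold (h x) (take k (l x)) (s0 x)) \<le> b (esize x + esize (l x) + esize (s0 x))"
      by (rule bnd(2)[of _ _ "drop k (l x)"]) simp
    also have "\<dots> \<le> b (esize x + c (esize x) + d (esize x))"
      using c(2) d(2) by (intro monoD[OF \<open>mono b\<close>] add_mono) auto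
    finally show "esize (fold (h x) (take k (l x)) (s0 x)) \<le> poly q (esize x + c (esize x) + d (esize x))"
      using q le_trans by blast
  qed
qed

section \<open>Quantifiers and list operations as folds\<close>

lemma pt_fold_bool [pt]:
  assumes "polytime (\<lambda>p. h (fst p) (fst (snd p)) (snd (snd p)))" "polytime l" "polytime s0"
  shows "polytime (\<lambda>x. fold (h x) (l x) (s0 x) :: bool)"
  by (rule polytime_fold[OF assms polybd_const[of 3]]) (rule esize_bool)

lemma pt_ex [pt]:
  assumes "polytime (\<lambda>p. P (fst p) (snd p))" "polytime l"
  shows "polytime (\<lambda>x. \<exists>a\<in>set (l x). P x a)"
proof -
  have "polytime (\<lambda>p :: 'a \<times> 'b \<times> bool. P (fst p) (fst (snd p)))"
    using pt_comp[OF assms(1), of "\<lambda>p. (fst p, fst (snd p))"] by (simp add: pt)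
  then have "polytime (\<lambda>x. fold (\<lambda>a s. s \<or> P x a) (l x) False)"
    by (intro pt assms)
  moreover have "fold (\<lambda>a s. s \<or> P x a) u b \<longleftrightarrow> b \<or> (\<exists>a\<in>set u. P x a)" for x u b
    by (induction u arbitrary: b) auto
  ultimately show ?thesis by simp
qed

lemma pt_all [pt]:
  assumes "polytime (\<lambda>p. P (fst p) (snd p))" "polytime l"
  shows "polytime (\<lambda>x. \<forall>a\<in>set (l x). P x a)"
  using pt_not[OF pt_ex[OF pt_not[OF assms(1)] assms(2)]] by simp

lemma pt_mem [pt]: "polytime f \<Longrightarrow> polytime l \<Longrightarrow> polytime (\<lambda>x. f x \<in> set (l x))"
proof -
  assume a: "polytime f" "polytime l"
  have "polytime (\<lambda>x. \<exists>a\<in>set (l x). f x = a)"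
    by (intro pt a pt_comp[OF a(1)])
  then show ?thesis by (rule pt_cong[rotated]) auto
qed

lemma pt_rev [pt]: "polytime l \<Longrightarrow> polytime (\<lambda>x. rev (l x))"
proof -
  assume l: "polytime l"
  have "polytime (\<lambda>x. fold (\<lambda>a s. a # s) (l x) [])"
  proof (rule pt_fold[OF _ l])
    show "polybd (\<lambda>n. n)" by (intro pb)
    fix x as bs assume "l x = as @ bs"
    then show "esize (fold (\<lambda>a s. a # s) as []) \<le> esize x + esize (l x) + esize ([] :: 'b list)"
      using esize_append[of as bs] esize_pos[of bs] by (simp add: fold_Cons_rev[of _ "[]", simplified] fold_Cons_rev)
  qed (auto intro!: pt monoI)
  then show ?thesis by (rule pt_cong[rotated]) (simp add: rev_conv_fold cong: fold_cong)
qed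

lemma pt_append [pt]: "polytime f \<Longrightarrow> polytime g \<Longrightarrow> polytime (\<lambda>x. f x @ g x)"
proof -
  assume f: "polytime f" and g: "polytime g"
  have "polytime (\<lambda>x. fold (\<lambda>a s. a # s) (rev (f x)) (g x))"
  proof (rule pt_fold[OF _ pt_rev[OF f] g])
    show "polybd (\<lambda>n. n)" by (intro pb)
    fix x as bs assume "rev (f x) = as @ bs"
    then have "esize (rev (f x)) + 1 = esize as + esize bs" using esize_append[of as bs] by simp
    then show "esize (fold (\<lambda>a s. a # s) as (g x)) \<le> esize x + esize (rev (f x)) + esize (g x)"
      using esize_append[of "rev as" "g x"] esize_pos[of bs] by (simp add: fold_Cons_rev)
  qed (auto intro!: pt monoI)
  then show ?thesis by (rule pt_cong[rotated]) (simp add: fold_Cons_rev)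
qed

lemma pt_map [pt]:
  assumes f: "polytime (\<lambda>p. f (fst p) (snd p))" and l: "polytime l"
  shows "polytime (\<lambda>x. map (f x) (l x))"
proof -
  obtain q where q: "\<And>p. esize (f (fst p) (snd p)) \<le> poly q (esize p)"
    using polytime_size[OF f] by blast
  have f': "polytime (\<lambda>p :: 'a \<times> 'b \<times> 'c list. f (fst p) (fst (snd p)))"
    using pt_comp[OF f, of "\<lambda>p. (fst p, fst (snd p))"] by (simp add: pt)
  have fold: "fold (\<lambda>a s. f x a # s) u s = rev (map (f x) u) @ s" for x u s
    by (induction u arbitrary: s) auto
  have "polytime (\<lambda>x. fold (\<lambda>a s. f x a # s) (l x) [])"
  proof (rule pt_fold[OF _ l])
    show "polytime (\<lambda>p :: 'a \<times> 'b \<times> 'c list. f (fst p) (fst (snd p)) # snd (snd p))"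
      by (intro pt f')
    \<comment> \<open>The accumulator has at most \<open>n\<close> entries, each the image of a pair
      \<open>(x, a)\<close> whose size is at most \<open>Suc n\<close>.\<close>
    show "polybd (\<lambda>n. Suc (n * Suc (poly q (Suc n))))" by (intro pb polybd_poly)
    show "mono (\<lambda>n. Suc (n * Suc (poly q (Suc n))))"
      by (intro monoI) (auto intro!: add_mono mult_mono poly_nat_mono)
    fix x as bs assume lx: "l x = as @ bs"
    let ?n = "esize x + esize (l x) + esize ([] :: 'c list)"
    have "esize (f x a) \<le> poly q (Suc ?n)" if "a \<in> set as" for a
    proof -
      have "esize a < esize (l x)" using esize_mem[of a "l x"] lx that by simp
      then have "esize (x, a) \<le> Suc ?n" by simp
      from poly_nat_mono[OF this, of q] q[of "(x, a)"] show ?thesis by simp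
    qed
    then have "esize (map (f x) as) \<le> Suc (length as * Suc (poly q (Suc ?n)))"
      using esize_list_bound[of "map (f x) as"] by auto
    moreover have "length as \<le> ?n" using length_le_esize[of "l x"] lx by simp
    then have "length as * Suc (poly q (Suc ?n)) \<le> ?n * Suc (poly q (Suc ?n))"
      by (rule mult_le_mono1)
    ultimately show "esize (fold (\<lambda>a s. f x a # s) as []) \<le> Suc (?n * Suc (poly q (Suc ?n)))"
      by (simp add: fold)
  qed (intro pt)
  then have "polytime (\<lambda>x. rev (fold (\<lambda>a s. f x a # s) (l x) []))" by (rule pt_rev)
  then show ?thesis by (rule pt_cong[rotated]) (simp add: fold)
qed

lemma esize_concat: "esize (concat xs) \<le> esize xs"
proof (induction xs)
  case (Cons x xs)
  then show ?case using esize_append[of x "concat xs"] by simp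
qed simp

lemma pt_concat [pt]:
  assumes l: "polytime l"
  shows "polytime (\<lambda>x. concat (l x))"
proof -
  have fold: "fold (\<lambda>a s. s @ a) u s = s @ concat u" for u and s :: "'b list"
    by (induction u arbitrary: s) auto
  have "polytime (\<lambda>x. fold (\<lambda>a s. s @ a) (l x) [])"
  proof (rule pt_fold[OF _ l])
    show "polybd (\<lambda>n. n)" by (intro pb)
    fix x as bs assume lx: "l x = as @ bs"
    then show "esize (fold (\<lambda>a s. s @ a) as []) \<le> esize x + esize (l x) + esize ([] :: 'b list)"
      using esize_concat[of as] esize_append[of as bs] esize_pos[of bs] by (simp add: fold)
  qed (auto intro!: pt monoI)
  then show ?thesis by (rule pt_cong[rotated]) (simp add: fold)
qed

lemma pt_filter [pt]:
  assumes "polytime (\<lambda>p. P (fst p) (snd p))" "polytime l"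
  shows "polytime (\<lambda>x. filter (P x) (l x))"
proof -
  have "polytime (\<lambda>x. concat (map (\<lambda>a. if P x a then [a] else []) (l x)))"
    by (intro pt assms)
  moreover have "concat (map (\<lambda>a. if Q a then [a] else []) u) = filter Q u" for Q and u :: "'b list"
    by (induction u) auto
  ultimately show ?thesis by simp
qed

lemma pt_distinct [pt]:
  assumes l: "polytime l"
  shows "polytime (\<lambda>x. distinct (l x))"
proof -
  let ?h = "\<lambda>a s. (a # fst s, snd s \<and> a \<notin> set (fst s))"
  have fold: "fold ?h u (s, b) = (rev u @ s, b \<and> distinct u \<and> set u \<inter> set s = {})"
    for u s :: "'b list" and b
    by (induction u arbitrary: s b) auto
  have "polytime (\<lambda>x. fold ?h (l x) ([], True))"
  proof (rule pt_fold[OF _ l])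
    show "polybd (\<lambda>n. n + 10)" by (intro pb)
    fix x as bs assume lx: "l x = as @ bs"
    then show "esize (fold ?h as ([], True)) \<le> esize x + esize (l x) + esize ([] :: 'b list, True) + 10"
      using esize_append[of as bs] esize_pos[of bs] esize_bool[of "distinct as"] by (simp add: fold)
  qed (auto intro!: pt monoI)
  then have "polytime (\<lambda>x. snd (fold ?h (l x) ([], True)))" by (rule pt_snd)
  then show ?thesis by (rule pt_cong[rotated]) (simp add: fold)
qed

lemma pt_tl [pt]: "polytime l \<Longrightarrow> polytime (\<lambda>x. tl (l x))"
proof -
  assume "polytime l"
  then have "polytime (\<lambda>x. case l x of [] \<Rightarrow> [] | a # as \<Rightarrow> as)" by (intro pt)
  then show ?thesis by (rule pt_cong[rotated]) (auto split: list.splits)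
qed

text \<open>The tape holds raw bits and not a code. \<open>LOAD\<close> bridges the gap in linear
  time, and a word of length \<open>n\<close> has a code of size at most
  \<open>4 * n + 1\<close>.\<close>

theorem P_class_polytime:
  assumes "polytime (f :: bool list \<Rightarrow> bool)"
  shows "{w. f w} \<in> P_class"
proof -
  obtain P q where P: "\<And>x r. runs P (init_store (ser (tree_of x) @ r)) (poly q (esize x))
      (init_store (ser (tree_of (f x)) @ r))"
    and s: "\<And>x. esize (f x) \<le> esize x + poly q (esize x)"
    using assms by (rule polytimeE) (rule that)
  have tb: "tree_of_bits w = tree_of w" for w
    by (induction w) (auto simp: tree_of_bool_def)
  have "\<exists>q'. \<forall>n. Suc (21 * n + 8 + poly q (4 * n + 1)) \<le> poly q' n"
    unfolding polybd_def[symmetric] by (intro pb)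
  then obtain q' where q': "\<And>n. Suc (21 * n + 8 + poly q (4 * n + 1)) \<le> poly q' n" by blast
  show ?thesis
  proof (rule P_class_prog[where P = "SEQ LOAD P" and q = q'])
    fix w
    have "runs (SEQ LOAD P) (init_store (map symbol w)) (Suc (21 * length w + 8 + poly q (4 * length w + 1)))
        (init_store (ser (tree_of (f w))))"
      by (rule runs_SEQ[OF runs_LOAD])
        (use runs_mono[OF P[of w "[]"] poly_nat_mono[OF esize_bits]] in \<open>simp add: tb\<close>)
    then have "runs (SEQ LOAD P) (init_store (map symbol w)) (poly q' (length w)) (init_store (ser (tree_of (f w))))"
      using q' runs_mono by blast
    then obtain t where "t \<le> poly q' (length w)"
        "exec (SEQ LOAD P) (init_store (map symbol w)) t (init_store (ser (tree_of (f w))))"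
      unfolding runs_def by blast
    moreover have "top_of (init_store (ser (tree_of (f w))) 0) = 2 \<longleftrightarrow> w \<in> {w. f w}"
      by (simp add: init_store_eq tree_of_bool_def)
    ultimately show "\<exists>t s'. exec (SEQ LOAD P) (init_store (map symbol w)) t s' \<and> t \<le> poly q' (length w) \<and>
        (top_of (s' 0) = 2 \<longleftrightarrow> w \<in> {w. f w})"
      by blast
  qed
qed

section \<open>Binary arithmetic in polynomial time\<close>

text \<open>Numbers are bit lists with the least significant bit first; leading zeros are allowed.\<close>

fun val :: "bool list \<Rightarrow> nat" where
  "val [] = 0"
| "val (b # w) = of_bool b + 2 * val w"

definition lsb :: "bool list \<Rightarrow> bool" where
  "lsb w = (case w of [] \<Rightarrow> False | b # _ \<Rightarrow> b)"

lemma pt_lsb [pt]: "polytime f \<Longrightarrow> polytime (\<lambda>x. lsb (f x))"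
  unfolding lsb_def by (intro pt)

lemma val_lsb: "val w = of_bool (lsb w) + 2 * val (tl w)"
  by (cases w) (auto simp: lsb_def)

lemma val_append: "val (u @ v) = val u + 2 ^ length u * val v"
  by (induction u) (auto simp: algebra_simps)

lemma val_less: "val w < 2 ^ length w"
  by (induction w) auto

text \<open>
  One position of a ripple-carry addition or subtraction, depending on the carry function. The
  lists of the state are the remaining bits of the operands and the reversed result.
\<close>

definition bit_step :: "(bool \<Rightarrow> bool \<Rightarrow> bool \<Rightarrow> bool) \<Rightarrow> bool list \<times> bool list \<times> bool \<times> bool list \<Rightarrow>
    bool list \<times> bool list \<times> bool \<times> bool list" where
  "bit_step c s = (let x = fst s; y = fst (snd s); k = fst (snd (snd s)); a = lsb x; b = lsb y in
     (tl x, tl y, c a b k, ((a = b) = k) # snd (snd (snd s))))"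

definition ripple :: "(bool \<Rightarrow> bool \<Rightarrow> bool \<Rightarrow> bool) \<Rightarrow> bool list \<Rightarrow> bool list \<Rightarrow> bool list \<Rightarrow> bool list \<times> bool" where
  "ripple c f x y = (let s = fold (\<lambda>_. bit_step c) f (x, y, False, []) in
     (rev (snd (snd (snd s))), fst (snd (snd s))))"

definition carry :: "bool \<Rightarrow> bool \<Rightarrow> bool \<Rightarrow> bool" where
  "carry a b k \<longleftrightarrow> (a \<and> b) \<or> (a \<and> k) \<or> (b \<and> k)"

definition borrow :: "bool \<Rightarrow> bool \<Rightarrow> bool \<Rightarrow> bool" where
  "borrow a b k \<longleftrightarrow> (\<not> a \<and> (b \<or> k)) \<or> (b \<and> k)"

definition add_bits :: "bool list \<Rightarrow> bool list \<Rightarrow> bool list" where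
  "add_bits x y = (let s = ripple carry (x @ y) x y in fst s @ [snd s])"

text \<open>
  The fuel \<open>x\<close> suffices for the difference, and keeps the length of \<open>x\<close>; the final borrow needs
  fuel for both numbers.
\<close>

definition diff_bits :: "bool list \<Rightarrow> bool list \<Rightarrow> bool list" where
  "diff_bits x y = fst (ripple borrow x x y)"

definition less_bits :: "bool list \<Rightarrow> bool list \<Rightarrow> bool" where
  "less_bits x y = snd (ripple borrow (x @ y) x y)"

text \<open>The identity at a single position, for addition with carry (\<open>e = 1\<close>) and
  subtraction with borrow (\<open>e = - 1\<close>) at once.\<close>

definition carry_sign :: "(bool \<Rightarrow> bool \<Rightarrow> bool \<Rightarrow> bool) \<Rightarrow> int \<Rightarrow> bool" where
  "carry_sign c e \<longleftrightarrow> (\<forall>a b k. of_bool a + e * (of_bool b + of_bool k) = of_bool ((a = b) = k) + 2 * e * of_bool (c a b k))"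

lemma carry_sign: "carry_sign carry 1" "carry_sign borrow (- 1)"
  by (auto simp: carry_sign_def carry_def borrow_def)

text \<open>An invariant: by the identity of \<open>carry_sign\<close>, weighted with the power of
  two of the position, a round moves value from the unread operands and the carry to the digits
  written, and the total stays the same.\<close>

lemma fold_bit_step:
  assumes "carry_sign c e" "fold (\<lambda>_. bit_step c) f (x, y, k, u) = (x', y', k', u')"
  shows "int (val (rev u')) + 2 ^ length u' * (int (val x') + e * (int (val y') + of_bool k')) =
      int (val (rev u)) + 2 ^ length u * (int (val x) + e * (int (val y) + of_bool k)) \<and>
    x' = drop (length f) x \<and> y' = drop (length f) y \<and> length u' = length f + length u"
  using assms(2)
proof (induction f arbitrary: x y k u)
  case (Cons i f)
  let ?k = "c (lsb x) (lsb y) k" and ?d = "(lsb x = lsb y) = k"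
  have s: "bit_step c (x, y, k, u) = (tl x, tl y, ?k, ?d # u)" by (simp add: bit_step_def Let_def)
  have "int (val x) + e * (int (val y) + of_bool k) =
      of_bool (lsb x) + e * (of_bool (lsb y) + of_bool k) + 2 * (int (val (tl x)) + e * int (val (tl y)))"
    unfolding val_lsb[of x] val_lsb[of y] by (simp add: algebra_simps)
  also have "of_bool (lsb x) + e * (of_bool (lsb y) + of_bool k) = of_bool ?d + 2 * e * of_bool ?k"
    using assms(1) unfolding carry_sign_def by blast
  finally have "int (val (rev (?d # u))) + 2 ^ length (?d # u) * (int (val (tl x)) + e * (int (val (tl y)) + of_bool ?k)) =
      int (val (rev u)) + 2 ^ length u * (int (val x) + e * (int (val y) + of_bool k))"
    by (simp add: val_append algebra_simps)
  moreover have "fold (\<lambda>_. bit_step c) f (tl x, tl y, ?k, ?d # u) = (x', y', k', u')"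
    using Cons.prems s by simp
  note IH = Cons.IH[OF this]
  ultimately show ?case
    using trans[OF conjunct1[OF IH]] IH by (simp add: drop_Suc del: of_bool_eq)
qed simp

lemma ripple:
  assumes "carry_sign c e"
  obtains u k where "ripple c f x y = (u, k)" "length u = length f" "int (val u) < 2 ^ length f"
    "int (val u) + 2 ^ length f * (int (val (drop (length f) x)) + e * (int (val (drop (length f) y)) + of_bool k)) =
      int (val x) + e * int (val y)"
proof -
  obtain x' y' k' u' where s: "fold (\<lambda>_. bit_step c) f (x, y, False, []) = (x', y', k', u')"
    by (metis prod_cases4)
  note b = fold_bit_step[OF assms s]
  have "val (rev u') < 2 ^ length f" using val_less[of "rev u'"] b by simp
  then have "int (val (rev u')) < 2 ^ length f" by (metis of_nat_less_iff of_nat_numeral of_nat_power)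
  moreover have "ripple c f x y = (rev u', k')" by (simp add: ripple_def s Let_def)
  ultimately show ?thesis using b by (intro that[of "rev u'" k']) auto
qed

lemma val_add_bits: "val (add_bits x y) = val x + val y"
proof -
  obtain u k where *: "ripple carry (x @ y) x y = (u, k)" "length u = length (x @ y)"
    "int (val u) + 2 ^ length (x @ y) * (int (val (drop (length (x @ y)) x)) +
      1 * (int (val (drop (length (x @ y)) y)) + of_bool k)) = int (val x) + 1 * int (val y)"
    using ripple[OF carry_sign(1), of "x @ y" x y] by metis
  then have "int (val (u @ [k])) = int (val x + val y)" by (simp add: val_append)
  then show ?thesis unfolding add_bits_def *(1) Let_def by simp
qed

lemma less_bits: "less_bits x y \<longleftrightarrow> val x < val y"
proof -
  obtain u k where *: "ripple borrow (x @ y) x y = (u, k)" "int (val u) < 2 ^ length (x @ y)"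
    "int (val u) + 2 ^ length (x @ y) * (int (val (drop (length (x @ y)) x)) +
      - 1 * (int (val (drop (length (x @ y)) y)) + of_bool k)) = int (val x) + - 1 * int (val y)"
    using ripple[OF carry_sign(2), of "x @ y" x y] by metis
  define m :: int where "m = 2 ^ length (x @ y)"
  \<comment> \<open>The fuel exhausts both operands, so the digits minus the weighted borrow are the
    exact difference. As the digits stay below \<open>m\<close>, the borrow is set exactly when the
    difference is negative.\<close>
  have "int (val u) - m * of_bool k = int (val x) - int (val y)" "int (val u) < m"
    using *(2,3) by (simp_all add: m_def)
  then show ?thesis using *(1) by (cases k) (simp_all add: less_bits_def)
qed

lemma val_diff_bits:
  assumes "val y \<le> val x"
  shows "val (diff_bits x y) = val x - val y"
proof -
  obtain u k where *: "ripple borrow x x y = (u, k)" "int (val u) < 2 ^ length x"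
    "int (val u) + 2 ^ length x * (int (val (drop (length x) x)) +
      - 1 * (int (val (drop (length x) y)) + of_bool k)) = int (val x) + - 1 * int (val y)"
    using ripple[OF carry_sign(2), of x x y] by metis
  define m :: int where "m = 2 ^ length x"
  \<comment> \<open>What is left unread of \<open>y\<close>, plus the last borrow. Any positive
    amount would make the difference negative, against the assumption.\<close>
  define n where "n = int (val (drop (length x) y)) + of_bool k"
  have "int (val u) - m * n = int (val x) - int (val y)" and lt: "int (val u) < m"
    using *(2,3) by (simp_all add: m_def n_def algebra_simps)
  moreover have "n = 0"
  proof (rule ccontr)
    assume "n \<noteq> 0"
    then have "m * 1 \<le> m * n" by (intro mult_left_mono) (auto simp: n_def m_def)
    with calculation assms show False by linarith
  qed
  ultimately show ?thesis using assms *(1) by (simp add: diff_bits_def)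
qed

text \<open>Lengths are the same for every carry function; this serves the size bounds, where
  \<open>c\<close> is arbitrary.\<close>

lemma shape_bit_step:
  "\<exists>k' u'. fold (\<lambda>_. bit_step c) f (x, y, k, u) = (drop (length f) x, drop (length f) y, k', u') \<and>
    length u' = length f + length u"
proof (induction f arbitrary: x y k u)
  case (Cons i f)
  from Cons[of "tl x" "tl y" "c (lsb x) (lsb y) k" "((lsb x = lsb y) = k) # u"]
  show ?case by (simp add: bit_step_def Let_def drop_Suc)
qed simp

lemma length_ripple: "length (fst (ripple c f x y)) = length f"
  using shape_bit_step[of c f x y False "[]"] by (auto simp: ripple_def Let_def)

lemma length_add_bits: "length (add_bits x y) = Suc (length x + length y)"
  by (simp add: add_bits_def Let_def length_ripple)

lemma length_diff_bits: "length (diff_bits x y) = length x"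
  by (simp add: diff_bits_def length_ripple)

lemma pt_ripple:
  assumes c: "polytime (\<lambda>p. c (fst p) (fst (snd p)) (snd (snd p)))"
    and l: "polytime l" and f: "polytime f" "polytime g"
  shows "polytime (\<lambda>x. ripple c (l x) (f x) (g x))"
proof -
  have "polytime (\<lambda>x. fold (\<lambda>_. bit_step c) (l x) (f x, g x, False, []))"
  proof (rule pt_fold)
    show "polytime (\<lambda>p :: 'a \<times> bool \<times> bool list \<times> bool list \<times> bool \<times> bool list. bit_step c (snd (snd p)))"
      unfolding bit_step_def Let_def
      using pt_comp[OF c, of "\<lambda>p :: 'a \<times> bool \<times> bool list \<times> bool list \<times> bool \<times> bool list.
        (lsb (fst (snd (snd p))), lsb (fst (snd (snd (snd p)))), fst (snd (snd (snd (snd p)))))"]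
      by (simp add: pt)
    \<comment> \<open>Three bit lists of length at most \<open>n\<close> with four symbols per bit;
      the constant covers the nodes, the final leaves and the carry.\<close>
    show "polybd (\<lambda>n. 12 * n + 9)" "mono (\<lambda>n :: nat. 12 * n + 9)"
      by (intro pb) (auto intro!: monoI)
    fix x as bs assume l: "l x = as @ bs"
    obtain x' y' k' u' where s: "fold (\<lambda>_. bit_step c) as (f x, g x, False, []) = (x', y', k', u')"
        "x' = drop (length as) (f x)" "y' = drop (length as) (g x)" "length u' = length as"
      using shape_bit_step[of c as "f x" "g x" False "[]"] by auto
    let ?n = "esize x + esize (l x) + esize (f x, g x, False, [] :: bool list)"
    have "length u' \<le> ?n" "length x' \<le> ?n" "length y' \<le> ?n"
      using s(2-) l length_le_esize[of "l x"] length_le_esize[of "f x"] length_le_esize[of "g x"]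
      by auto
    then have "4 * (length x' + length y' + length u') \<le> 4 * (?n + ?n + ?n)"
      by (intro mult_le_mono2 add_mono)
    moreover have "esize (x', y', k', u') \<le> 4 * (length x' + length y' + length u') + 9"
      using esize_bits[of x'] esize_bits[of y'] esize_bits[of u'] esize_bool[of k'] by simp
    ultimately show "esize (fold (\<lambda>_. bit_step c) as (f x, g x, False, [])) \<le> 12 * ?n + 9"
      unfolding s(1) by simp
  qed (intro pt assms)+
  then show ?thesis unfolding ripple_def Let_def by (intro pt)
qed

lemma pt_carry: "polytime (\<lambda>p. carry (fst p) (fst (snd p)) (snd (snd p)))"
  "polytime (\<lambda>p. borrow (fst p) (fst (snd p)) (snd (snd p)))"
  unfolding carry_def borrow_def by (intro pt)+

lemma pt_add_bits [pt]: "polytime f \<Longrightarrow> polytime g \<Longrightarrow> polytime (\<lambda>x. add_bits (f x) (g x))"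
  unfolding add_bits_def Let_def by (intro pt pt_ripple pt_carry)

lemma pt_diff_bits [pt]: "polytime f \<Longrightarrow> polytime g \<Longrightarrow> polytime (\<lambda>x. diff_bits (f x) (g x))"
  unfolding diff_bits_def by (intro pt pt_ripple pt_carry)

lemma pt_less_bits [pt]: "polytime f \<Longrightarrow> polytime g \<Longrightarrow> polytime (\<lambda>x. less_bits (f x) (g x))"
  unfolding less_bits_def by (intro pt pt_ripple pt_carry)

text \<open>Horner's scheme, most significant bit of \<open>x\<close> first: prepending
  \<open>False\<close> doubles the accumulator.\<close>

definition mult_bits :: "bool list \<Rightarrow> bool list \<Rightarrow> bool list" where
  "mult_bits x y = fold (\<lambda>b ac. add_bits (False # ac) (if b then y else [])) (rev x) []"

lemma val_mult_bits: "val (mult_bits x y) = val x * val y"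
proof -
  have "val (fold (\<lambda>b ac. add_bits (False # ac) (if b then y else [])) (rev u) a) =
      val u * val y + 2 ^ length u * val a" for u a
  proof (induction u)
    case (Cons b u)
    then show ?case by (auto simp: val_add_bits algebra_simps)
  qed simp
  then show ?thesis by (simp add: mult_bits_def)
qed

lemma pt_mult_bits [pt]: "polytime f \<Longrightarrow> polytime g \<Longrightarrow> polytime (\<lambda>x. mult_bits (f x) (g x))"
proof -
  assume f: "polytime f" and g: "polytime g"
  have "polytime (\<lambda>p :: (bool list \<times> bool list). fold (\<lambda>b ac. add_bits (False # ac) (if b then snd p else [])) (rev (fst p)) [])"
  proof (rule pt_fold)
    show "polybd (\<lambda>n. 4 * (n * (n + 2)) + 1)" "mono (\<lambda>n :: nat. 4 * (n * (n + 2)) + 1)"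
      by (intro pb, intro monoI add_mono mult_mono) auto
    fix p :: "bool list \<times> bool list" and as bs assume l: "rev (fst p) = as @ bs"
    let ?n = "esize p + esize (rev (fst p)) + esize ([] :: bool list)"
    let ?w = "fold (\<lambda>b ac. add_bits (False # ac) (if b then snd p else [])) as []"
    \<comment> \<open>A round adds at most \<open>length y + 2\<close> bits. The growth is additive,
      so the accumulator has quadratic length.\<close>
    have "length (fold (\<lambda>b ac. add_bits (False # ac) (if b then y else [])) u a) \<le>
        length a + length u * (length y + 2)" for u a and y :: "bool list"
    proof (induction u arbitrary: a)
      case (Cons b u)
      show ?case using Cons[of "add_bits (False # a) (if b then y else [])"]
        by (auto simp: length_add_bits)
    qed simp
    from this[where a = "[]"] have "length ?w \<le> length as * (length (snd p) + 2)" by simp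
    also have "\<dots> \<le> ?n * (?n + 2)"
    proof (intro mult_mono add_mono)
      show "length as \<le> ?n"
        using length_le_esize[of "rev (fst p)"] l by simp
      show "length (snd p) \<le> ?n"
        using length_le_esize[of "snd p"] esize_fst_snd(2)[of p] by simp
    qed auto
    finally show "esize ?w \<le> 4 * (?n * (?n + 2)) + 1" using esize_bits[of ?w] by linarith
  qed (intro pt)+
  from pt_comp[OF this pt_pair[OF f g]] show ?thesis by (simp add: mult_bits_def cong: if_cong)
qed

section \<open>Coprimality by a binary Euclidean algorithm\<close>

definition zero_bits :: "bool list \<Rightarrow> bool" where
  "zero_bits w \<longleftrightarrow> (\<forall>b\<in>set w. \<not> b)"

lemma zero_bits: "zero_bits w \<longleftrightarrow> val w = 0"
  by (induction w) (auto simp: zero_bits_def)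

lemma pt_zero_bits [pt]: "polytime f \<Longrightarrow> polytime (\<lambda>x. zero_bits (f x))"
  unfolding zero_bits_def by (intro pt)

text \<open>
  One round of the binary Euclidean algorithm for coprimality. It is stuck at pairs with first
  component 0 and at pairs of even numbers, and otherwise at least halves the product.
\<close>

definition gcd_step :: "bool list \<times> bool list \<Rightarrow> bool list \<times> bool list" where
  "gcd_step p = (if zero_bits (fst p) \<or> (\<not> lsb (fst p) \<and> \<not> lsb (snd p)) then p
     else if \<not> lsb (fst p) then (tl (fst p), snd p)
     else if \<not> lsb (snd p) then (fst p, tl (snd p))
     else if less_bits (fst p) (snd p) then (fst p, tl (diff_bits (snd p) (fst p)))
     else (tl (diff_bits (fst p) (snd p)), snd p))"

text \<open>There are more rounds than the product of the two numbers has bits, so halving it in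
  each round drives it to zero unless the pair gets stuck at even numbers. A final pair is coprime
  exactly if it is \<open>(0, 1)\<close>, which the last line tests.\<close>

definition coprime_bits :: "bool list \<Rightarrow> bool list \<Rightarrow> bool" where
  "coprime_bits a b \<longleftrightarrow> (let p = fold (\<lambda>_. gcd_step) (True # a @ b) (a, b) in
     zero_bits (fst p) \<and> lsb (snd p) \<and> zero_bits (tl (snd p)))"

text \<open>Every productive move halves one number while the other one is odd, and a factor 2 is
  invisible to an odd partner. When both are odd, the difference is even and may replace the larger
  number before halving. Positivity of \<open>b\<close> is carried along, so that a vanishing
  product means \<open>a = 0\<close>.\<close>

lemma gcd_step_invariant:
  assumes "gcd_step (a, b) = (a', b')" "val b > 0"
  shows "val b' > 0" "coprime (val a') (val b') \<longleftrightarrow> coprime (val a) (val b)"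
    "(a', b') = (a, b) \<and> (val a = 0 \<or> even (val a) \<and> even (val b)) \<or> 2 * (val a' * val b') \<le> val a * val b"
    "length a' + length b' \<le> length a + length b"
proof -
  have lsb: "lsb w \<longleftrightarrow> odd (val w)" for w using val_lsb[of w] by (cases "lsb w") auto
  have half: "val w = 2 * val (tl w)" if "even (val w)" for w
    using val_lsb[of w] that lsb[of w] by simp
  have co: "coprime (2 * m) n \<longleftrightarrow> coprime m n" "coprime n (2 * m) \<longleftrightarrow> coprime n m" if "odd n" for m n :: nat
    using that by (simp_all add: coprime_commute)
  have step: "(a', b') = (if val a = 0 \<or> even (val a) \<and> even (val b) then (a, b)
      else if even (val a) then (tl a, b) else if even (val b) then (a, tl b)
      else if val a < val b then (a, tl (diff_bits b a)) else (tl (diff_bits a b), b))"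
    unfolding assms(1)[symmetric] by (simp add: gcd_step_def zero_bits lsb less_bits)
  consider (stuck) "val a = 0 \<or> even (val a) \<and> even (val b)"
    | (left) "val a \<noteq> 0" "even (val a)" "odd (val b)"
    | (right) "val a \<noteq> 0" "odd (val a)" "even (val b)"
    | (less) "val a \<noteq> 0" "odd (val a)" "odd (val b)" "val a < val b"
    | (ge) "val a \<noteq> 0" "odd (val a)" "odd (val b)" "\<not> val a < val b"
    by (cases "val a = 0") blast+
  then have "val b' > 0 \<and> (coprime (val a') (val b') \<longleftrightarrow> coprime (val a) (val b)) \<and>
    ((a', b') = (a, b) \<and> (val a = 0 \<or> even (val a) \<and> even (val b)) \<or> 2 * (val a' * val b') \<le> val a * val b) \<and>
    length a' + length b' \<le> length a + length b"
  proof cases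
    case stuck
    with step have "(a', b') = (a, b)" by simp
    with stuck assms(2) show ?thesis by simp
  next
    case left_cond: left
    with step have left: "a' = tl a" "b' = b" by simp_all
    note left = left left_cond
    with assms(2) show ?thesis using half[of a] co(1)[of "val b" "val (tl a)"] by simp
  next
    case right_cond: right
    with step have right: "a' = a" "b' = tl b" by simp_all
    note right = right right_cond
    with assms(2) show ?thesis using half[of b] co(2)[of "val a" "val (tl b)"] by simp
  next
    case less_cond: less
    with step have less: "a' = a" "b' = tl (diff_bits b a)" by simp_all
    note less = less less_cond
    have d: "val b - val a = 2 * val b'"
      using half[of "diff_bits b a"] less by (simp add: val_diff_bits)
    have "coprime (val a) (val b') \<longleftrightarrow> coprime (val a) (2 * val b')"
      using co(2)[of "val a" "val b'"] less by simp
    also have "\<dots> \<longleftrightarrow> coprime (val a) (2 * val b' + val a)"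
      unfolding coprime_iff_gcd_eq_1 by (metis gcd_add2 add.commute)
    also have "2 * val b' + val a = val b" using d less by simp
    finally have "coprime (val a') (val b') \<longleftrightarrow> coprime (val a) (val b)" using less by simp
    moreover have "2 * (val a' * val b') \<le> val a * val b"
    proof -
      have "val a * (2 * val b') \<le> val a * val b" unfolding d[symmetric] by (intro mult_le_mono2) simp
      then show ?thesis using less by simp
    qed
    moreover have "val b' > 0" using d less by (intro gr0I) simp
    moreover have "length b' \<le> length b" using less by (simp add: length_diff_bits)
    ultimately show ?thesis using less by auto
  next
    case ge_cond: ge
    with step have ge: "a' = tl (diff_bits a b)" "b' = b" by simp_all
    note ge = ge ge_cond
    have d: "val a - val b = 2 * val a'"
      using half[of "diff_bits a b"] ge by (simp add: val_diff_bits)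
    have "coprime (val a') (val b) \<longleftrightarrow> coprime (2 * val a') (val b)"
      using co(1)[of "val b" "val a'"] ge by simp
    also have "\<dots> \<longleftrightarrow> coprime (2 * val a' + val b) (val b)"
      unfolding coprime_iff_gcd_eq_1 by (metis gcd_add1)
    also have "2 * val a' + val b = val a" using d ge by simp
    finally have "coprime (val a') (val b') \<longleftrightarrow> coprime (val a) (val b)" using ge by simp
    moreover have "2 * (val a' * val b') \<le> val a * val b"
    proof -
      have "2 * val a' * val b \<le> val a * val b" unfolding d[symmetric] by (intro mult_le_mono1) simp
      then show ?thesis using ge by simp
    qed
    moreover have "length a' \<le> length a" using ge by (simp add: length_diff_bits)
    ultimately show ?thesis using ge assms(2) by auto
  qed
  then show "val b' > 0" "coprime (val a') (val b') \<longleftrightarrow> coprime (val a) (val b)"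
    "(a', b') = (a, b) \<and> (val a = 0 \<or> even (val a) \<and> even (val b)) \<or> 2 * (val a' * val b') \<le> val a * val b"
    "length a' + length b' \<le> length a + length b" by auto
qed

text \<open>A stuck pair never changes again. Hence either the final pair is stuck, or every round
  has halved the product.\<close>

lemma fold_gcd_step:
  assumes "fold (\<lambda>_. gcd_step) f (a, b) = (a', b')" "val b > 0"
  shows "val b' > 0 \<and> (coprime (val a') (val b') \<longleftrightarrow> coprime (val a) (val b)) \<and>
    (val a' = 0 \<or> even (val a') \<and> even (val b') \<or> 2 ^ length f * (val a' * val b') \<le> val a * val b)"
  using assms
proof (induction f arbitrary: a b)
  case (Cons u f)
  obtain a1 b1 where s: "gcd_step (a, b) = (a1, b1)" by fastforce
  note inv = gcd_step_invariant[OF s Cons.prems(2)]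
  from Cons.prems(1) have f: "fold (\<lambda>_. gcd_step) f (a1, b1) = (a', b')" by (simp add: s)
  note IH = Cons.IH[OF f inv(1)]
  have "val a' = 0 \<or> even (val a') \<and> even (val b') \<or>
      2 ^ length (u # f) * (val a' * val b') \<le> val a * val b"
  proof (cases "(a1, b1) = (a, b) \<and> (val a = 0 \<or> even (val a) \<and> even (val b))")
    case True
    have "fold (\<lambda>_. gcd_step) f (a, b) = (a, b)"
      using s True by (induction f) auto
    with f True show ?thesis by auto
  next
    case False
    then have "2 * (val a1 * val b1) \<le> val a * val b" using inv(3) by blast
    moreover have "2 ^ length (u # f) * (val a' * val b') = 2 * (2 ^ length f * (val a' * val b'))"
      by simp
    ultimately show ?thesis using IH by linarith
  qed
  with IH inv(2) show ?case by blast
qed auto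

lemma coprime_bits:
  assumes "val b > 0"
  shows "coprime_bits a b \<longleftrightarrow> coprime (val a) (val b)"
proof -
  obtain a' b' where s: "fold (\<lambda>_. gcd_step) (True # a @ b) (a, b) = (a', b')" by fastforce
  have inv: "val b' > 0" "coprime (val a') (val b') \<longleftrightarrow> coprime (val a) (val b)"
    "val a' = 0 \<or> even (val a') \<and> even (val b') \<or>
      2 ^ length (True # a @ b) * (val a' * val b') \<le> val a * val b"
    using fold_gcd_step[OF s assms] by blast+
  have "val a * val b < 2 ^ length a * 2 ^ length b"
    using val_less[of a] val_less[of b] by (intro mult_strict_mono) auto
  then have lt: "val a * val b < 2 ^ length (True # a @ b)" by (simp add: power_add)
  have zero: "val a' = 0 \<or> even (val a') \<and> even (val b')"
  proof (rule ccontr)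
    assume *: "\<not> ?thesis"
    then have "val a' * val b' \<ge> 1" using inv(1) by simp
    then have "2 ^ length (True # a @ b) * 1 \<le> (2 :: nat) ^ length (True # a @ b) * (val a' * val b')"
      by (intro mult_le_mono2)
    with inv(3) * lt show False by linarith
  qed
  have "coprime_bits a b \<longleftrightarrow> val a' = 0 \<and> val b' = 1"
    using s val_lsb[of b'] by (auto simp: coprime_bits_def zero_bits split: if_splits)
  also have "\<dots> \<longleftrightarrow> coprime (val a') (val b')"
    using zero
  proof
    assume "even (val a') \<and> even (val b')"
    then have "\<not> coprime (val a') (val b')" using coprime_common_divisor[of "val a'" "val b'" 2] by auto
    with \<open>even (val a') \<and> even (val b')\<close> show ?thesis by auto
  qed simp
  finally show ?thesis using inv(2) by simp
qed

lemma pt_coprime_bits [pt]: "polytime f \<Longrightarrow> polytime g \<Longrightarrow> polytime (\<lambda>x. coprime_bits (f x) (g x))"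
proof -
  assume f: "polytime f" and g: "polytime g"
  have len: "length (fst (fold (\<lambda>_. gcd_step) u p)) + length (snd (fold (\<lambda>_. gcd_step) u p)) \<le>
      length (fst p) + length (snd p)" for u :: "bool list" and p
  proof (induction u arbitrary: p)
    case (Cons b u)
    have "length (fst (gcd_step p)) + length (snd (gcd_step p)) \<le> length (fst p) + length (snd p)"
      by (auto simp: gcd_step_def length_diff_bits)
    with Cons[of "gcd_step p"] show ?case by simp
  qed simp
  have "polytime (\<lambda>x. fold (\<lambda>_. gcd_step) (True # f x @ g x) (f x, g x))"
  proof (rule pt_fold)
    show "polytime (\<lambda>p :: 'a \<times> bool \<times> bool list \<times> bool list. gcd_step (snd (snd p)))"
      unfolding gcd_step_def by (intro pt)
    show "polybd (\<lambda>n. 4 * n + 9)" "mono (\<lambda>n :: nat. 4 * n + 9)"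
      by (intro pb) (auto intro!: monoI)
    fix x as bs assume l: "True # f x @ g x = as @ bs"
    let ?n = "esize x + esize (True # f x @ g x) + esize (f x, g x)"
    obtain a b where s: "fold (\<lambda>_. gcd_step) as (f x, g x) = (a, b)" by fastforce
    have "esize (a, b) \<le> 4 * (length a + length b) + 9"
      using esize_bits[of a] esize_bits[of b] by simp
    also have "length a + length b \<le> ?n"
      using len[of as "(f x, g x)"] length_le_esize[of "f x"] length_le_esize[of "g x"] s by simp
    finally show "esize (fold (\<lambda>_. gcd_step) as (f x, g x)) \<le> 4 * ?n + 9"
      unfolding s by simp
  qed (intro pt f g)+
  then show ?thesis unfolding coprime_bits_def Let_def by (intro pt)
qed

section \<open>Numbers and constants as coded data\<close>

lemma val_bits: "val (bits n) = n"
proof (induction n rule: less_induct)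
  case (less n)
  show ?case
  proof (cases "n = 0")
    case False
    then have "val (bits (n div 2)) = n div 2" by (intro less) simp
    then show ?thesis using bits.simps[of n] False
      by (cases "even n") (auto elim!: oddE evenE)
  qed (simp add: bits.simps)
qed

text \<open>Together with \<open>last_bits\<close>: the canonical codes of numbers are the bit lists
  without a leading zero, a condition that a parser can test.\<close>

lemma bits_val: "w = [] \<or> last w \<Longrightarrow> bits (val w) = w"
proof (induction w)
  case (Cons b w)
  show ?case
  proof (cases "w = []")
    case False
    then have w: "bits (val w) = w" using Cons by simp
    have "bits 0 = []" by (simp add: bits.simps)
    with w False have "val w \<noteq> 0" by metis
    then show ?thesis using bits.simps[of "val (b # w)"] w by (cases b) auto
  qed (use Cons in \<open>simp add: bits.simps\<close>)
qed (simp add: bits.simps)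

lemma last_bits: "bits n = [] \<or> last (bits n)"
proof (induction n rule: less_induct)
  case (less n)
  show ?case
  proof (cases "n = 0")
    case False
    then have *: "bits (n div 2) = [] \<or> last (bits (n div 2))" by (intro less) simp
    show ?thesis
    proof (cases "bits (n div 2) = []")
      case True
      then have "n div 2 = 0" using val_bits[of "n div 2"] by simp
      then have "n = 1" using False by linarith
      then show ?thesis by (simp add: bits.simps)
    next
      case f: False
      then show ?thesis using * bits.simps[of n] False by simp
    qed
  qed (simp add: bits.simps)
qed

instantiation tree :: encodable
begin
definition tree_of_tree :: "tree \<Rightarrow> tree" where "tree_of_tree t = t"
instance by standard (simp add: tree_of_tree_def)
end

instantiation nat :: encodable
begin
definition tree_of_nat :: "nat \<Rightarrow> tree" where "tree_of_nat n = tree_of (bits n)"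
instance by standard (auto simp: tree_of_nat_def dest!: tree_of_inj intro: bits_inj)
end

instantiation int :: encodable
begin
definition tree_of_int :: "int \<Rightarrow> tree" where "tree_of_int i = tree_of (i < 0, nat \<bar>i\<bar>)"
instance
proof
  fix x y :: int
  assume "tree_of x = tree_of y"
  then have "(x < 0) = (y < 0)" "nat \<bar>x\<bar> = nat \<bar>y\<bar>"
    by (simp_all add: tree_of_int_def tree_of_eq_iff)
  then show "x = y" by linarith
qed
end

instantiation rat :: encodable
begin
definition tree_of_rat :: "rat \<Rightarrow> tree" where
  "tree_of_rat r = tree_of (fst (quotient_of r), nat (snd (quotient_of r)))"
instance
proof
  fix x y :: rat
  assume "tree_of x = tree_of y"
  then have *: "fst (quotient_of x) = fst (quotient_of y)" "nat (snd (quotient_of x)) = nat (snd (quotient_of y))"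
    by (simp_all add: tree_of_rat_def tree_of_eq_iff)
  have "snd (quotient_of x) > 0" "snd (quotient_of y) > 0" by (simp_all add: quotient_of_denom_pos')
  with * have "quotient_of x = quotient_of y" by (simp add: prod_eq_iff)
  then show "x = y" by (simp add: quotient_of_inject)
qed
end

instantiation cst :: encodable
begin
fun tree_of_cst :: "cst \<Rightarrow> tree" where
  "tree_of_cst (Num r) = tree_of (False, r)"
| "tree_of_cst (Name s) = tree_of (True, s)"
instance
proof
  fix x y :: cst
  show "tree_of x = tree_of y \<Longrightarrow> x = y" by (cases x; cases y) (auto simp: tree_of_eq_iff)
qed
end

lemma pt_bits [pt]: "polytime f \<Longrightarrow> polytime (\<lambda>x. bits (f x))"
  by (rule pt_cong[where g = f]) (simp_all add: tree_of_nat_def)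

lemma pt_int_parts:
  assumes "polytime (f :: 'a :: encodable \<Rightarrow> int)"
  shows "polytime (\<lambda>x. (f x < 0, nat \<bar>f x\<bar>))"
  by (rule pt_cong[OF _ assms]) (simp add: tree_of_int_def)

lemma pt_int_neg [pt]: "polytime f \<Longrightarrow> polytime (\<lambda>x. (f x :: int) < 0)"
  using pt_fst[OF pt_int_parts] by simp

lemma pt_int_abs [pt]: "polytime f \<Longrightarrow> polytime (\<lambda>x. nat \<bar>f x :: int\<bar>)"
  using pt_snd[OF pt_int_parts] by simp

lemma pt_rat_parts:
  assumes "polytime (f :: 'a :: encodable \<Rightarrow> rat)"
  shows "polytime (\<lambda>x. (fst (quotient_of (f x)), nat (snd (quotient_of (f x)))))"
  by (rule pt_cong[OF _ assms]) (simp add: tree_of_rat_def)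

lemma pt_rat_num [pt]: "polytime f \<Longrightarrow> polytime (\<lambda>x. fst (quotient_of (f x)))"
  using pt_fst[OF pt_rat_parts] by simp

lemma pt_rat_den [pt]: "polytime f \<Longrightarrow> polytime (\<lambda>x. nat (snd (quotient_of (f x))))"
  using pt_snd[OF pt_rat_parts] by simp

text \<open>Cross-multiplication by positive denominators. Signs are split off because
  multiplication is available for natural numbers only. As a rewrite rule the lemma turns the order
  into an expression to which the closure rules apply.\<close>

lemma rat_less_iff:
  "r < s \<longleftrightarrow> (let a = fst (quotient_of r); b = bits (nat (snd (quotient_of r)));
      c = fst (quotient_of s); d = bits (nat (snd (quotient_of s)));
      m = mult_bits (bits (nat \<bar>a\<bar>)) d; n = mult_bits (bits (nat \<bar>c\<bar>)) b in
    if a < 0 then (if c < 0 then less_bits n m else True) else (if c < 0 then False else less_bits m n))"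
proof -
  obtain a b c d where q: "quotient_of r = (a, b)" "quotient_of s = (c, d)" by fastforce
  have pos: "b > 0" "d > 0" using q quotient_of_denom_pos by auto
  have "r < s \<longleftrightarrow> of_int a / of_int b < (of_int c / of_int d :: rat)"
    using q quotient_of_div by metis
  also have "\<dots> \<longleftrightarrow> a * d < c * b"
  proof -
    have "of_int a / of_int b < (of_int c / of_int d :: rat) \<longleftrightarrow> of_int a * of_int d < (of_int c * of_int b :: rat)"
      using pos by (simp add: divide_simps)
    also have "\<dots> \<longleftrightarrow> a * d < c * b" by (metis of_int_less_iff of_int_mult)
    finally show ?thesis .
  qed
  finally have *: "r < s \<longleftrightarrow> a * d < c * b" .
  have nn: "nat x * nat y < nat u * nat v \<longleftrightarrow> x * y < u * v"
    if "x \<ge> 0" "y \<ge> 0" "u \<ge> 0" "v \<ge> 0" for x y u v :: int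
    using that nat_less_eq_zless[of "x * y" "u * v"] by (simp only: nat_mult_distrib mult_nonneg_nonneg)
  have "a * d < c * b" if "a < 0" "\<not> c < 0"
  proof -
    have "a * d < 0" "c * b \<ge> 0" using that pos by (simp_all add: mult_less_0_iff)
    then show ?thesis by linarith
  qed
  moreover have "\<not> a * d < c * b" if "\<not> a < 0" "c < 0"
  proof -
    have "a * d \<ge> 0" "c * b < 0" using that pos by (simp_all add: mult_less_0_iff)
    then show ?thesis by linarith
  qed
  ultimately show ?thesis
    unfolding * q fst_conv snd_conv Let_def less_bits val_mult_bits val_bits
    using pos nn[of "\<bar>a\<bar>" d "\<bar>c\<bar>" b] nn[of "\<bar>c\<bar>" b "\<bar>a\<bar>" d]
    by (cases "a < 0"; cases "c < 0") auto
qed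

lemma pt_rat_less [pt]: "polytime f \<Longrightarrow> polytime g \<Longrightarrow> polytime (\<lambda>x. (f x :: rat) < g x)"
  unfolding rat_less_iff Let_def by (intro pt)

lemma pt_Num [pt]: "polytime f \<Longrightarrow> polytime (\<lambda>x. Num (f x))"
  by (rule pt_cong[of _ "\<lambda>x. (False, f x)"]) (auto intro: pt)

lemma pt_Name [pt]: "polytime f \<Longrightarrow> polytime (\<lambda>x. Name (f x))"
  by (rule pt_cong[of _ "\<lambda>x. (True, f x)"]) (auto intro: pt)

definition is_number :: "cst \<Rightarrow> bool" where
  "is_number c \<longleftrightarrow> sort_of c = SQ"

lemma is_number_simps [simp]: "is_number (Num r)" "\<not> is_number (Name s)"
  by (simp_all add: is_number_def)

fun the_num :: "cst \<Rightarrow> rat" where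
  "the_num (Num r) = r"
| "the_num (Name s) = 0"

text \<open>A view of constants that leaves the payload as a bare tree, so that rationals and names
  fit into one result type with unchanged codes.\<close>

definition cst_parts :: "cst \<Rightarrow> bool \<times> tree" where
  "cst_parts c = (case c of Num r \<Rightarrow> (False, tree_of r) | Name s \<Rightarrow> (True, tree_of s))"

lemma pt_cst_parts: "polytime f \<Longrightarrow> polytime (\<lambda>x. cst_parts (f x))"
  by (rule pt_cong[where g = f]) (auto simp: cst_parts_def tree_of_tree_def split: cst.splits)

lemma pt_is_number [pt]:
  assumes "polytime f"
  shows "polytime (\<lambda>x. is_number (f x))"
proof -
  have "polytime (\<lambda>x. \<not> fst (cst_parts (f x)))" by (intro pt pt_cst_parts assms)
  then show ?thesis by (rule pt_cong[rotated]) (auto simp: cst_parts_def split: cst.splits)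
qed

lemma pt_the_num [pt]:
  assumes "polytime f"
  shows "polytime (\<lambda>x. the_num (f x))"
proof -
  have "polytime (\<lambda>x. if is_number (f x) then snd (cst_parts (f x)) else tree_of (0 :: rat))"
    by (intro pt pt_cst_parts assms)
  then show ?thesis
    by (rule pt_cong[rotated]) (auto simp: cst_parts_def tree_of_tree_def split: cst.splits)
qed

section \<open>Parsing\<close>

type_synonym 'a parser = "bool list \<Rightarrow> ('a \<times> bool list) option"

text \<open>\<open>sized\<close> is what keeps the accumulator of \<open>parse_list\<close> polynomial.\<close>

definition parses :: "('a \<Rightarrow> bool list) \<Rightarrow> 'a parser \<Rightarrow> bool" where
  "parses e p \<longleftrightarrow> (\<forall>w x r. p w = Some (x, r) \<longleftrightarrow> w = e x @ r)"

definition sized :: "('a :: encodable \<Rightarrow> bool list) \<Rightarrow> bool" where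
  "sized e \<longleftrightarrow> (\<exists>c. \<forall>x. esize x \<le> c * (length (e x) + 1))"

definition ptparser :: "('a :: encodable \<Rightarrow> bool list) \<Rightarrow> 'a parser \<Rightarrow> bool" where
  "ptparser e p \<longleftrightarrow> parses e p \<and> sized e \<and> polytime p"

lemma parsesD: "parses e p \<Longrightarrow> p w = Some (x, r) \<longleftrightarrow> w = e x @ r"
  unfolding parses_def by blast

definition parse_bit :: "bool parser" where
  "parse_bit w = (case w of [] \<Rightarrow> None | b # r \<Rightarrow> Some (b, r))"

lemma ptparser_bit: "ptparser (\<lambda>b. [b]) parse_bit"
proof -
  have "polytime (\<lambda>w. parse_bit w)" unfolding parse_bit_def by (intro pt)
  moreover have "parses (\<lambda>b. [b]) parse_bit"
    by (auto simp: parses_def parse_bit_def split: list.splits)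
  moreover have "esize b \<le> 3 * (length [b] + 1)" for b :: bool
    using esize_bool[of b] by simp
  then have "sized (\<lambda>b. [b])" unfolding sized_def by blast
  ultimately show ?thesis by (simp add: ptparser_def)
qed

definition parse_pair :: "'a parser \<Rightarrow> 'b parser \<Rightarrow> ('a \<times> 'b) parser" where
  "parse_pair p q w = (case p w of None \<Rightarrow> None
     | Some u \<Rightarrow> (case q (snd u) of None \<Rightarrow> None | Some v \<Rightarrow> Some ((fst u, fst v), snd v)))"

lemma ptparser_pair:
  assumes "ptparser e p" "ptparser e' q"
  shows "ptparser (\<lambda>x. e (fst x) @ e' (snd x)) (parse_pair p q)"
proof -
  have p: "parses e p" "sized e" "polytime p" and q: "parses e' q" "sized e'" "polytime q"
    using assms by (auto simp: ptparser_def)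
  have "polytime (\<lambda>w. parse_pair p q w)"
    unfolding parse_pair_def by (intro pt pt_comp[OF q(3)] p(3))
  moreover have "parses (\<lambda>x. e (fst x) @ e' (snd x)) (parse_pair p q)"
    unfolding parses_def
  proof (intro allI)
    fix w x r
    show "parse_pair p q w = Some (x, r) \<longleftrightarrow> w = (e (fst x) @ e' (snd x)) @ r"
    proof
      assume "parse_pair p q w = Some (x, r)"
      then obtain a u b where "p w = Some (a, u)" "q u = Some (b, r)" "x = (a, b)"
        by (auto simp: parse_pair_def split: option.splits)
      then show "w = (e (fst x) @ e' (snd x)) @ r" using parsesD[OF p(1)] parsesD[OF q(1)] by simp
    next
      assume "w = (e (fst x) @ e' (snd x)) @ r"
      then have "p w = Some (fst x, e' (snd x) @ r)" "q (e' (snd x) @ r) = Some (snd x, r)"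
        using parsesD[OF p(1)] parsesD[OF q(1)] by simp_all
      then show "parse_pair p q w = Some (x, r)" by (simp add: parse_pair_def)
    qed
  qed
  moreover have "sized (\<lambda>x. e (fst x) @ e' (snd x))"
  proof -
    obtain c d where c: "\<And>x. esize x \<le> c * (length (e x) + 1)" and d: "\<And>x. esize x \<le> d * (length (e' x) + 1)"
      using p(2) q(2) by (auto simp: sized_def)
    have "esize (x, y) \<le> (c + d + 1) * (length (e x @ e' y) + 1)" for x y
    proof -
      define m where "m = length (e x @ e' y) + 1"
      have "esize x \<le> c * m" by (rule order_trans[OF c]) (simp add: m_def)
      moreover have "esize y \<le> d * m" by (rule order_trans[OF d]) (simp add: m_def)
      moreover have "1 \<le> m" by (simp add: m_def)
      ultimately show ?thesis unfolding m_def[symmetric] by (simp add: add_mult_distrib)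
    qed
    then show ?thesis unfolding sized_def by (intro exI[of _ "c + d + 1"]) auto
  qed
  ultimately show ?thesis by (simp add: ptparser_def)
qed

text \<open>Raw and converted values are coded by the same tree, so the conversion costs nothing.\<close>

definition parse_conv :: "('a \<Rightarrow> bool) \<Rightarrow> ('a \<Rightarrow> 'b) \<Rightarrow> 'a parser \<Rightarrow> 'b parser" where
  "parse_conv ok conv p w = (case p w of None \<Rightarrow> None
     | Some u \<Rightarrow> if ok (fst u) then Some (conv (fst u), snd u) else None)"

lemma ptparser_conv:
  assumes "ptparser e p" and "polytime ok"
    and ok: "\<And>y. ok (raw y)" "\<And>a. ok a \<Longrightarrow> raw (conv a) = a" "\<And>y. conv (raw y) = y"
    and tree: "\<And>y. tree_of y = tree_of (raw y)" and e': "\<And>y. e' y = e (raw y)"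
  shows "ptparser e' (parse_conv ok conv p)"
proof -
  have p: "parses e p" "sized e" "polytime p" using assms(1) by (auto simp: ptparser_def)
  have "polytime (\<lambda>w. parse_conv ok (\<lambda>a. a) p w)"
    unfolding parse_conv_def by (intro pt pt_comp[OF assms(2)] p(3))
  then have "polytime (\<lambda>w. parse_conv ok conv p w)"
    by (rule pt_cong[rotated]) (auto simp: parse_conv_def tree ok split: option.splits)
  moreover have "parses e' (parse_conv ok conv p)"
    unfolding parses_def
  proof (intro allI)
    fix w y r
    show "parse_conv ok conv p w = Some (y, r) \<longleftrightarrow> w = e' y @ r"
    proof
      assume "parse_conv ok conv p w = Some (y, r)"
      then obtain a where "p w = Some (a, r)" "ok a" "y = conv a"
        by (auto simp: parse_conv_def split: option.splits if_splits)
      then show "w = e' y @ r" using parsesD[OF p(1)] ok(2) e' by simp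
    next
      assume "w = e' y @ r"
      then have "p w = Some (raw y, r)" using parsesD[OF p(1)] e' by simp
      then show "parse_conv ok conv p w = Some (y, r)" by (simp add: parse_conv_def ok)
    qed
  qed
  moreover have "sized e'"
    using p(2) unfolding sized_def esize_def tree e' by blast
  ultimately show ?thesis by (simp add: ptparser_def)
qed

definition parse_step :: "'a parser \<Rightarrow> ('a list \<times> bool list) \<times> bool \<Rightarrow> ('a list \<times> bool list) \<times> bool" where
  "parse_step p s = (if \<not> snd s then s else
     (case snd (fst s) of [] \<Rightarrow> s
      | b # r \<Rightarrow> if b then (case p r of None \<Rightarrow> s | Some u \<Rightarrow> ((fst u # fst (fst s), snd u), True))
          else ((fst (fst s), r), False)))"

text \<open>
  The flag of the state tells that the list is still open; the word serves as fuel, since every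
  round consumes a bit, and a state that is stuck with an open list signals a failure.
\<close>

definition parse_list :: "'a parser \<Rightarrow> 'a list parser" where
  "parse_list p w = (let s = fold (\<lambda>_. parse_step p) w (([], w), True) in
     if snd s then None else Some (rev (fst (fst s)), snd (fst s)))"

lemma enc_list_simps: "enc_list e [] = [False]" "enc_list e (x # xs) = True # e x @ enc_list e xs"
  by (simp_all add: enc_list_def)

text \<open>No bit is lost: the elements found so far, written down again, and the rest restore the
  word. This gives the soundness of the parser and also bounds its accumulator by the input.\<close>

lemma parse_step_invariant:
  assumes "parses e p" "fold (\<lambda>_. parse_step p) f (([], w), True) = ((acs, r), b)"
  shows "w = concat (map (\<lambda>x. True # e x) (rev acs)) @ (if b then r else False # r)"
  using assms(2)
proof (induction f arbitrary: acs r b rule: rev_induct)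
  case (snoc a f)
  obtain as' r' b' where s: "fold (\<lambda>_. parse_step p) f (([], w), True) = ((as', r'), b')"
    by (metis prod.exhaust)
  note IH = snoc.IH[OF s]
  have "parse_step p ((as', r'), b') = ((acs, r), b)" using snoc.prems s by simp
  then show ?case using IH
    by (auto simp: parse_step_def parsesD[OF assms(1)] split: if_splits list.splits option.splits)
qed simp

lemma parses_list:
  assumes "parses e p"
  shows "parses (enc_list e) (parse_list p)"
  unfolding parses_def
proof (intro allI)
  fix w xs r
  show "parse_list p w = Some (xs, r) \<longleftrightarrow> w = enc_list e xs @ r"
  proof
    obtain acs r' b where s: "fold (\<lambda>_. parse_step p) w (([], w), True) = ((acs, r'), b)"
      by (metis prod.exhaust)
    assume "parse_list p w = Some (xs, r)"
    then have "\<not> b" "xs = rev acs" "r = r'" by (auto simp: parse_list_def s Let_def split: if_splits)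
    with parse_step_invariant[OF assms s] show "w = enc_list e xs @ r" by (simp add: enc_list_def)
  next
    assume w: "w = enc_list e xs @ r"
    have stop: "fold (\<lambda>_. parse_step p) f ((acs, u), False) = ((acs, u), False)" for f acs u
      by (induction f) (auto simp: parse_step_def)
    \<comment> \<open>The inequality is strict because the closing \<open>False\<close> takes a
      round of its own.\<close>
    have run: "fold (\<lambda>_. parse_step p) f ((acs, enc_list e ys @ r), True) = ((rev ys @ acs, r), False)"
      if "length ys < length f" for f :: "bool list" and acs ys
      using that
    proof (induction ys arbitrary: acs f)
      case Nil
      then obtain a f' where f: "f = a # f'" by (cases f) auto
      have "parse_step p ((acs, enc_list e [] @ r), True) = ((acs, r), False)"
        by (simp add: parse_step_def enc_list_simps)
      then show ?case by (simp add: f stop)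
    next
      case (Cons y ys)
      then obtain a f' where f: "f = a # f'" by (cases f) auto
      have "p (e y @ enc_list e ys @ r) = Some (y, enc_list e ys @ r)"
        using parsesD[OF assms] by simp
      then have "parse_step p ((acs, enc_list e (y # ys) @ r), True) = ((y # acs, enc_list e ys @ r), True)"
        by (simp add: parse_step_def enc_list_simps)
      then show ?case using Cons.IH[of f' "y # acs"] Cons.prems by (simp add: f)
    qed
    \<comment> \<open>Every element costs at least its marker and the list its terminator, so the
      word is enough fuel for its own parsing.\<close>
    have "length xs < length (enc_list e xs)"
      by (induction xs) (auto simp: enc_list_simps)
    then have "length xs < length w" by (simp add: w)
    from run[OF this, of "[]"] show "parse_list p w = Some (xs, r)"
      unfolding parse_list_def w[symmetric] by simp
  qed
qed

lemma sized_concat: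
  assumes "\<And>x. esize x \<le> c * (length (e x) + 1)"
  shows "esize xs \<le> (c + 1) * length (concat (map (\<lambda>x. True # e x) xs)) + 1"
proof (induction xs)
  case (Cons x xs)
  then show ?case using assms[of x] by (simp add: add_mult_distrib2 add_mult_distrib)
qed simp

lemma ptparser_list:
  assumes "ptparser e p"
  shows "ptparser (enc_list e) (parse_list p)"
proof -
  have p: "parses e p" "sized e" "polytime p" using assms by (auto simp: ptparser_def)
  obtain c where c: "\<And>x. esize x \<le> c * (length (e x) + 1)" using p(2) by (auto simp: sized_def)
  have "polytime (\<lambda>w :: bool list. fold (\<lambda>_. parse_step p) w (([], w), True))"
  proof (rule pt_fold)
    show "polytime (\<lambda>q :: bool list \<times> bool \<times> ('a list \<times> bool list) \<times> bool. parse_step p (snd (snd q)))"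
      unfolding parse_step_def by (intro pt pt_comp[OF p(3)])
    show "polybd (\<lambda>n. (c + 1) * n + 4 * n + 10)" by (intro pb)
    show "mono (\<lambda>n. (c + 1) * n + 4 * n + 10)" by (intro monoI add_mono mult_le_mono2) auto
    fix w f bs :: "bool list" assume "w = f @ bs"
    let ?n = "esize w + esize w + esize (([] :: 'a list, w), True)"
    obtain acs r b where s: "fold (\<lambda>_. parse_step p) f (([], w), True) = ((acs, r), b)"
      by (metis prod.exhaust)
    note w = parse_step_invariant[OF p(1) s]
    let ?u = "concat (map (\<lambda>x. True # e x) (rev acs))"
    have n: "length w \<le> ?n" using length_le_esize[of w] by simp
    have "length w = length ?u + length (if b then r else False # r)"
      using arg_cong[OF w, of length] by (simp only: length_append)
    then have l: "length ?u \<le> ?n" "length r \<le> ?n" using n by (auto split: if_splits)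
    have "esize acs \<le> (c + 1) * length ?u + 1" using sized_concat[OF c, of "rev acs"] by simp
    also have "\<dots> \<le> (c + 1) * ?n + 1" using l(1) by (intro add_mono mult_le_mono2) auto
    finally have "esize acs \<le> (c + 1) * ?n + 1" .
    moreover have "esize r \<le> 4 * ?n + 1"
      by (rule order_trans[OF esize_bits]) (intro add_mono mult_le_mono2 l(2) order_refl)
    ultimately show "esize (fold (\<lambda>_. parse_step p) f (([], w), True)) \<le> (c + 1) * ?n + 4 * ?n + 10"
      unfolding s esize_simps(3)[of "(acs, r)"] esize_simps(3)[of acs] using esize_bool[of b] by simp
  qed (intro pt)+
  then have "polytime (\<lambda>w. parse_list p w)"
    unfolding parse_list_def Let_def by (intro pt)
  moreover have "sized (enc_list e)"
  proof -
    have "esize xs \<le> (c + 1) * (length (enc_list e xs) + 1)" for xs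
    proof -
      have "(c + 1) * length (concat (map (\<lambda>x. True # e x) xs)) + 1 \<le> (c + 1) * (length (enc_list e xs) + 1)"
        by (simp add: enc_list_def)
      with sized_concat[OF c, of xs] show ?thesis by linarith
    qed
    then show ?thesis unfolding sized_def by blast
  qed
  ultimately show ?thesis using parses_list[OF p(1)] by (simp add: ptparser_def)
qed

definition parse_str :: "bool list parser" where
  "parse_str = parse_list parse_bit"

lemma ptparser_str: "ptparser enc_str parse_str"
  unfolding enc_str_def parse_str_def by (rule ptparser_list[OF ptparser_bit])

definition parse_nat :: "nat parser" where
  "parse_nat = parse_conv (\<lambda>w. w = [] \<or> lsb (rev w)) val parse_str"

lemma ptparser_nat: "ptparser enc_nat parse_nat"
  unfolding parse_nat_def
proof (rule ptparser_conv[OF ptparser_str, where raw = bits])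
  have lsb: "w \<noteq> [] \<Longrightarrow> lsb (rev w) = last w" for w
    by (cases w rule: rev_cases) (auto simp: lsb_def)
  show "polytime (\<lambda>w. w = [] \<or> lsb (rev w))" by (intro pt)
  show "bits n = [] \<or> lsb (rev (bits n))" for n
    using last_bits[of n] lsb by blast
  show "bits (val w) = w" if "w = [] \<or> lsb (rev w)" for w
    using that bits_val[of w] lsb by blast
qed (simp_all add: val_bits tree_of_nat_def enc_nat_def)

text \<open>The test rejects a negative zero, which codes no integer.\<close>

definition parse_int :: "int parser" where
  "parse_int = parse_conv (\<lambda>u. fst u \<longrightarrow> snd u \<noteq> 0) (\<lambda>u. if fst u then - int (snd u) else int (snd u))
     (parse_pair parse_bit parse_nat)"

lemma ptparser_int: "ptparser enc_int parse_int"
  unfolding parse_int_def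
proof (rule ptparser_conv[OF ptparser_pair[OF ptparser_bit ptparser_nat],
      where raw = "\<lambda>i. (i < 0, nat \<bar>i\<bar>)"])
  show "polytime (\<lambda>u :: bool \<times> nat. fst u \<longrightarrow> snd u \<noteq> 0)" by (intro pt)
qed (auto simp: tree_of_int_def enc_int_def)

text \<open>Only reduced fractions with nonzero denominator are codes. Accepting other fractions
  would accept words outside the languages. For numerator 0, coprimality leaves only the denominator
  1.\<close>

definition parse_rat :: "rat parser" where
  "parse_rat = parse_conv (\<lambda>u. snd u \<noteq> 0 \<and> coprime_bits (bits (nat \<bar>fst u\<bar>)) (bits (snd u)))
     (\<lambda>u. Fract (fst u) (int (snd u))) (parse_pair parse_int parse_nat)"

lemma ptparser_rat: "ptparser enc_rat parse_rat"
  unfolding parse_rat_def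
proof (rule ptparser_conv[OF ptparser_pair[OF ptparser_int ptparser_nat],
      where raw = "\<lambda>r. (fst (quotient_of r), nat (snd (quotient_of r)))"])
  let ?ok = "\<lambda>u. snd u \<noteq> 0 \<and> coprime_bits (bits (nat \<bar>fst u\<bar>)) (bits (snd u))"
  have ok: "?ok (a, n) \<longleftrightarrow> n > 0 \<and> coprime a (int n)" for a n
  proof (cases "n > 0")
    case True
    have "coprime (nat \<bar>a\<bar>) n \<longleftrightarrow> coprime (int (nat \<bar>a\<bar>)) (int n)" by (simp only: coprime_int_iff)
    then show ?thesis using True by (simp add: coprime_bits val_bits)
  qed simp
  show "polytime ?ok" by (intro pt)
  show "?ok (fst (quotient_of r), nat (snd (quotient_of r)))" for r
    using quotient_of_denom_pos'[of r] quotient_of_coprime[of r "fst (quotient_of r)" "snd (quotient_of r)"]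
    unfolding ok by simp
  show "(fst (quotient_of (Fract (fst u) (int (snd u)))), nat (snd (quotient_of (Fract (fst u) (int (snd u)))))) = u"
    if "?ok u" for u
  proof -
    have "coprime (fst u) (int (snd u))" "0 < int (snd u)" using that ok[of "fst u" "snd u"] by auto
    then have "quotient_of (Fract (fst u) (int (snd u))) = (fst u, int (snd u))"
      by (simp add: quotient_of_Fract normalize_stable)
    then show ?thesis by simp
  qed
  show "Fract (fst (fst (quotient_of r), nat (snd (quotient_of r))))
      (int (snd (fst (quotient_of r), nat (snd (quotient_of r))))) = r" for r
    using quotient_of_denom_pos'[of r] quotient_of_div[of r "fst (quotient_of r)" "snd (quotient_of r)"]
    by (simp add: Fract_of_int_quotient)
qed (auto simp: tree_of_rat_def enc_rat_def split: prod.splits)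

definition parse_cst :: "cst parser" where
  "parse_cst w = (case w of [] \<Rightarrow> None
     | b # r \<Rightarrow> if b then (case parse_str r of None \<Rightarrow> None | Some u \<Rightarrow> Some (Name (fst u), snd u))
         else (case parse_rat r of None \<Rightarrow> None | Some u \<Rightarrow> Some (Num (fst u), snd u)))"

lemma ptparser_cst: "ptparser enc_constant parse_cst"
proof -
  have s: "parses enc_str parse_str" "sized enc_str" "polytime parse_str"
    and r: "parses enc_rat parse_rat" "sized enc_rat" "polytime parse_rat"
    using ptparser_str ptparser_rat by (auto simp: ptparser_def)
  have "polytime (\<lambda>w. parse_cst w)"
    unfolding parse_cst_def by (intro pt pt_comp[OF s(3)] pt_comp[OF r(3)])
  moreover have "parses enc_constant parse_cst"
    unfolding parses_def
  proof (intro allI)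
    fix w x u
    show "parse_cst w = Some (x, u) \<longleftrightarrow> w = enc_constant x @ u"
    proof (cases w)
      case Nil
      then show ?thesis by (cases x) (auto simp: parse_cst_def)
    next
      case (Cons b v)
      then have "parse_cst w = Some (x, u) \<longleftrightarrow>
          (if b then \<exists>s. x = Name s \<and> parse_str v = Some (s, u) else \<exists>q. x = Num q \<and> parse_rat v = Some (q, u))"
        by (auto simp: parse_cst_def split: option.splits)
      then show ?thesis using Cons by (cases x) (auto simp: parsesD[OF s(1)] parsesD[OF r(1)])
    qed
  qed
  moreover have "sized enc_constant"
  proof -
    obtain c d where c: "\<And>x. esize x \<le> c * (length (enc_str x) + 1)" and d: "\<And>x. esize x \<le> d * (length (enc_rat x) + 1)"
      using s(2) r(2) by (auto simp: sized_def)
    have "esize x \<le> (c + d + 4) * (length (enc_constant x) + 1)" for x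
    proof (cases x)
      case (Num q)
      have "esize x = 2 + esize q" by (simp add: esize_def Num)
      also have "\<dots> \<le> 4 * 1 + d * (length (enc_rat q) + 1)" using d[of q] by simp
      also have "\<dots> \<le> 4 * (length (enc_constant x) + 1) + d * (length (enc_constant x) + 1)"
        by (intro add_mono mult_le_mono2) (auto simp: Num)
      finally show ?thesis by (simp add: add_mult_distrib)
    next
      case (Name q)
      have "esize x = 4 + esize q" by (simp add: esize_def Name)
      also have "\<dots> \<le> 4 * 1 + c * (length (enc_str q) + 1)" using c[of q] by simp
      also have "\<dots> \<le> 4 * (length (enc_constant x) + 1) + c * (length (enc_constant x) + 1)"
        by (intro add_mono mult_le_mono2) (auto simp: Name)
      finally show ?thesis by (simp add: add_mult_distrib)
    qed
    then show ?thesis unfolding sized_def by blast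
  qed
  ultimately show ?thesis by (simp add: ptparser_def)
qed

definition parse_fact :: "fact parser" where
  "parse_fact = parse_pair parse_nat (parse_list parse_cst)"

lemma ptparser_fact: "ptparser enc_fact parse_fact"
  unfolding parse_fact_def enc_fact_def[abs_def]
  by (rule ptparser_pair[OF ptparser_nat ptparser_list[OF ptparser_cst]])

lemma ptparser_fact_pair: "ptparser enc_fact_pair (parse_pair parse_fact parse_fact)"
  unfolding enc_fact_pair_def[abs_def] by (rule ptparser_pair[OF ptparser_fact ptparser_fact])

lemma ptparser_enc_pair: "ptparser (\<lambda>x. enc_pair (fst x) (snd x)) (parse_pair parse_str parse_str)"
  unfolding enc_pair_def by (rule ptparser_pair[OF ptparser_str ptparser_str])

section \<open>Evaluation of queries over the infinite domains\<close>

text \<open>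
  A symbolic value is a constant with a list of digits, the newest first. At every quantifier all
  values present get the new digit 1, and the quantified variable ranges over the values with
  digits 0, 1 and 2: the old values, and new values placed immediately below or above one of
  them (for rationals), or merely different from everything (for names). This is what is needed
  to match an arbitrary element of the infinite domain up to the built-in predicates.
\<close>

type_synonym sval = "cst \<times> nat list"

definition digit :: "sval \<Rightarrow> nat" where
  "digit v = (case snd v of [] \<Rightarrow> 0 | d # _ \<Rightarrow> d)"

definition lower :: "sval \<Rightarrow> sval" where
  "lower v = (fst v, tl (snd v))"

definition raise :: "nat \<Rightarrow> sval \<Rightarrow> sval" where
  "raise d v = (fst v, d # snd v)"

lemma raise_simps [simp]:
  "digit (raise d v) = d" "lower (raise d v) = v" "fst (raise d v) = fst v"
  "raise d v = raise d' v' \<longleftrightarrow> d = d' \<and> v = v'"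
  by (auto simp: digit_def lower_def raise_def prod_eq_iff)

text \<open>A lexicographic order: the underlying numbers first, then the digits from the oldest to
  the newest. Since old values carry the digit 1, the digits 0 and 2 fit directly below and above
  them.\<close>

primrec sless :: "nat \<Rightarrow> sval \<Rightarrow> sval \<Rightarrow> bool" where
  "sless 0 v w \<longleftrightarrow> the_num (fst v) < the_num (fst w)"
| "sless (Suc n) v w \<longleftrightarrow> sless n (lower v) (lower w) \<or> (lower v = lower w \<and> digit v < digit w)"

text \<open>A partial isomorphism in the sense of Ehrenfeucht-Fraisse games between actual and
  symbolic values: it respects sorts, equality and, among numbers, the order.\<close>

definition agree :: "nat \<Rightarrow> (cst \<times> sval) set \<Rightarrow> bool" where
  "agree n Z \<longleftrightarrow> (\<forall>(r, v)\<in>Z. is_number r = is_number (fst v) \<and> (\<forall>(r', v')\<in>Z. (r = r' \<longleftrightarrow> v = v') \<and>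
     (is_number r \<and> is_number r' \<longrightarrow> (the_num r < the_num r' \<longleftrightarrow> sless n v v'))))"

definition raise_set :: "(cst \<times> sval) set \<Rightarrow> (cst \<times> sval) set" where
  "raise_set Z = (\<lambda>(r, v). (r, raise 1 v)) ` Z"

lemma agreeD:
  assumes "agree n Z" "(r, v) \<in> Z"
  shows "is_number r = is_number (fst v)"
    "(r', v') \<in> Z \<Longrightarrow> r = r' \<longleftrightarrow> v = v'"
    "(r', v') \<in> Z \<Longrightarrow> is_number r \<Longrightarrow> is_number r' \<Longrightarrow> the_num r < the_num r' \<longleftrightarrow> sless n v v'"
  using assms unfolding agree_def by fast+

lemma is_number_eqI: "is_number r \<Longrightarrow> is_number r' \<Longrightarrow> the_num r = the_num r' \<Longrightarrow> r = r'"
  by (cases r; cases r') auto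

lemma agreeI:
  assumes "\<And>r v. (r, v) \<in> Z \<Longrightarrow> is_number r = is_number (fst v)"
    and "\<And>r v r' v'. (r, v) \<in> Z \<Longrightarrow> (r', v') \<in> Z \<Longrightarrow> (r = r' \<longleftrightarrow> v = v') \<and>
     (is_number r \<and> is_number r' \<longrightarrow> (the_num r < the_num r' \<longleftrightarrow> sless n v v'))"
  shows "agree n Z"
proof -
  have "is_number (fst p) = is_number (fst (snd p)) \<and> (\<forall>p'\<in>Z. (fst p = fst p' \<longleftrightarrow> snd p = snd p') \<and>
     (is_number (fst p) \<and> is_number (fst p') \<longrightarrow> (the_num (fst p) < the_num (fst p') \<longleftrightarrow> sless n (snd p) (snd p'))))"
    if "p \<in> Z" for p
    using assms(1)[of "fst p" "snd p"] assms(2)[of "fst p" "snd p"] that by (metis prod.collapse)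
  then show ?thesis unfolding agree_def split_beta by blast
qed

lemma agree_raise:
  assumes "agree n Z"
  shows "agree (Suc n) (raise_set Z)"
proof (rule agreeI)
  fix r w r' w'
  assume "(r, w) \<in> raise_set Z"
  then obtain v where v: "w = raise 1 v" "(r, v) \<in> Z" by (auto simp: raise_set_def)
  then show "is_number r = is_number (fst w)" using agreeD(1)[OF assms v(2)] by simp
  assume "(r', w') \<in> raise_set Z"
  then obtain v' where v': "w' = raise 1 v'" "(r', v') \<in> Z" by (auto simp: raise_set_def)
  show "(r = r' \<longleftrightarrow> w = w') \<and> (is_number r \<and> is_number r' \<longrightarrow> (the_num r < the_num r' \<longleftrightarrow> sless (Suc n) w w'))"
    using agreeD(2,3)[OF assms v(2) v'(2)] v v' by auto
qed

text \<open>The hypothesis \<open>ord\<close> says that no number of \<open>Z\<close> separates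
  \<open>c\<close> from \<open>r\<close>, and that \<open>c\<close> lies on the side of
  \<open>r\<close> which \<open>d\<close> indicates. For names it is void: a name only has to be
  new.\<close>

lemma agree_raise_insert:
  assumes Z: "agree n Z" "(r, v) \<in> Z" and c: "is_number c = is_number r"
    and new: "d \<noteq> 1" "c \<notin> fst ` Z"
    and ord: "\<And>r' v'. is_number c \<Longrightarrow> (r', v') \<in> Z \<Longrightarrow> is_number r' \<Longrightarrow>
      (the_num c < the_num r' \<longleftrightarrow> the_num r < the_num r' \<or> (d = 0 \<and> r = r')) \<and>
      (the_num r' < the_num c \<longleftrightarrow> the_num r' < the_num r \<or> (d > 1 \<and> r = r'))"
  shows "agree (Suc n) (insert (c, raise d v) (raise_set Z))"
proof -
  have 1: "is_number c = is_number (fst v)" using agreeD(1)[OF Z] c by simp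
  have irr: "\<not> sless n v v" if "is_number c" using agreeD(3)[OF Z Z(2)] that c by simp
  have ne: "c \<noteq> r'" if "(r', v') \<in> Z" for r' v' using new(2) that by force
  have o: "(the_num c < the_num r' \<longleftrightarrow> sless (Suc n) (raise d v) (raise 1 v')) \<and>
      (the_num r' < the_num c \<longleftrightarrow> sless (Suc n) (raise 1 v') (raise d v))"
    if "(r', v') \<in> Z" "is_number c" "is_number r'" for r' v'
  proof -
    have "is_number r" using that c by simp
    with ord[OF that(2,1,3)] agreeD(2)[OF Z that(1)] agreeD(3)[OF Z that(1)] agreeD(3)[OF Z(1) that(1) Z(2)] that(3) new(1)
    show ?thesis by (auto simp: less_Suc_eq)
  qed
  note old = agree_raise[OF Z(1)]
  have new_old: "c \<noteq> a \<and> raise d v \<noteq> w \<and> (is_number c \<and> is_number a \<longrightarrow>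
      (the_num c < the_num a \<longleftrightarrow> sless (Suc n) (raise d v) w) \<and> (the_num a < the_num c \<longleftrightarrow> sless (Suc n) w (raise d v)))"
    if "(a, w) \<in> raise_set Z" for a w
  proof -
    from that obtain u where u: "w = raise 1 u" "(a, u) \<in> Z" by (auto simp: raise_set_def)
    then show ?thesis using ne[OF u(2)] o[OF u(2)] new(1) by (simp del: sless.simps)
  qed
  have self: "\<not> sless (Suc n) (raise d v) (raise d v)" if "is_number c" using irr[OF that] by simp
  show ?thesis
  proof (rule agreeI)
    fix a w a' w'
    assume aw: "(a, w) \<in> insert (c, raise d v) (raise_set Z)"
    then show "is_number a = is_number (fst w)"
      using 1 agreeD(1)[OF old, of a w] by (elim insertE) simp_all
    assume aw': "(a', w') \<in> insert (c, raise d v) (raise_set Z)"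
    from aw aw' consider "(a, w) = (c, raise d v)" "(a', w') = (c, raise d v)"
      | "(a, w) = (c, raise d v)" "(a', w') \<in> raise_set Z"
      | "(a, w) \<in> raise_set Z" "(a', w') = (c, raise d v)"
      | "(a, w) \<in> raise_set Z" "(a', w') \<in> raise_set Z" by blast
    then show "(a = a' \<longleftrightarrow> w = w') \<and>
        (is_number a \<and> is_number a' \<longrightarrow> (the_num a < the_num a' \<longleftrightarrow> sless (Suc n) w w'))"
    proof cases
      case 1
      then show ?thesis using self by (simp del: sless.simps)
    next
      case 2
      then show ?thesis using new_old[OF 2(2)] by (simp del: sless.simps)
    next
      case 3
      then show ?thesis using new_old[OF 3(1)] by (auto simp del: sless.simps)
    next
      case 4
      then show ?thesis using agreeD(2,3)[OF old] by blast
    qed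
  qed
qed

lemma insert_raise_set: "(r, v) \<in> Z \<Longrightarrow> insert (r, raise 1 v) (raise_set Z) = raise_set Z"
  by (force simp: raise_set_def)

section \<open>Density of the rationals and infinitely many names\<close>

lemma rat_just_above:
  assumes "finite (A :: rat set)"
  shows "\<exists>q>r. \<forall>a\<in>A. r < a \<longrightarrow> q < a"
  using assms
proof induction
  case empty
  show ?case by (intro exI[of _ "r + 1"]) simp
next
  case (insert x A)
  then obtain q where q: "q > r" "\<forall>a\<in>A. r < a \<longrightarrow> q < a" by blast
  show ?case
  proof (cases "r < x")
    case True
    with q(1) obtain p where "r < p" "p < min q x" using dense[of r "min q x"] by auto
    with q(2) show ?thesis by (intro exI[of _ p]) auto
  qed (use q in auto)
qed

lemma rat_just_below:
  assumes "finite (A :: rat set)"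
  shows "\<exists>q<r. \<forall>a\<in>A. a < r \<longrightarrow> a < q"
  using rat_just_above[of "uminus ` A" "- r"] assms
  by (metis (no_types, lifting) finite_imageI image_eqI minus_less_iff neg_less_iff_less)

lemma infinite_names: "infinite (range Name)"
proof -
  have "infinite (UNIV :: bool list set)" by (rule infinite_UNIV_listI)
  then show ?thesis by (metis cst.inject(2) finite_imageD inj_on_def)
qed

text \<open>Every symbolic choice is realised: the rationals are dense and unbounded, so there is
  room immediately next to a number, and there are infinitely many names.\<close>

lemma agree_back:
  assumes Z: "agree n Z" "finite Z" "(r, v) \<in> Z" and d: "d \<in> {0, 1, 2}"
  shows "\<exists>c. is_number c = is_number r \<and> agree (Suc n) (insert (c, raise d v) (raise_set Z))"
proof (cases "d = 1")
  case True
  then show ?thesis using agree_raise[OF Z(1)] insert_raise_set[OF Z(3)] by auto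
next
  case d1: False
  show ?thesis
  proof (cases "is_number r")
    case False
    have "finite (fst ` Z)" using Z(2) by simp
    then obtain c where c: "c \<in> range Name" "c \<notin> fst ` Z"
      using infinite_names by (meson finite_subset subsetI)
    then have "\<not> is_number c" by auto
    with c d1 False show ?thesis
      by (intro exI[of _ c] conjI agree_raise_insert[OF Z(1,3)]) auto
  next
    case True
    let ?A = "the_num ` fst ` Z"
    have fin: "finite ?A" using Z(2) by simp
    have A: "the_num r' \<in> ?A" if "(r', v') \<in> Z" for r' v' using that by force
    show ?thesis
    proof (cases "d = 0")
      case d0: True
      obtain q where q: "q < the_num r" "\<forall>a\<in>?A. a < the_num r \<longrightarrow> a < q" using rat_just_below[OF fin] by blast
      then have "Num q \<notin> fst ` Z" by force
      moreover have "(q < the_num r' \<longleftrightarrow> the_num r < the_num r' \<or> r = r') \<and>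
          (the_num r' < q \<longleftrightarrow> the_num r' < the_num r)" if "(r', v') \<in> Z" "is_number r'" for r' v'
      proof -
        have "r = r' \<longleftrightarrow> the_num r = the_num r'" using is_number_eqI[OF True that(2)] by blast
        with q(1) q(2)[rule_format, OF A[OF that(1)]] show ?thesis
          by (cases "the_num r" "the_num r'" rule: linorder_cases) auto
      qed
      ultimately show ?thesis using True d0
        by (intro exI[of _ "Num q"] conjI agree_raise_insert[OF Z(1,3)]) auto
    next
      case False
      with d d1 have d2: "d = 2" by auto
      obtain q where q: "q > the_num r" "\<forall>a\<in>?A. the_num r < a \<longrightarrow> q < a" using rat_just_above[OF fin] by blast
      then have "Num q \<notin> fst ` Z" by force
      moreover have "(q < the_num r' \<longleftrightarrow> the_num r < the_num r') \<and>
          (the_num r' < q \<longleftrightarrow> the_num r' < the_num r \<or> r = r')" if "(r', v') \<in> Z" "is_number r'" for r' v'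
      proof -
        have "r = r' \<longleftrightarrow> the_num r = the_num r'" using is_number_eqI[OF True that(2)] by blast
        with q(1) q(2)[rule_format, OF A[OF that(1)]] show ?thesis
          by (cases "the_num r" "the_num r'" rule: linorder_cases) auto
      qed
      ultimately show ?thesis using True d2
        by (intro exI[of _ "Num q"] conjI agree_raise_insert[OF Z(1,3)]) auto
    qed
  qed
qed

text \<open>A new rational is attached above the greatest smaller number (digit 2) or, if there is
  none, below the least number (digit 0). A new name may be attached to any name. The hypothesis
  \<open>same\<close> supplies something of the right sort to attach to.\<close>

lemma agree_forth:
  assumes Z: "agree n Z" "finite Z" and same: "\<exists>(r, v)\<in>Z. is_number r = is_number c"
  shows "\<exists>(r, v)\<in>Z. \<exists>d\<in>{0, 1, 2}. is_number r = is_number c \<and> agree (Suc n) (insert (c, raise d v) (raise_set Z))"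
proof (cases "c \<in> fst ` Z")
  case True
  then obtain v where "(c, v) \<in> Z" by auto
  then show ?thesis using agree_raise[OF Z(1)] insert_raise_set by (intro bexI[of _ "(c, v)"]) auto
next
  case new: False
  show ?thesis
  proof (cases "is_number c")
    case False
    obtain r v where rv: "(r, v) \<in> Z" "is_number r = is_number c" using same by auto
    then have "agree (Suc n) (insert (c, raise 0 v) (raise_set Z))"
      using new False by (intro agree_raise_insert[OF Z(1)]) auto
    with rv show ?thesis by blast
  next
    case True
    define B where "B = {p \<in> Z. is_number (fst p) \<and> the_num (fst p) < the_num c}"
    have ne: "the_num r' \<noteq> the_num c" if "(r', v') \<in> Z" "is_number r'" for r' v'
      using is_number_eqI[OF that(2) True] that new by force
    show ?thesis
    proof (cases "B = {}")
      case False
      have "finite B" using Z(2) by (simp add: B_def)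
      then obtain p where p: "p \<in> B" "\<And>p'. p' \<in> B \<Longrightarrow> the_num (fst p') \<le> the_num (fst p)"
        using False finite_imageI[of B "\<lambda>p. the_num (fst p)"] Max_in[of "(\<lambda>p. the_num (fst p)) ` B"]
          Max_ge[of "(\<lambda>p. the_num (fst p)) ` B"] by (smt (verit) image_iff image_is_empty)
      obtain r v where rv: "p = (r, v)" by (metis surj_pair)
      have r: "(r, v) \<in> Z" "is_number r" "the_num r < the_num c" using p(1) by (auto simp: B_def rv)
      have max: "the_num r' \<le> the_num r" if "(r', v') \<in> Z" "is_number r'" "the_num r' < the_num c" for r' v'
        using p(2)[of "(r', v')"] that by (simp add: B_def rv)
      have "(the_num c < the_num r' \<longleftrightarrow> the_num r < the_num r') \<and>
          (the_num r' < the_num c \<longleftrightarrow> the_num r' < the_num r \<or> r = r')" if "(r', v') \<in> Z" "is_number r'" for r' v'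
        using r(3) max[OF that] ne[OF that] is_number_eqI[OF r(2) that(2)]
        by (smt (verit) less_trans linorder_neqE not_le)
      then have "agree (Suc n) (insert (c, raise 2 v) (raise_set Z))"
        using new True r by (intro agree_raise_insert[OF Z(1) r(1)]) auto
      with r True show ?thesis by blast
    next
      case True': True
      define G where "G = {p \<in> Z. is_number (fst p)}"
      have "finite G" "G \<noteq> {}" using Z(2) same True by (auto simp: G_def)
      then obtain p where p: "p \<in> G" "\<And>p'. p' \<in> G \<Longrightarrow> the_num (fst p) \<le> the_num (fst p')"
        using finite_imageI[of G "\<lambda>p. the_num (fst p)"] Min_in[of "(\<lambda>p. the_num (fst p)) ` G"]
          Min_le[of "(\<lambda>p. the_num (fst p)) ` G"] by (smt (verit) image_iff image_is_empty)
      obtain r v where rv: "p = (r, v)" by (metis surj_pair)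
      have r: "(r, v) \<in> Z" "is_number r" using p(1) by (auto simp: G_def rv)
      have min: "the_num r \<le> the_num r'" if "(r', v') \<in> Z" "is_number r'" for r' v'
        using p(2)[of "(r', v')"] that by (simp add: G_def rv)
      have above: "the_num c < the_num r'" if "(r', v') \<in> Z" "is_number r'" for r' v'
      proof -
        have "(r', v') \<notin> B" using True' by simp
        then have "\<not> the_num r' < the_num c" using that by (simp add: B_def)
        with ne[OF that] show ?thesis by linarith
      qed
      have "(the_num c < the_num r' \<longleftrightarrow> the_num r < the_num r' \<or> r = r') \<and>
          (the_num r' < the_num c \<longleftrightarrow> the_num r' < the_num r)" if "(r', v') \<in> Z" "is_number r'" for r' v'
        using min[OF that] above[OF that] is_number_eqI[OF r(2) that(2)] by force
      then have "agree (Suc n) (insert (c, raise 0 v) (raise_set Z))"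
        using new True r by (intro agree_raise_insert[OF Z(1) r(1)]) auto
      with r True show ?thesis by blast
    qed
  qed
qed


subsection \<open>The evaluator\<close>

fun trm_csts :: "trm \<Rightarrow> cst set" where
  "trm_csts (Var v) = {}"
| "trm_csts (Const c) = {c}"

fun fmla_csts :: "fmla \<Rightarrow> cst set" where
  "fmla_csts Top = {}"
| "fmla_csts (Rel R ts) = (\<Union>t\<in>set ts. trm_csts t)"
| "fmla_csts (Cmp b t u) = trm_csts t \<union> trm_csts u"
| "fmla_csts (Neg \<phi>) = fmla_csts \<phi>"
| "fmla_csts (Conj \<phi> \<psi>) = fmla_csts \<phi> \<union> fmla_csts \<psi>"
| "fmla_csts (Disj \<phi> \<psi>) = fmla_csts \<phi> \<union> fmla_csts \<psi>"
| "fmla_csts (Exists v \<phi>) = fmla_csts \<phi>"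
| "fmla_csts (Forall v \<phi>) = fmla_csts \<phi>"

lemma finite_fmla_csts: "finite (fmla_csts \<phi>)"
proof -
  have "finite (trm_csts t)" for t by (cases t) auto
  then show ?thesis by (induction \<phi>) auto
qed

text \<open>Within range this is \<open>nth\<close>. The recursion is on the position, which the
  query fixes, so \<open>pt_lookup\<close> can go by induction on it.\<close>

primrec lookup :: "nat \<Rightarrow> sval list \<Rightarrow> sval" where
  "lookup 0 l = (case l of [] \<Rightarrow> (Name [], []) | v # _ \<Rightarrow> v)"
| "lookup (Suc i) l = lookup i (tl l)"

lemma lookup_nth: "i < length l \<Longrightarrow> lookup i l = l ! i"
  by (induction i arbitrary: l) (auto simp: nth_tl split: list.splits)

text \<open>The constants of query and instance are old at every quantifier, hence the digits 1
  throughout.\<close>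

definition base :: "nat \<Rightarrow> cst \<Rightarrow> sval" where
  "base n c = (c, replicate n 1)"

lemma base_Suc: "base (Suc n) c = raise 1 (base n c)"
  by (simp add: base_def raise_def)

definition seval :: "nat \<Rightarrow> sval list \<Rightarrow> (var \<Rightarrow> nat) \<Rightarrow> trm \<Rightarrow> sval" where
  "seval n env pos t = (case t of Var x \<Rightarrow> lookup (pos x) env | Const c \<Rightarrow> base n c)"

definition scmp :: "nat \<Rightarrow> cmp \<Rightarrow> sval \<Rightarrow> sval \<Rightarrow> bool" where
  "scmp n b v w = (case b of Eq \<Rightarrow> v = w | Neq \<Rightarrow> v \<noteq> w
     | Lt \<Rightarrow> is_number (fst v) \<and> is_number (fst w) \<and> sless n v w
     | Le \<Rightarrow> is_number (fst v) \<and> is_number (fst w) \<and> \<not> sless n w v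
     | Gt \<Rightarrow> is_number (fst v) \<and> is_number (fst w) \<and> sless n w v
     | Ge \<Rightarrow> is_number (fst v) \<and> is_number (fst w) \<and> \<not> sless n v w)"

definition cands :: "fact list \<Rightarrow> cst list \<Rightarrow> nat \<Rightarrow> sval list \<Rightarrow> sval list" where
  "cands I K n env = map (base n) (K @ concat (map snd I)) @ env"

text \<open>
  The environment \<open>env\<close> is a stack of symbolic values and \<open>pos\<close> gives the stack positions of the
  variables; \<open>n\<close> is the number of enclosing quantifiers, hence of digits.
\<close>

fun ev :: "fact list \<Rightarrow> cst list \<Rightarrow> nat \<Rightarrow> sval list \<Rightarrow> (var \<Rightarrow> nat) \<Rightarrow> fmla \<Rightarrow> bool" where
  "ev I K n env pos Top \<longleftrightarrow> True"
| "ev I K n env pos (Rel R ts) \<longleftrightarrow> (\<exists>f\<in>set I. fst f = R \<and> map (base n) (snd f) = map (seval n env pos) ts)"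
| "ev I K n env pos (Cmp b t u) \<longleftrightarrow> scmp n b (seval n env pos t) (seval n env pos u)"
| "ev I K n env pos (Neg \<phi>) \<longleftrightarrow> \<not> ev I K n env pos \<phi>"
| "ev I K n env pos (Conj \<phi> \<psi>) \<longleftrightarrow> ev I K n env pos \<phi> \<and> ev I K n env pos \<psi>"
| "ev I K n env pos (Disj \<phi> \<psi>) \<longleftrightarrow> ev I K n env pos \<phi> \<or> ev I K n env pos \<psi>"
| "ev I K n env pos (Exists x \<phi>) \<longleftrightarrow> (\<exists>v\<in>set (cands I K n env). is_number (fst v) = (fst x = SQ) \<and>
     (\<exists>d\<in>set [0, 1, 2]. ev I K (Suc n) (raise d v # map (raise 1) env) ((\<lambda>u. Suc (pos u))(x := 0)) \<phi>))"
| "ev I K n env pos (Forall x \<phi>) \<longleftrightarrow> (\<forall>v\<in>set (cands I K n env). is_number (fst v) = (fst x = SQ) \<longrightarrow>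
     (\<forall>d\<in>set [0, 1, 2]. ev I K (Suc n) (raise d v # map (raise 1) env) ((\<lambda>u. Suc (pos u))(x := 0)) \<phi>))"

text \<open>The constants of \<open>K\<close> and \<open>I\<close> take part in the correspondence,
  so a symbolic value that equals the base of a constant stands for this very constant. In this way
  the correspondence also respects relational atoms.\<close>

definition pair_set :: "fact list \<Rightarrow> cst list \<Rightarrow> nat \<Rightarrow> cst list \<Rightarrow> sval list \<Rightarrow> (cst \<times> sval) set" where
  "pair_set I K n renv env = (\<lambda>c. (c, base n c)) ` set (K @ concat (map snd I)) \<union> set (zip renv env)"

lemma pair_set_Suc:
  assumes "length renv = length env"
  shows "pair_set I K (Suc n) (c # renv) (w # map (raise 1) env) = insert (c, w) (raise_set (pair_set I K n renv env))"
  using assms by (auto simp: pair_set_def raise_set_def base_Suc zip_map2 image_Un image_image)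

lemma snd_pair_set: "length renv = length env \<Longrightarrow> snd ` pair_set I K n renv env = set (cands I K n env)"
  by (auto simp: pair_set_def cands_def image_Un image_image set_zip_leftD in_set_zip image_iff in_set_conv_nth
      Bex_def)

definition env_ok :: "fact list \<Rightarrow> cst list \<Rightarrow> nat \<Rightarrow> cst list \<Rightarrow> sval list \<Rightarrow> (var \<Rightarrow> nat) \<Rightarrow> valuation \<Rightarrow> var set \<Rightarrow> bool" where
  "env_ok I K n renv env pos \<rho> V \<longleftrightarrow> agree n (pair_set I K n renv env) \<and> length renv = length env \<and>
     (\<forall>x\<in>V. pos x < length env \<and> \<rho> x = renv ! pos x)"

lemma env_ok_mono: "env_ok I K n renv env pos \<rho> V \<Longrightarrow> W \<subseteq> V \<Longrightarrow> env_ok I K n renv env pos \<rho> W"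
  by (auto simp: env_ok_def)

lemma seval_rel:
  assumes "env_ok I K n renv env pos \<rho> V" "fv_trm t \<subseteq> V" "trm_csts t \<subseteq> set K"
  shows "(eval_trm \<rho> t, seval n env pos t) \<in> pair_set I K n renv env"
proof (cases t)
  case (Var x)
  then have "pos x < length env" "\<rho> x = renv ! pos x" "length renv = length env"
    using assms by (auto simp: env_ok_def)
  then show ?thesis
    by (auto simp: Var seval_def lookup_nth pair_set_def in_set_zip)
qed (use assms in \<open>auto simp: seval_def pair_set_def\<close>)

lemma env_ok_push:
  assumes "env_ok I K n renv env pos \<rho> (V - {x})"
    and "agree (Suc n) (insert (c, raise d v) (raise_set (pair_set I K n renv env)))"
  shows "env_ok I K (Suc n) (c # renv) (raise d v # map (raise 1) env) ((\<lambda>u. Suc (pos u))(x := 0)) (\<rho>(x := c)) V"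
  using assms unfolding env_ok_def by (auto simp: pair_set_Suc simp del: One_nat_def)

lemma cmp_agree:
  assumes "agree n Z" "(r, v) \<in> Z" "(r', v') \<in> Z"
  shows "eval_cmp b r r' \<longleftrightarrow> scmp n b v v'"
proof -
  note D = agreeD(1)[OF assms(1,2)] agreeD(1)[OF assms(1,3)] agreeD(2,3)[OF assms]
    agreeD(3)[OF assms(1,3,2)]
  show ?thesis
    by (cases b; cases r; cases r') (use D in \<open>auto simp: scmp_def\<close>)
qed

lemma ev_correct:
  assumes "env_ok I K n renv env pos \<rho> (fv \<phi>)" "fmla_csts \<phi> \<subseteq> set K"
    and K: "Num 0 \<in> set K" "Name [] \<in> set K"
  shows "ev I K n env pos \<phi> \<longleftrightarrow> sat (set I) \<rho> \<phi>"
proof -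
  \<comment> \<open>One quantifier by back and forth. Arbitrary \<open>P\<close> and
    \<open>Q\<close> make it usable for \<open>Exists\<close> and, with negations, for
    \<open>Forall\<close>.\<close>
  have quant: "(\<exists>v\<in>set (cands I K n env). is_number (fst v) = (fst x = SQ) \<and> (\<exists>d\<in>set [0, 1, 2]. P d v)) \<longleftrightarrow>
      (\<exists>c. sort_of c = fst x \<and> Q c)"
    if ok: "env_ok I K n renv env pos \<rho> V"
      and PQ: "\<And>c d v. agree (Suc n) (insert (c, raise d v) (raise_set (pair_set I K n renv env))) \<Longrightarrow> P d v = Q c"
    for n renv env pos \<rho> V and x :: var and P Q
  proof -
    let ?Z = "pair_set I K n renv env"
    have Z: "agree n ?Z" "finite ?Z" and len: "length renv = length env"
      using ok by (auto simp: env_ok_def pair_set_def)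
    have sort: "sort_of c = fst x \<longleftrightarrow> is_number c = (fst x = SQ)" for c
      by (cases c; cases "fst x") auto
    show ?thesis
    proof
      assume "\<exists>v\<in>set (cands I K n env). is_number (fst v) = (fst x = SQ) \<and> (\<exists>d\<in>set [0, 1, 2]. P d v)"
      then obtain v d where v: "v \<in> snd ` ?Z" "is_number (fst v) = (fst x = SQ)" "d \<in> {0, 1, 2}" "P d v"
        unfolding snd_pair_set[OF len] by auto
      then obtain r where r: "(r, v) \<in> ?Z" by auto
      then obtain c where "is_number c = is_number r" "agree (Suc n) (insert (c, raise d v) (raise_set ?Z))"
        using agree_back[OF Z r v(3)] by auto
      moreover have "is_number r = is_number (fst v)" using agreeD(1)[OF Z(1) r] .
      ultimately show "\<exists>c. sort_of c = fst x \<and> Q c" using PQ v sort by blast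
    next
      assume "\<exists>c. sort_of c = fst x \<and> Q c"
      then obtain c where c: "sort_of c = fst x" "Q c" by blast
      \<comment> \<open>These two constants provide a value of either sort even when query and
        instance mention none.\<close>
      have "(Num 0, base n (Num 0)) \<in> ?Z" "(Name [], base n (Name [])) \<in> ?Z" using K by (auto simp: pair_set_def)
      then have "\<exists>(r, v)\<in>?Z. is_number r = is_number c"
        by (intro bexI[of _ "if is_number c then (Num 0, base n (Num 0)) else (Name [], base n (Name []))"]) auto
      from agree_forth[OF Z this] obtain r v d where rv: "(r, v) \<in> ?Z" "d \<in> {0, 1, 2}" "is_number r = is_number c"
        "agree (Suc n) (insert (c, raise d v) (raise_set ?Z))" by auto
      have "P d v" using PQ[OF rv(4)] c(2) by simp
      moreover have "v \<in> set (cands I K n env)" using rv(1) unfolding snd_pair_set[OF len, symmetric] by force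
      moreover have "is_number (fst v) = (fst x = SQ)"
        using agreeD(1)[OF Z(1) rv(1)] rv(3) c(1) sort by simp
      ultimately show "\<exists>v\<in>set (cands I K n env). is_number (fst v) = (fst x = SQ) \<and> (\<exists>d\<in>set [0, 1, 2]. P d v)"
        using rv(2) by auto
    qed
  qed
  from assms(1,2) show ?thesis
  proof (induction \<phi> arbitrary: n renv env pos \<rho>)
    case (Rel R ts)
    let ?Z = "pair_set I K n renv env"
    have Z: "agree n ?Z" using Rel.prems by (simp add: env_ok_def)
    have t: "(eval_trm \<rho> t, seval n env pos t) \<in> ?Z" if "t \<in> set ts" for t
      by (rule seval_rel[OF Rel.prems(1)]) (use Rel.prems that in auto)
    have key: "map (base n) cs = map (seval n env pos) ts \<longleftrightarrow> cs = map (eval_trm \<rho>) ts"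
      if "(R, cs) \<in> set I" for cs
    proof -
      have b: "(c, base n c) \<in> ?Z" if "c \<in> set cs" for c
        using \<open>(R, cs) \<in> set I\<close> that by (force simp: pair_set_def)
      have "base n c = seval n env pos t \<longleftrightarrow> c = eval_trm \<rho> t" if "c \<in> set cs" "t \<in> set ts" for c t
        using agreeD(2)[OF Z b[OF that(1)] t[OF that(2)]] by simp
      moreover have "map (base n) cs = map (seval n env pos) ts \<longleftrightarrow>
          length cs = length ts \<and> (\<forall>i<length cs. base n (cs ! i) = seval n env pos (ts ! i))"
        by (auto simp: list_eq_iff_nth_eq)
      moreover have "cs = map (eval_trm \<rho>) ts \<longleftrightarrow>
          length cs = length ts \<and> (\<forall>i<length cs. cs ! i = eval_trm \<rho> (ts ! i))"
        by (auto simp: list_eq_iff_nth_eq)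
      ultimately show ?thesis by (metis nth_mem)
    qed
    show ?case
    proof
      assume "ev I K n env pos (Rel R ts)"
      then obtain cs where "(R, cs) \<in> set I" "map (base n) cs = map (seval n env pos) ts" by force
      with key show "sat (set I) \<rho> (Rel R ts)" by simp
    next
      assume "sat (set I) \<rho> (Rel R ts)"
      then have "(R, map (eval_trm \<rho>) ts) \<in> set I" by simp
      moreover from key[OF this] have "map (base n) (map (eval_trm \<rho>) ts) = map (seval n env pos) ts" by blast
      ultimately show "ev I K n env pos (Rel R ts)" by (auto intro!: bexI[of _ "(R, map (eval_trm \<rho>) ts)"])
    qed
  next
    case (Cmp b t u)
    have Z: "agree n (pair_set I K n renv env)" using Cmp.prems by (simp add: env_ok_def)
    have "(eval_trm \<rho> t, seval n env pos t) \<in> pair_set I K n renv env"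
      "(eval_trm \<rho> u, seval n env pos u) \<in> pair_set I K n renv env"
      by (rule seval_rel[OF Cmp.prems(1)]; use Cmp.prems in auto)+
    from cmp_agree[OF Z this] show ?case by simp
  next
    case (Neg \<phi>)
    then show ?case by simp
  next
    case (Conj \<phi> \<psi>)
    then have "env_ok I K n renv env pos \<rho> (fv \<phi>)" "env_ok I K n renv env pos \<rho> (fv \<psi>)"
      by (auto elim: env_ok_mono)
    with Conj show ?case by simp
  next
    case (Disj \<phi> \<psi>)
    then have "env_ok I K n renv env pos \<rho> (fv \<phi>)" "env_ok I K n renv env pos \<rho> (fv \<psi>)"
      by (auto elim: env_ok_mono)
    with Disj show ?case by simp
  next
    case (Exists x \<phi>)
    from Exists.prems(1) have ok: "env_ok I K n renv env pos \<rho> (fv \<phi> - {x})" by simp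
    have K': "fmla_csts \<phi> \<subseteq> set K" using Exists.prems by simp
    have "(\<exists>v\<in>set (cands I K n env). is_number (fst v) = (fst x = SQ) \<and> (\<exists>d\<in>set [0, 1, 2].
        ev I K (Suc n) (raise d v # map (raise 1) env) ((\<lambda>u. Suc (pos u))(x := 0)) \<phi>)) \<longleftrightarrow>
      (\<exists>c. sort_of c = fst x \<and> sat (set I) (\<rho>(x := c)) \<phi>)"
      by (rule quant[OF ok]) (rule Exists.IH[OF env_ok_push[OF ok] K'])
    then show ?case by auto
  next
    case (Forall x \<phi>)
    from Forall.prems(1) have ok: "env_ok I K n renv env pos \<rho> (fv \<phi> - {x})" by simp
    have K': "fmla_csts \<phi> \<subseteq> set K" using Forall.prems by simp
    have "(\<exists>v\<in>set (cands I K n env). is_number (fst v) = (fst x = SQ) \<and> (\<exists>d\<in>set [0, 1, 2].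
        \<not> ev I K (Suc n) (raise d v # map (raise 1) env) ((\<lambda>u. Suc (pos u))(x := 0)) \<phi>)) \<longleftrightarrow>
      (\<exists>c. sort_of c = fst x \<and> \<not> sat (set I) (\<rho>(x := c)) \<phi>)"
      by (rule quant[OF ok]) (simp only: Forall.IH[OF env_ok_push[OF ok] K'])
    then show ?case by auto
  qed simp
qed


subsection \<open>Data complexity of query evaluation\<close>

lemma pt_nat_less [pt]: "polytime f \<Longrightarrow> polytime g \<Longrightarrow> polytime (\<lambda>x. (f x :: nat) < g x)"
proof -
  assume "polytime f" "polytime g"
  then have "polytime (\<lambda>x. less_bits (bits (f x)) (bits (g x)))" by (intro pt)
  then show ?thesis by (simp add: less_bits val_bits)
qed

lemma pt_digit [pt]: "polytime f \<Longrightarrow> polytime (\<lambda>x. digit (f x))"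
  unfolding digit_def by (intro pt)

lemma pt_lower [pt]: "polytime f \<Longrightarrow> polytime (\<lambda>x. lower (f x))"
  unfolding lower_def by (intro pt)

lemma pt_raise [pt]: "polytime d \<Longrightarrow> polytime f \<Longrightarrow> polytime (\<lambda>x. raise (d x) (f x))"
  unfolding raise_def by (intro pt)

lemma pt_base [pt]: "polytime f \<Longrightarrow> polytime (\<lambda>x. base n (f x))"
  unfolding base_def by (intro pt)

lemma pt_sless [pt]: "polytime f \<Longrightarrow> polytime g \<Longrightarrow> polytime (\<lambda>x. sless n (f x) (g x))"
proof (induction n arbitrary: f g)
  case 0
  then show ?case unfolding sless.simps by (intro pt)
next
  case (Suc n)
  from Suc.prems have "polytime (\<lambda>x. sless n (lower (f x)) (lower (g x)))"
    by (intro Suc.IH pt)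
  with Suc.prems show ?case unfolding sless.simps by (intro pt)
qed

lemma pt_lookup [pt]: "polytime f \<Longrightarrow> polytime (\<lambda>x. lookup i (f x))"
proof (induction i arbitrary: f)
  case 0
  then show ?case unfolding lookup.simps by (intro pt)
next
  case (Suc i)
  from Suc.prems show ?case unfolding lookup.simps by (intro Suc.IH pt)
qed

lemma pt_seval: "polytime f \<Longrightarrow> polytime (\<lambda>x. seval n (f x) pos t)"
  unfolding seval_def by (cases t) (auto intro: pt)

lemma pt_scmp:
  assumes "polytime f" "polytime g"
  shows "polytime (\<lambda>x. scmp n b (f x) (g x))"
  unfolding scmp_def by (cases b; simp only: cmp.case) (intro pt assms)+

lemma pt_cands:
  assumes "polytime f" "polytime g"
  shows "polytime (\<lambda>x. cands (f x) K n (g x))"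
  using assms unfolding cands_def by (intro pt)

lemma pt_map_const: "(\<And>t. polytime (\<lambda>x. g x t)) \<Longrightarrow> polytime (\<lambda>x. map (g x) ts)"
  by (induction ts) (auto intro!: pt)

text \<open>The induction is on the formula, which is no part of the input. A quantifier adds one
  search over candidates, and their number depends only on \<open>I\<close>, the fixed list
  \<open>K\<close> and the current environment.\<close>

lemma pt_ev: "polytime (\<lambda>x :: fact list \<times> sval list. ev (fst x) K n (snd x) pos \<phi>)"
proof (induction \<phi> arbitrary: n pos)
  case Top
  show ?case unfolding ev.simps by (intro pt)
next
  case (Rel R ts)
  have m: "polytime (\<lambda>x :: (fact list \<times> sval list) \<times> fact. map (seval n (snd (fst x)) pos) ts)"
    by (intro pt_map_const pt_seval pt)
  show ?case unfolding ev.simps by (intro pt m)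
next
  case (Cmp b t u)
  show ?case unfolding ev.simps by (intro pt_scmp pt_seval pt)
next
  case (Neg \<phi>)
  from Neg[of n pos] show ?case unfolding ev.simps by (intro pt)
next
  case (Conj \<phi> \<psi>)
  from Conj[of n pos] show ?case unfolding ev.simps by (intro pt)
next
  case (Disj \<phi> \<psi>)
  from Disj[of n pos] show ?case unfolding ev.simps by (intro pt)
next
  case (Exists x \<phi>)
  note IH = pt_comp[OF Exists, of "\<lambda>p :: ((fact list \<times> sval list) \<times> sval) \<times> nat.
    (fst (fst (fst p)), raise (snd p) (snd (fst p)) # map (raise 1) (snd (fst (fst p))))", unfolded fst_conv snd_conv]
  show ?case unfolding ev.simps by (intro pt IH pt_cands)
next
  case (Forall x \<phi>)
  note IH = pt_comp[OF Forall, of "\<lambda>p :: ((fact list \<times> sval list) \<times> sval) \<times> nat.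
    (fst (fst (fst p)), raise (snd p) (snd (fst p)) # map (raise 1) (snd (fst (fst p))))", unfolded fst_conv snd_conv]
  show ?case unfolding ev.simps by (intro pt IH pt_cands)
qed

lemma exists_wf_val: "\<exists>\<rho>. wf_val \<rho>"
  by (rule exI[of _ "\<lambda>v. if fst v = SQ then Num 0 else Name []"])
    (auto simp: wf_val_def, metis sort.exhaust)

theorem pt_query:
  assumes "fv Q = {}" "polytime f"
  shows "polytime (\<lambda>x. set (f x) \<Turnstile> Q)"
proof -
  obtain K where K: "set K = fmla_csts Q \<union> {Num 0, Name []}"
    using finite_list[of "fmla_csts Q \<union> {Num 0, Name []}"] finite_fmla_csts by auto
  have "agree 0 (pair_set I K 0 [] [])" for I
    unfolding agree_def pair_set_def by (auto simp: base_def)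
  then have "ev I K 0 [] (\<lambda>_. 0) Q \<longleftrightarrow> sat (set I) \<rho> Q" for I \<rho>
    using K assms(1) by (intro ev_correct[where renv = "[]"]) (auto simp: env_ok_def)
  then have "set I \<Turnstile> Q \<longleftrightarrow> ev I K 0 [] (\<lambda>_. 0) Q" for I
    using exists_wf_val by (auto simp: models_def)
  moreover have "polytime (\<lambda>x. ev (f x) K 0 [] (\<lambda>_. 0) Q)"
    using pt_comp[OF pt_ev[of K 0 "\<lambda>_. 0" Q] pt_pair[OF assms(2) pt_const[of "[]"]]] by simp
  ultimately show ?thesis by simp
qed

section \<open>Checking instances, repairs and improvements\<close>

lemma models_foldr_Forall: "I \<Turnstile> foldr Forall xs \<psi> \<longleftrightarrow> I \<Turnstile> \<psi>"
proof (induction xs)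
  case (Cons x xs)
  \<comment> \<open>\<open>models\<close> ranges over all well-sorted valuations, so an outer
    universal quantifier changes nothing.\<close>
  have "I \<Turnstile> Forall x \<phi> \<longleftrightarrow> I \<Turnstile> \<phi>" for \<phi>
  proof
    assume *: "I \<Turnstile> Forall x \<phi>"
    show "I \<Turnstile> \<phi>" unfolding models_def
    proof (intro allI impI)
      fix \<rho> assume "wf_val \<rho>"
      with * have "sat I (\<rho>(x := \<rho> x)) \<phi>" unfolding models_def wf_val_def sat.simps by blast
      then show "sat I \<rho> \<phi>" by simp
    qed
  next
    assume *: "I \<Turnstile> \<phi>"
    have "wf_val (\<rho>(x := c))" if "wf_val \<rho>" "sort_of c = fst x" for \<rho> c
      using that by (auto simp: wf_val_def)
    with * show "I \<Turnstile> Forall x \<phi>" by (simp add: models_def)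
  qed
  with Cons show ?case by simp
qed simp

lemma fv_foldr_Forall: "fv (foldr Forall xs \<psi>) = fv \<psi> - set xs"
  by (induction xs) auto

definition conj_atoms :: "(nat \<times> var list) list \<Rightarrow> fmla" where
  "conj_atoms as = foldr Conj (map (\<lambda>a. Rel (fst a) (map Var (snd a))) as) Top"

lemma sat_conj_atoms: "sat I \<rho> (conj_atoms as) \<longleftrightarrow> (\<forall>a\<in>set as. inst_atom \<rho> a \<in> I)"
  unfolding conj_atoms_def by (induction as) (auto simp: inst_atom_def comp_def)

lemma fv_conj_atoms: "fv (conj_atoms as) = (\<Union>a\<in>set as. set (snd a))"
  unfolding conj_atoms_def by (induction as) auto

definition closure :: "(nat \<times> var list) list \<Rightarrow> fmla \<Rightarrow> fmla" where
  "closure as \<psi> = foldr Forall (concat (map snd as)) (Neg (Conj (conj_atoms as) \<psi>))"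

lemma models_closure:
  "I \<Turnstile> closure as \<psi> \<longleftrightarrow> (\<forall>\<rho>. wf_val \<rho> \<longrightarrow> \<not> ((\<forall>a\<in>set as. inst_atom \<rho> a \<in> I) \<and> sat I \<rho> \<psi>))"
  unfolding closure_def models_foldr_Forall by (simp add: models_def sat_conj_atoms)

lemma fv_closure: "fv \<psi> \<subseteq> (\<Union>a\<in>set as. set (snd a)) \<Longrightarrow> fv (closure as \<psi>) = {}"
  unfolding closure_def fv_foldr_Forall by (auto simp: fv_conj_atoms)

lemma pt_finite_ex:
  assumes "finite A" "\<And>a. a \<in> A \<Longrightarrow> polytime (\<lambda>x. P a x)"
  shows "polytime (\<lambda>x. \<exists>a\<in>A. P a x)"
  using assms by (induction A) (auto intro!: pt)

lemma pt_finite_all: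
  assumes "finite A" "\<And>a. a \<in> A \<Longrightarrow> polytime (\<lambda>x. P a x)"
  shows "polytime (\<lambda>x. \<forall>a\<in>A. P a x)"
  using assms by (induction A) (auto intro!: pt)

lemma sat_builtin: "builtin_qf \<phi> \<Longrightarrow> sat I \<rho> \<phi> \<longleftrightarrow> sat J \<rho> \<phi>"
  by (induction \<phi>) auto

text \<open>The word is a mask. Missing bits count as \<open>False\<close> and surplus bits are
  ignored, so every word is a certificate for some subset.\<close>

fun select :: "'a list \<Rightarrow> bool list \<Rightarrow> 'a list" where
  "select [] bs = []"
| "select (a # as) bs = (if lsb bs then a # select as (tl bs) else select as (tl bs))"

lemma set_select: "set (select as bs) \<subseteq> set as"
  by (induction as arbitrary: bs) auto

lemma set_select_map: "set (select as (map P as)) = {a \<in> set as. P a}"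
  by (induction as) (auto simp: lsb_def)

lemma pt_select [pt]:
  assumes "polytime f" "polytime g"
  shows "polytime (\<lambda>x. select (f x) (g x))"
proof -
  let ?h = "\<lambda>a s. (tl (fst s), if lsb (fst s) then a # snd s else snd s)"
  have fold: "snd (fold ?h as (bs, u)) = rev (select as bs) @ u \<and> fst (fold ?h as (bs, u)) = drop (length as) bs"
    for as :: "'b list" and bs u
    by (induction as arbitrary: bs u) (auto simp: drop_Suc)
  have size: "esize (select as bs) \<le> esize as" for as :: "'b list" and bs
    by (induction as arbitrary: bs) (auto intro: le_SucI trans_le_add2)
  have "polytime (\<lambda>x. fold ?h (f x) (g x, []))"
  proof (rule pt_fold[OF _ assms(1)])
    show "polybd (\<lambda>n. n)" by (intro pb)
    fix x as cs assume l: "f x = as @ cs"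
    obtain bs u where s: "fold ?h as (g x, []) = (bs, u)" by fastforce
    have "esize bs \<le> esize (g x)" "esize u \<le> esize as"
      using fold[of as "g x" "[]"] esize_take_drop(2)[of "length as" "g x"] size[of as "g x"] by (auto simp: s)
    moreover have "esize as \<le> esize (f x)" using esize_append[of as cs] esize_pos[of cs] l by simp
    ultimately show "esize (fold ?h as (g x, [])) \<le> esize x + esize (f x) + esize (g x, [] :: 'b list)"
      by (simp add: s)
  qed (auto intro!: pt monoI assms)
  then have "polytime (\<lambda>x. rev (snd (fold ?h (f x) (g x, []))))" by (intro pt)
  then show ?thesis by (rule pt_cong[rotated]) (simp add: fold)
qed

text \<open>Acyclicity is tested by repeatedly removing the edges whose target has no outgoing edge.\<close>

definition prune :: "('a \<times> 'a) list \<Rightarrow> ('a \<times> 'a) list" where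
  "prune E = filter (\<lambda>e. \<exists>e'\<in>set E. fst e' = snd e) E"

text \<open>Choose a target \<open>z\<close> that is minimal for the converse relation. An edge
  leaving \<open>z\<close> would lead to a smaller target, so there is none, and the edges into
  \<open>z\<close> are pruned.\<close>

lemma prune_shorter:
  assumes "acyclic (set E)" "E \<noteq> []"
  shows "length (prune E) < length E"
proof -
  have "wf ((set E)\<inverse>)" using assms(1) by (simp add: finite_acyclic_wf_converse)
  moreover obtain e where "e \<in> set E" using assms(2) by (cases E) auto
  then have "snd e \<in> snd ` set E" by simp
  ultimately obtain z where z: "z \<in> snd ` set E" "\<And>y. (y, z) \<in> (set E)\<inverse> \<Longrightarrow> y \<notin> snd ` set E"
    by (rule wfE_min) blast
  from z(1) obtain e' where e': "e' \<in> set E" "snd e' = z" by auto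
  have "fst e'' \<noteq> snd e'" if "e'' \<in> set E" for e''
    using z(2)[of "snd e''"] that e'(2) by (cases e'') force
  with e'(1) have "e' \<in> set E" "\<not> (\<exists>e''\<in>set E. fst e'' = snd e')" by blast+
  then show ?thesis unfolding prune_def by (rule length_filter_less)
qed

lemma acyclic_prune_iff: "acyclic (set E) \<longleftrightarrow> fold (\<lambda>_. prune) E E = []"
proof
  assume ac: "acyclic (set E)"
  have "acyclic (set u) \<Longrightarrow> length (fold (\<lambda>_. prune) f u) \<le> length u - length f" for f u :: "('a \<times> 'a) list"
  proof (induction f arbitrary: u)
    case (Cons a f)
    have "set (prune u) \<subseteq> set u" by (auto simp: prune_def)
    then have "acyclic (set (prune u))" using Cons.prems acyclic_subset by blast
    from Cons.IH[OF this] have "length (fold (\<lambda>_. prune) (a # f) u) \<le> length (prune u) - length f" by simp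
    also have "\<dots> \<le> length u - length (a # f)"
      using prune_shorter[OF Cons.prems] by (cases "u = []") (auto simp: prune_def)
    finally show ?case .
  qed simp
  from this[OF ac, of E] show "fold (\<lambda>_. prune) E E = []" by simp
next
  assume empty: "fold (\<lambda>_. prune) E E = []"
  \<comment> \<open>The edges that lie on a cycle. Each of them is followed by another one, so
    pruning never removes any.\<close>
  define C where "C = {e \<in> set E. (snd e, fst e) \<in> (set E)\<^sup>*}"
  have succ: "\<exists>e'\<in>C. fst e' = snd e" if "e \<in> C" for e
  proof -
    have e: "(fst e, snd e) \<in> set E" "(snd e, fst e) \<in> (set E)\<^sup>*" using that by (auto simp: C_def)
    from e(2) show ?thesis
    proof (cases rule: converse_rtranclE)
      case base
      then show ?thesis using that by auto
    next
      case (step y)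
      then have "(y, snd e) \<in> (set E)\<^sup>*" using e(1) by (meson rtrancl.rtrancl_into_rtrancl)
      with step(1) show ?thesis by (intro bexI[of _ "(snd e, y)"]) (auto simp: C_def)
    qed
  qed
  have "C \<subseteq> set u \<Longrightarrow> C \<subseteq> set (fold (\<lambda>_. prune) f u)" for f u :: "('a \<times> 'a) list"
  proof (induction f arbitrary: u)
    case (Cons a f)
    have "C \<subseteq> set (prune u)" using Cons.prems succ unfolding prune_def by fastforce
    from Cons.IH[OF this] show ?case by simp
  qed simp
  from this[of E E] empty have "C = {}" by (auto simp: C_def)
  show "acyclic (set E)"
  proof (rule ccontr)
    assume "\<not> acyclic (set E)"
    then obtain x where "(x, x) \<in> (set E)\<^sup>+" by (auto simp: acyclic_def)
    then obtain y where "(x, y) \<in> set E" "(y, x) \<in> (set E)\<^sup>*" by (meson tranclD)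
    then have "(x, y) \<in> C" by (simp add: C_def)
    with \<open>C = {}\<close> show False by simp
  qed
qed

lemma pt_acyclic [pt]:
  assumes "polytime l"
  shows "polytime (\<lambda>x. acyclic (set (l x)))"
proof -
  have "polytime (\<lambda>x. fold (\<lambda>_. prune) (l x) (l x))"
  proof (rule pt_fold[OF _ assms assms])
    show "polytime (\<lambda>p :: 'a \<times> ('b \<times> 'b) \<times> ('b \<times> 'b) list. prune (snd (snd p)))"
      unfolding prune_def by (intro pt)
    show "polybd (\<lambda>n. n)" by (intro pb)
    have "esize (fold (\<lambda>_. prune) f u) \<le> esize u" for f u :: "('b \<times> 'b) list"
    proof (induction f arbitrary: u)
      case (Cons a f)
      from Cons[of "prune u"] have "esize (fold (\<lambda>_. prune) (a # f) u) \<le> esize (prune u)" by simp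
      also have "\<dots> \<le> esize u" unfolding prune_def by (rule esize_filter)
      finally show ?case .
    qed simp
    then show "esize (fold (\<lambda>_. prune) as (l x)) \<le> esize x + esize (l x) + esize (l x)"
      for x and as :: "('b \<times> 'b) list"
      by (rule trans_le_add2)
  qed (auto intro: monoI)
  then show ?thesis unfolding acyclic_prune_iff by (intro pt)
qed

section \<open>Tests for a fixed schema and fixed constraints\<close>

locale database =
  fixes S :: schema and F :: "denial set"
  assumes wf_S: "wf_schema S" and fin_F: "finite F" and wf_F: "\<forall>d\<in>F. wf_denial S d"
begin

lemma denialD:
  assumes "(as, \<phi>) \<in> F"
  shows "builtin_qf \<phi>" "fv \<phi> \<subseteq> (\<Union>a\<in>set as. set (snd a))" "a \<in> set as \<Longrightarrow> fst a \<in> dom S"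
proof -
  have *: "wf_denial S (as, \<phi>)" using wf_F assms by blast
  show "builtin_qf \<phi>" "fv \<phi> \<subseteq> (\<Union>a\<in>set as. set (snd a))"
    using * by (simp_all add: wf_denial_def split_beta)
  show "fst a \<in> dom S" if "a \<in> set as"
    using * that by (auto simp: wf_denial_def split_beta)
qed

lemma pt_consistent:
  assumes "polytime f"
  shows "polytime (\<lambda>x. consistent F (set (f x)))"
proof -
  have "consistent F I \<longleftrightarrow> (\<forall>d\<in>F. I \<Turnstile> closure (fst d) (snd d))" for I
    by (simp add: consistent_def satisfies_denial_def models_closure split_beta)
  moreover have "polytime (\<lambda>x. \<forall>d\<in>F. set (f x) \<Turnstile> closure (fst d) (snd d))"
    by (intro pt_finite_all fin_F pt_query fv_closure assms) (use denialD(2) in auto)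
  ultimately show ?thesis by simp
qed

text \<open>
  The two facts are handed to the query evaluator in relations whose names, from \<open>fresh\<close> on, do
  not belong to the schema.
\<close>

definition fresh :: nat where
  "fresh = Suc (Max (insert 0 (dom S)))"

lemma fresh: "R \<in> dom S \<Longrightarrow> R < fresh"
  using wf_S unfolding fresh_def wf_schema_def by (simp add: less_Suc_eq_le)

text \<open>The query has to be fixed, while the two facts belong to the input. Their argument
  tuples arrive as the only facts of the two fresh relations, and the formula equates them with the
  instances of the atoms \<open>a\<close> and \<open>b\<close>.\<close>

definition neighbor_query :: "(nat \<times> var list) list \<Rightarrow> fmla \<Rightarrow> nat \<times> var list \<Rightarrow> nat \<times> var list \<Rightarrow> fmla" where
  "neighbor_query as \<phi> a b = closure as (Conj \<phi>
     (Conj (Rel fresh (map Var (snd a))) (Rel (Suc fresh) (map Var (snd b)))))"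

definition atom_pairs :: "(denial \<times> (nat \<times> var list) \<times> (nat \<times> var list)) set" where
  "atom_pairs = (SIGMA d : F. set (fst d) \<times> set (fst d))"

text \<open>A conflict with both facts matches them with two atoms of one constraint, and
  \<open>F\<close> leaves finitely many choices. Relation names are compared outside the query,
  which only sees argument tuples. The query is a negated conjunction, so it fails exactly when a
  common conflict exists.\<close>

lemma neighbors_iff:
  assumes "is_instance S I" "x \<in> I" "y \<in> I"
  shows "neighbors F I x y \<longleftrightarrow> (\<exists>t\<in>atom_pairs. fst (fst (snd t)) = fst x \<and> fst (snd (snd t)) = fst y \<and>
    \<not> insert (fresh, snd x) (insert (Suc fresh, snd y) I) \<Turnstile>
      neighbor_query (fst (fst t)) (snd (fst t)) (fst (snd t)) (snd (snd t)))"
proof -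
  let ?J = "insert (fresh, snd x) (insert (Suc fresh, snd y) I)"
  have I: "R < fresh" if "(R, cs) \<in> I" for R cs
    using assms(1) that fresh[of R] by (auto simp: is_instance_def is_fact_def dom_def)
  have query: "\<not> ?J \<Turnstile> neighbor_query as \<phi> a b \<longleftrightarrow> (\<exists>\<rho>. wf_val \<rho> \<and> (\<forall>c\<in>set as. inst_atom \<rho> c \<in> I) \<and>
      sat I \<rho> \<phi> \<and> map \<rho> (snd a) = snd x \<and> map \<rho> (snd b) = snd y)" if d: "(as, \<phi>) \<in> F" for as \<phi> a b
  proof -
    have "inst_atom \<rho> c \<in> ?J \<longleftrightarrow> inst_atom \<rho> c \<in> I" if "c \<in> set as" for c \<rho>
      using fresh[OF denialD(3)[OF d that]] by (auto simp: inst_atom_def)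
    then have 1: "(\<forall>c\<in>set as. inst_atom \<rho> c \<in> ?J) \<longleftrightarrow> (\<forall>c\<in>set as. inst_atom \<rho> c \<in> I)" for \<rho>
      by blast
    have 2: "sat ?J \<rho> \<phi> \<longleftrightarrow> sat I \<rho> \<phi>" for \<rho> by (rule sat_builtin[OF denialD(1)[OF d]])
    have "(fresh, cs) \<notin> I" "(Suc fresh, cs) \<notin> I" for cs using I by force+
    then have 3: "sat ?J \<rho> (Rel fresh (map Var vs)) \<longleftrightarrow> map \<rho> vs = snd x"
      "sat ?J \<rho> (Rel (Suc fresh) (map Var vs)) \<longleftrightarrow> map \<rho> vs = snd y" for \<rho> vs
      by (auto simp: comp_def)
    show ?thesis
      unfolding neighbor_query_def models_closure sat.simps(5) 1 2 3 by blast
  qed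
  show ?thesis
  proof
    assume "neighbors F I x y"
    then obtain as \<phi> \<rho> where d: "(as, \<phi>) \<in> F" and \<rho>: "wf_val \<rho>" "sat I \<rho> \<phi>"
        "inst_atom \<rho> ` set as \<subseteq> I" "x \<in> inst_atom \<rho> ` set as" "y \<in> inst_atom \<rho> ` set as"
      unfolding neighbors_def conflict_def by auto
    then obtain a b where ab: "a \<in> set as" "b \<in> set as" "x = inst_atom \<rho> a" "y = inst_atom \<rho> b" by auto
    have "\<not> ?J \<Turnstile> neighbor_query as \<phi> a b"
      unfolding query[OF d] using \<rho> ab(3,4) by (intro exI[of _ \<rho>]) (auto simp: inst_atom_def)
    moreover have "((as, \<phi>), a, b) \<in> atom_pairs" using d ab by (auto simp: atom_pairs_def)
    ultimately show "\<exists>t\<in>atom_pairs. fst (fst (snd t)) = fst x \<and> fst (snd (snd t)) = fst y \<and>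
        \<not> ?J \<Turnstile> neighbor_query (fst (fst t)) (snd (fst t)) (fst (snd t)) (snd (snd t))"
      using ab(3,4) by (intro bexI[of _ "((as, \<phi>), a, b)"]) (auto simp: inst_atom_def)
  next
    assume "\<exists>t\<in>atom_pairs. fst (fst (snd t)) = fst x \<and> fst (snd (snd t)) = fst y \<and>
        \<not> ?J \<Turnstile> neighbor_query (fst (fst t)) (snd (fst t)) (fst (snd t)) (snd (snd t))"
    then obtain as \<phi> a b where "((as, \<phi>), a, b) \<in> atom_pairs" and ab: "fst a = fst x" "fst b = fst y"
        "\<not> ?J \<Turnstile> neighbor_query as \<phi> a b" by auto
    then have d: "(as, \<phi>) \<in> F" "a \<in> set as" "b \<in> set as" by (auto simp: atom_pairs_def)
    from ab(3) obtain \<rho> where \<rho>: "wf_val \<rho>" "\<forall>c\<in>set as. inst_atom \<rho> c \<in> I" "sat I \<rho> \<phi>"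
        "map \<rho> (snd a) = snd x" "map \<rho> (snd b) = snd y"
      unfolding query[OF d(1)] by blast
    have "conflict F I (inst_atom \<rho> ` set as)"
      unfolding conflict_def using \<rho> d(1) by (intro conjI bexI[of _ "(as, \<phi>)"]) auto
    moreover have "x = inst_atom \<rho> a" "y = inst_atom \<rho> b"
      using \<rho> ab by (simp_all add: inst_atom_def prod_eq_iff)
    ultimately show "neighbors F I x y" unfolding neighbors_def using d(2,3) by blast
  qed
qed

definition neighbor_test :: "fact list \<Rightarrow> fact \<times> fact \<Rightarrow> bool" where
  "neighbor_test I e \<longleftrightarrow> (\<exists>t\<in>atom_pairs. fst (fst (snd t)) = fst (fst e) \<and> fst (snd (snd t)) = fst (snd e) \<and>
    \<not> set ((fresh, snd (fst e)) # (Suc fresh, snd (snd e)) # I) \<Turnstile>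
      neighbor_query (fst (fst t)) (snd (fst t)) (fst (snd t)) (snd (snd t)))"

lemma pt_neighbor_test:
  assumes "polytime f" "polytime g"
  shows "polytime (\<lambda>x. neighbor_test (f x) (g x))"
  unfolding neighbor_test_def
proof (rule pt_finite_ex)
  show "finite atom_pairs" using fin_F by (auto simp: atom_pairs_def)
  fix t assume t: "t \<in> atom_pairs"
  obtain d a b where t1: "t = (d, a, b)" by (rule prod_cases3)
  obtain as \<phi> where "d = (as, \<phi>)" by (rule prod.exhaust)
  with t1 have t': "t = ((as, \<phi>), a, b)" by simp
  have d: "(as, \<phi>) \<in> F" "a \<in> set as" "b \<in> set as" using t by (auto simp: atom_pairs_def t')
  have "fv (neighbor_query as \<phi> a b) = {}"
    unfolding neighbor_query_def using denialD(2)[OF d(1)] d(2,3) by (intro fv_closure) auto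
  then show "polytime (\<lambda>x. fst (fst (snd t)) = fst (fst (g x)) \<and> fst (snd (snd t)) = fst (snd (g x)) \<and>
      \<not> set ((fresh, snd (fst (g x))) # (Suc fresh, snd (snd (g x))) # f x) \<Turnstile>
        neighbor_query (fst (fst t)) (snd (fst t)) (fst (snd t)) (snd (snd t)))"
    unfolding t' fst_conv snd_conv by (intro pt pt_query assms)
qed

lemma pt_is_fact:
  assumes "polytime f"
  shows "polytime (\<lambda>x. is_fact S (f x))"
proof -
  \<comment> \<open>Lists of sorts are compared as lists of booleans; injectivity makes this
    faithful.\<close>
  have inj: "inj (\<lambda>s. s = SQ)"
  proof
    fix s t :: sort assume "(s = SQ) = (t = SQ)"
    then show "s = t" by (cases s; cases t) auto
  qed
  have "is_fact S g \<longleftrightarrow> (\<exists>R\<in>dom S. R = fst g \<and> map is_number (snd g) = map (\<lambda>s. s = SQ) (the (S R)))" for g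
  proof -
    have *: "map is_number (snd g) = map (\<lambda>s. s = SQ) (map sort_of (snd g))" by (simp add: is_number_def)
    have m: "map is_number (snd g) = map (\<lambda>s. s = SQ) u \<longleftrightarrow> map sort_of (snd g) = u" for u
      unfolding * by (rule inj_map_eq_map[OF inj])
    show ?thesis unfolding m is_fact_def by (cases "S (fst g)") (simp_all add: domIff, blast)
  qed
  moreover have "polytime (\<lambda>x. \<exists>R\<in>dom S. R = fst (f x) \<and> map is_number (snd (f x)) = map (\<lambda>s. s = SQ) (the (S R)))"
    using wf_S by (intro pt_finite_ex pt assms) (simp add: wf_schema_def)
  ultimately show ?thesis by simp
qed

section \<open>Validity of the input\<close>

definition valid :: "fact list \<times> (fact \<times> fact) list \<Rightarrow> bool" where
  "valid p \<longleftrightarrow> distinct (fst p) \<and> distinct (snd p) \<and> (\<forall>f\<in>set (fst p). is_fact S f) \<and>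
     (\<forall>e\<in>set (snd p). fst e \<in> set (fst p) \<and> snd e \<in> set (fst p) \<and> neighbor_test (fst p) e) \<and>
     acyclic (set (snd p))"

text \<open>The neighbor test is shown correct for instances of the schema, where no fact carries a
  fresh name. The equivalence holds for all lists because the facts are checked in the same
  conjunction.\<close>

lemma valid_iff: "valid (I, pr) \<longleftrightarrow> distinct I \<and> distinct pr \<and> is_instance S (set I) \<and> is_priority F (set I) (set pr)"
proof -
  have "neighbor_test I e \<longleftrightarrow> neighbors F (set I) (fst e) (snd e)"
    if "is_instance S (set I)" "fst e \<in> set I" "snd e \<in> set I" for e
    using neighbors_iff[OF that] by (simp add: neighbor_test_def)
  then have "(\<forall>e\<in>set pr. fst e \<in> set I \<and> snd e \<in> set I \<and> neighbor_test I e) \<longleftrightarrow>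
      (\<forall>e\<in>set pr. fst e \<in> set I \<and> snd e \<in> set I) \<and> (\<forall>e\<in>set pr. neighbors F (set I) (fst e) (snd e))"
    if "is_instance S (set I)" using that by blast
  moreover have "set pr \<subseteq> set I \<times> set I \<longleftrightarrow> (\<forall>e\<in>set pr. fst e \<in> set I \<and> snd e \<in> set I)"
    by (auto simp: mem_Times_iff)
  moreover have "is_instance S (set I) \<longleftrightarrow> (\<forall>f\<in>set I. is_fact S f)" by (simp add: is_instance_def)
  ultimately show ?thesis unfolding valid_def is_priority_def split_beta fst_conv snd_conv by argo
qed

lemma pt_valid:
  assumes "polytime f"
  shows "polytime (\<lambda>x. valid (f x))"
  unfolding valid_def by (intro pt pt_is_fact pt_neighbor_test assms pt_comp[OF assms])

text \<open>A denial constraint only forbids the joint presence of facts, and its built-in part does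
  not look at the instance.\<close>

lemma consistent_subset: "consistent F J \<Longrightarrow> I \<subseteq> J \<Longrightarrow> consistent F I"
  unfolding consistent_def satisfies_denial_def
  using sat_builtin denialD(1) by (fastforce split: prod.splits)

definition repair_test :: "fact list \<Rightarrow> fact list \<Rightarrow> bool" where
  "repair_test I J \<longleftrightarrow> (\<forall>f\<in>set J. f \<in> set I) \<and> consistent F (set J) \<and>
     (\<forall>f\<in>set I. f \<notin> set J \<longrightarrow> \<not> consistent F (set (f # J)))"

text \<open>Inconsistency passes to supersets. A consistent proper extension would thus contain a
  consistent extension by a single fact, so linearly many tests replace the search over all
  \<open>K\<close>.\<close>

lemma repair_test_iff: "repair_test I J \<longleftrightarrow> is_repair F (set I) (set J)"
proof -
  have "(\<forall>f\<in>set I. f \<notin> set J \<longrightarrow> \<not> consistent F (insert f (set J))) \<longleftrightarrow>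
      (\<forall>K. set J \<subset> K \<and> K \<subseteq> set I \<longrightarrow> \<not> consistent F K)" if "set J \<subseteq> set I"
  proof (intro iffI allI impI ballI notI)
    fix K assume *: "\<forall>f\<in>set I. f \<notin> set J \<longrightarrow> \<not> consistent F (insert f (set J))"
      "set J \<subset> K \<and> K \<subseteq> set I" "consistent F K"
    then obtain f where "f \<in> K" "f \<notin> set J" by blast
    moreover have "insert f (set J) \<subseteq> K" using * calculation by auto
    ultimately show False using * consistent_subset by (meson subsetD)
  next
    fix f assume "\<forall>K. set J \<subset> K \<and> K \<subseteq> set I \<longrightarrow> \<not> consistent F K" "f \<in> set I" "f \<notin> set J"
      "consistent F (insert f (set J))"
    with that show False by (metis insertI1 insert_subset psubsetI subset_insertI)
  qed
  then show ?thesis unfolding repair_test_def is_repair_def by (auto simp: subset_iff)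
qed

lemma pt_repair_test:
  assumes "polytime f" "polytime g"
  shows "polytime (\<lambda>x. repair_test (f x) (g x))"
  unfolding repair_test_def by (intro pt pt_consistent assms pt_comp[OF assms(1)] pt_comp[OF assms(2)])

text \<open>A set \<open>Z\<close> of facts codes the exchange of \<open>X = Z \<inter> J\<close> for \<open>Y = Z - J\<close>.\<close>

definition improves :: "fact list \<Rightarrow> (fact \<times> fact) list \<Rightarrow> fact list \<Rightarrow> bool" where
  "improves J pr Z \<longleftrightarrow> (\<exists>x\<in>set Z. x \<in> set J) \<and> (\<exists>y\<in>set Z. y \<notin> set J) \<and>
     (\<forall>x\<in>set Z. x \<in> set J \<longrightarrow> (\<exists>y\<in>set Z. y \<notin> set J \<and> (y, x) \<in> set pr)) \<and>
     consistent F (set (filter (\<lambda>f. f \<notin> set Z) J @ filter (\<lambda>f. f \<notin> set J) Z))"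

lemma globally_optimal_iff:
  assumes "set J \<subseteq> set I"
  shows "globally_optimal F (set I) (set pr) (set J) \<longleftrightarrow> (\<forall>Z. set Z \<subseteq> set I \<longrightarrow> \<not> improves J pr Z)"
proof
  assume *: "globally_optimal F (set I) (set pr) (set J)"
  show "\<forall>Z. set Z \<subseteq> set I \<longrightarrow> \<not> improves J pr Z"
  proof (intro allI impI notI)
    fix Z assume Z: "set Z \<subseteq> set I" "improves J pr Z"
    note imp = Z(2)[unfolded improves_def]
    note i = imp[THEN conjunct1] imp[THEN conjunct2, THEN conjunct1]
      imp[THEN conjunct2, THEN conjunct2, THEN conjunct1] imp[THEN conjunct2, THEN conjunct2, THEN conjunct2]
    have "set (filter (\<lambda>f. f \<notin> set Z) J @ filter (\<lambda>f. f \<notin> set J) Z) = (set J - (set Z \<inter> set J)) \<union> (set Z - set J)"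
      by auto
    then have c: "consistent F ((set J - (set Z \<inter> set J)) \<union> (set Z - set J))" using i(4) by (rule subst)
    have "\<exists>X Y. X \<noteq> {} \<and> Y \<noteq> {} \<and> X \<subseteq> set J \<and> Y \<subseteq> set I - set J \<and>
      (\<forall>x\<in>X. \<exists>y\<in>Y. (y, x) \<in> set pr) \<and> consistent F (set J - X \<union> Y)"
    proof (intro exI conjI)
      show "set Z \<inter> set J \<noteq> {}" using i(1) by blast
      show "set Z - set J \<noteq> {}" using i(2) by blast
      show "\<forall>x\<in>set Z \<inter> set J. \<exists>y\<in>set Z - set J. (y, x) \<in> set pr" using i(3) by blast
      show "consistent F ((set J - (set Z \<inter> set J)) \<union> (set Z - set J))" by (rule c)
    qed (use Z(1) in blast)+
    then show False using * unfolding globally_optimal_def by (elim conjE notE)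
  qed
next
  assume *: "\<forall>Z. set Z \<subseteq> set I \<longrightarrow> \<not> improves J pr Z"
  show "globally_optimal F (set I) (set pr) (set J)"
    unfolding globally_optimal_def
  proof (intro conjI assms notI)
    assume "\<exists>X Y. X \<noteq> {} \<and> Y \<noteq> {} \<and> X \<subseteq> set J \<and> Y \<subseteq> set I - set J \<and>
      (\<forall>x\<in>X. \<exists>y\<in>Y. (y, x) \<in> set pr) \<and> consistent F (set J - X \<union> Y)"
    then obtain X Y where XY: "X \<noteq> {}" "Y \<noteq> {}" "X \<subseteq> set J" "Y \<subseteq> set I - set J"
      "\<forall>x\<in>X. \<exists>y\<in>Y. (y, x) \<in> set pr" "consistent F (set J - X \<union> Y)" by (elim exE conjE) (rule that)
    have "X \<union> Y \<subseteq> set I" using XY(3,4) assms by blast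
    then have "finite (X \<union> Y)" by (rule finite_subset) simp
    from finite_list[OF this] obtain Z where Z: "set Z = X \<union> Y" by (rule exE)
    have eX: "X = set Z \<inter> set J" and eY: "Y = set Z - set J"
      unfolding Z using XY(3,4) by blast+
    have "set J - X \<union> Y = set (filter (\<lambda>f. f \<notin> set Z) J @ filter (\<lambda>f. f \<notin> set J) Z)"
      unfolding eX eY by auto
    then have "consistent F (set (filter (\<lambda>f. f \<notin> set Z) J @ filter (\<lambda>f. f \<notin> set J) Z))"
      using XY(6) by (rule subst)
    moreover have "\<exists>x\<in>set Z. x \<in> set J" using XY(1) unfolding eX by blast
    moreover have "\<exists>y\<in>set Z. y \<notin> set J" using XY(2) unfolding eY by blast
    moreover have "\<forall>x\<in>set Z. x \<in> set J \<longrightarrow> (\<exists>y\<in>set Z. y \<notin> set J \<and> (y, x) \<in> set pr)"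
      using XY(5) unfolding eX eY by blast
    ultimately have "improves J pr Z" unfolding improves_def by (intro conjI)
    moreover have "set Z \<subseteq> set I" unfolding Z using XY(3,4) assms by blast
    ultimately show False using * by blast
  qed
qed

lemma pt_improves:
  assumes "polytime f" "polytime g" "polytime h"
  shows "polytime (\<lambda>x. improves (f x) (g x) (h x))"
proof -
  note c = pt_comp[OF assms(1)] pt_comp[OF assms(2)] pt_comp[OF assms(3)]
  show ?thesis unfolding improves_def by (intro pt pt_consistent assms c)
qed

end

section \<open>The decision problems\<close>

definition decode :: "'a parser \<Rightarrow> ('a \<Rightarrow> bool) \<Rightarrow> bool list \<Rightarrow> 'a option" where
  "decode p ok w = (case p w of None \<Rightarrow> None
     | Some u \<Rightarrow> if snd u = [] \<and> ok (fst u) then Some (fst u) else None)"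

lemma decode_iff:
  assumes "parses e p"
  shows "decode p ok w = Some t \<longleftrightarrow> w = e t \<and> ok t"
proof
  assume "decode p ok w = Some t"
  then have "p w = Some (t, [])" "ok t"
    by (auto simp: decode_def split: option.splits if_splits)
  then show "w = e t \<and> ok t" using parsesD[OF assms, of w t "[]"] by simp
next
  assume *: "w = e t \<and> ok t"
  then have "p w = Some (t, [])" using parsesD[OF assms, of w t "[]"] by simp
  with * show "decode p ok w = Some t" by (simp add: decode_def)
qed

lemma pt_decode:
  assumes "polytime p" "polytime ok" "polytime f"
  shows "polytime (\<lambda>x. decode p ok (f x))"
  unfolding decode_def by (intro pt pt_comp[OF assms(1)] pt_comp[OF assms(2)] assms(3))

text \<open>The classes speak of words \<open>enc_pair x y\<close>, so a verifier for pairs has to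
  decode first; \<open>b\<close> settles the words that are no pairs.\<close>

lemma P_class_pair:
  fixes g :: "bool list \<Rightarrow> bool list \<Rightarrow> bool"
  assumes "polytime (\<lambda>p. g (fst p) (snd p))" "polytime b"
  shows "\<exists>V\<in>P_class. (\<forall>x y. enc_pair x y \<in> V \<longleftrightarrow> g x y) \<and>
    (\<forall>w. (\<nexists>x y. w = enc_pair x y) \<longrightarrow> (w \<in> V \<longleftrightarrow> b w))"
proof -
  let ?d = "decode (parse_pair parse_str parse_str) (\<lambda>_. True)"
  define f where "f w = (case ?d w of None \<Rightarrow> b w | Some u \<Rightarrow> g (fst u) (snd u))" for w
  have p: "parses (\<lambda>x. enc_pair (fst x) (snd x)) (parse_pair parse_str parse_str)"
    "polytime (parse_pair parse_str parse_str)"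
    using ptparser_enc_pair by (auto simp: ptparser_def)
  have d: "?d w = Some u \<longleftrightarrow> w = enc_pair (fst u) (snd u)" for w u
    using decode_iff[OF p(1)] by simp
  have "polytime (\<lambda>p :: bool list \<times> bool list \<times> bool list. g (fst (snd p)) (snd (snd p)))"
    using pt_comp[OF assms(1), of snd] by (simp add: pt)
  then have "polytime (\<lambda>w. f w)"
    unfolding f_def by (intro pt pt_decode p assms(2))
  then have "{w. f w} \<in> P_class" by (rule P_class_polytime)
  moreover have "f (enc_pair x y) \<longleftrightarrow> g x y" for x y
    using d[of "enc_pair x y" "(x, y)"] by (simp add: f_def)
  moreover have "f w \<longleftrightarrow> b w" if "\<nexists>x y. w = enc_pair x y" for w
  proof -
    have "?d w = None" using d[of w] that by (cases "?d w") auto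
    then show ?thesis by (simp add: f_def)
  qed
  ultimately show ?thesis by (intro bexI[of _ "{w. f w}"] conjI allI impI) simp_all
qed

lemma coNP_I:
  fixes g :: "bool list \<Rightarrow> bool list \<Rightarrow> bool"
  assumes "polytime (\<lambda>p. g (fst p) (snd p))"
    and "\<And>x. x \<notin> L \<longleftrightarrow> (\<exists>y. length y \<le> length x \<and> g x y)"
  shows "L \<in> coNP_class"
proof -
  obtain V where V: "V \<in> P_class" "\<And>x y. enc_pair x y \<in> V \<longleftrightarrow> g x y"
    using P_class_pair[OF assms(1) pt_const[of False]] by blast
  \<comment> \<open>The polynomial \<open>[:0, 1:]\<close> is the identity: certificates need not be
    longer than the input.\<close>
  have "- L = {x. \<exists>y. length y \<le> poly [:0, 1:] (length x) \<and> enc_pair x y \<in> V}"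
    using assms(2) V(2) by auto
  with V(1) show ?thesis unfolding coNP_class_def co_class_def NP_class_def poly_ex_def by blast
qed

text \<open>The inner quantifier defines the coNP set \<open>W\<close> of pairs. Its input is the
  whole pair, which explains the length bound for \<open>z\<close>. A word that is no pair lies
  outside \<open>W\<close>, so the verifier accepts every certificate against it.\<close>

lemma Pi2_I:
  fixes h :: "bool list \<Rightarrow> bool list \<Rightarrow> bool list \<Rightarrow> bool"
  assumes "polytime (\<lambda>p. h (fst p) (fst (snd p)) (snd (snd p)))"
    and "\<And>x. x \<notin> L \<longleftrightarrow> (\<exists>y. length y \<le> length x \<and> (\<forall>z. length z \<le> length (enc_pair x y) \<longrightarrow> \<not> h x y z))"
  shows "L \<in> Pi2_class"
proof -
  define W where "W = {w. \<exists>x y. w = enc_pair x y \<and> (\<forall>z. length z \<le> length w \<longrightarrow> \<not> h x y z)}"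
  let ?d = "decode (parse_pair parse_str parse_str) (\<lambda>_. True)"
  have p: "parses (\<lambda>x. enc_pair (fst x) (snd x)) (parse_pair parse_str parse_str)"
    "polytime (parse_pair parse_str parse_str)"
    using ptparser_enc_pair by (auto simp: ptparser_def)
  have d: "?d w = Some u \<longleftrightarrow> w = enc_pair (fst u) (snd u)" for w u
    using decode_iff[OF p(1)] by simp
  have inj: "enc_pair x y = enc_pair x' y' \<longleftrightarrow> x = x' \<and> y = y'" for x y x' y'
    using d[of "enc_pair x y" "(x, y)"] d[of "enc_pair x y" "(x', y')"] by auto
  define g where "g w z = (case ?d w of None \<Rightarrow> True | Some u \<Rightarrow> h (fst u) (snd u) z)" for w z
  have "polytime (\<lambda>p :: (bool list \<times> bool list) \<times> bool list \<times> bool list.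
      h (fst (snd p)) (snd (snd p)) (snd (fst p)))"
    using pt_comp[OF assms(1), of "\<lambda>p :: (bool list \<times> bool list) \<times> bool list \<times> bool list.
      (fst (snd p), snd (snd p), snd (fst p))"] by (simp add: pt)
  then have "polytime (\<lambda>p. g (fst p) (snd p))"
    unfolding g_def by (intro pt pt_decode p)
  moreover have "w \<notin> W \<longleftrightarrow> (\<exists>z. length z \<le> length w \<and> g w z)" for w
  proof (cases "?d w")
    case None
    then have "w \<notin> W" using d[of w "(x, y)" for x y] by (auto simp: W_def)
    moreover have "g w []" using None by (simp add: g_def)
    ultimately show ?thesis by (metis le0 list.size(3))
  next
    case (Some u)
    then have "w = enc_pair (fst u) (snd u)" using d by simp
    then show ?thesis using Some inj by (auto simp: W_def g_def)
  qed
  ultimately have "W \<in> coNP_class" by (rule coNP_I)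
  moreover have "- L = {x. \<exists>y. length y \<le> poly [:0, 1:] (length x) \<and> enc_pair x y \<in> W}"
    using assms(2) inj by (auto simp: W_def)
  ultimately show ?thesis unfolding Pi2_class_def co_class_def Sigma2_class_def poly_ex_def by blast
qed

text \<open>A mask with one bit per fact is therefore no longer than the input.\<close>

lemma length_enc_list: "length xs < length (Defs.enc_list e xs)"
  by (induction xs) (auto simp: enc_list_simps)

lemma length_enc_pair: "length x \<le> length (enc_pair x y)"
proof -
  have "length (enc_str x) = 2 * length x + 1" for x
    unfolding enc_str_def by (induction x) (auto simp: enc_list_simps)
  then show ?thesis by (simp add: enc_pair_def)
qed

lemma ex_select:
  assumes "length as \<le> n"
  shows "(\<exists>y. length y \<le> n \<and> P (set (select as y))) \<longleftrightarrow> (\<exists>A. A \<subseteq> set as \<and> P A)"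
proof
  assume "\<exists>A. A \<subseteq> set as \<and> P A"
  then obtain A where A: "A \<subseteq> set as" "P A" by blast
  have "set (select as (map (\<lambda>a. a \<in> A) as)) = A" using A(1) by (auto simp: set_select_map)
  with A(2) assms show "\<exists>y. length y \<le> n \<and> P (set (select as y))"
    by (intro exI[of _ "map (\<lambda>a. a \<in> A) as"]) simp
next
  assume "\<exists>y. length y \<le> n \<and> P (set (select as y))"
  then obtain y where "P (set (select as y))" by (elim exE conjE) (rule that)
  with set_select show "\<exists>A. A \<subseteq> set as \<and> P A" by (intro exI conjI)
qed

section \<open>The two languages\<close>

definition parse_input :: "(fact list \<times> (fact \<times> fact) list) parser" where
  "parse_input = parse_pair (parse_list parse_fact) (parse_list (parse_pair parse_fact parse_fact))"

lemma ptparser_input: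
  "ptparser (\<lambda>t. enc_list enc_fact (fst t) @ enc_list enc_fact_pair (snd t)) parse_input"
  unfolding parse_input_def
  by (intro ptparser_pair ptparser_list ptparser_fact ptparser_fact_pair)

context database
begin

lemma GRep_iff:
  "set J \<in> GRep F (set I) (set pr) \<longleftrightarrow> repair_test I J \<and> \<not> (\<exists>Z. set Z \<subseteq> set I \<and> improves J pr Z)"
proof (cases "is_repair F (set I) (set J)")
  case True
  then have "set J \<subseteq> set I" by (simp add: is_repair_def)
  from globally_optimal_iff[OF this] True show ?thesis by (simp add: GRep_def repair_test_iff)
qed (simp add: GRep_def repair_test_iff)

lemma ex_improves_select:
  assumes "length I \<le> n"
  shows "(\<exists>z. length z \<le> n \<and> improves J pr (select I z)) \<longleftrightarrow> (\<exists>Z. set Z \<subseteq> set I \<and> improves J pr Z)"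
proof -
  \<comment> \<open>\<open>improves\<close> depends only on the set of entries of \<open>Z\<close>;
    \<open>P\<close> expresses this, so that the statement on subsets in \<open>ex_select\<close>
    applies.\<close>
  define P where "P A \<longleftrightarrow> (\<exists>Z. set Z = A \<and> improves J pr Z)" for A
  have cong: "improves J pr Z \<longleftrightarrow> improves J pr Z'" if "set Z = set Z'" for Z Z'
    using that by (simp add: improves_def)
  have "improves J pr Z \<longleftrightarrow> P (set Z)" for Z
  proof
    assume "improves J pr Z"
    then show "P (set Z)" unfolding P_def by (intro exI[of _ Z]) simp
  next
    assume "P (set Z)"
    then obtain Z' where "set Z' = set Z" "improves J pr Z'" unfolding P_def by (elim exE conjE) (rule that)
    then show "improves J pr Z" using cong by metis
  qed
  then have "(\<exists>z. length z \<le> n \<and> improves J pr (select I z)) \<longleftrightarrow> (\<exists>A. A \<subseteq> set I \<and> P A)"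
    using ex_select[OF assms, of P] by simp
  then show ?thesis by (auto simp: P_def)
qed

lemma repair_checking_coNP: "repair_checking_lang S F \<in> coNP_class"
proof -
  let ?p = "parse_pair parse_input (parse_list parse_fact)"
  let ?e = "\<lambda>t. (enc_list enc_fact (fst (fst t)) @ enc_list enc_fact_pair (snd (fst t))) @ enc_list enc_fact (snd t)"
  have "ptparser ?e ?p"
    by (rule ptparser_pair[OF ptparser_input ptparser_list[OF ptparser_fact]])
  then have p: "parses ?e ?p" "polytime ?p" by (auto simp: ptparser_def)
  define ok where "ok t \<longleftrightarrow> valid (fst t) \<and> distinct (snd t)" for t :: "(fact list \<times> (fact \<times> fact) list) \<times> fact list"
  have ok: "polytime ok" unfolding ok_def[abs_def] by (intro pt pt_valid)
  \<comment> \<open>A certificate speaks against membership. Malformed words, and sets that are no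
    repairs, are refuted by every word, in particular by the empty one.\<close>
  define g where "g x y = (case decode ?p ok x of None \<Rightarrow> True
    | Some t \<Rightarrow> \<not> repair_test (fst (fst t)) (snd t) \<or>
        improves (snd t) (snd (fst t)) (select (fst (fst t)) y))" for x y
  show ?thesis
  proof (rule coNP_I)
    show "polytime (\<lambda>p. g (fst p) (snd p))"
      unfolding g_def by (intro pt pt_decode p ok pt_repair_test pt_improves)
    fix x
    have L: "x \<in> repair_checking_lang S F \<longleftrightarrow>
        (\<exists>I pr J. decode ?p ok x = Some ((I, pr), J) \<and> set J \<in> GRep F (set I) (set pr))"
    proof
      assume "x \<in> repair_checking_lang S F"
      then obtain I pr J where "(set I, set pr, set J) \<in> repair_checking S F" "distinct I" "distinct pr" "distinct J"
        "x = enc_list enc_fact I @ enc_list enc_fact_pair pr @ enc_list enc_fact J"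
        unfolding repair_checking_lang_def set_codes_def by blast
      then show "\<exists>I pr J. decode ?p ok x = Some ((I, pr), J) \<and> set J \<in> GRep F (set I) (set pr)"
        unfolding decode_iff[OF p(1)] ok_def fst_conv snd_conv valid_iff repair_checking_def
        by (intro exI[of _ I] exI[of _ pr] exI[of _ J]) simp
    next
      assume "\<exists>I pr J. decode ?p ok x = Some ((I, pr), J) \<and> set J \<in> GRep F (set I) (set pr)"
      then obtain I pr J where J: "decode ?p ok x = Some ((I, pr), J)" "set J \<in> GRep F (set I) (set pr)"
        by (elim exE conjE) (rule that)
      then have v: "valid (I, pr)" "distinct J"
        and x: "x = enc_list enc_fact I @ enc_list enc_fact_pair pr @ enc_list enc_fact J"
        unfolding decode_iff[OF p(1)] ok_def by simp_all
      have "enc_list enc_fact I \<in> set_codes enc_fact (set I)" "enc_list enc_fact J \<in> set_codes enc_fact (set J)"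
        "enc_list enc_fact_pair pr \<in> set_codes enc_fact_pair (set pr)"
        using v by (auto simp: set_codes_def valid_iff)
      from repair_checking_lang_iff[OF this(1,3,2)] v(1) J(2) show "x \<in> repair_checking_lang S F"
        unfolding x by (simp add: repair_checking_def valid_iff)
    qed
    show "x \<notin> repair_checking_lang S F \<longleftrightarrow> (\<exists>y. length y \<le> length x \<and> g x y)"
    proof (cases "decode ?p ok x")
      case None
      then have "g x []" by (simp add: g_def)
      with None L show ?thesis by (metis le0 list.size(3) option.distinct(1))
    next
      case (Some t)
      obtain u J where "t = (u, J)" by (rule prod.exhaust)
      moreover obtain I pr where "u = (I, pr)" by (rule prod.exhaust)
      ultimately have t: "t = ((I, pr), J)" by simp
      have "x = ?e t" using Some decode_iff[OF p(1)] by blast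
      then have len: "length I \<le> length x" using length_enc_list[of I enc_fact] by (simp add: t)
      have "x \<in> repair_checking_lang S F \<longleftrightarrow> set J \<in> GRep F (set I) (set pr)"
        using L Some t by auto
      also have "\<dots> \<longleftrightarrow> repair_test I J \<and> \<not> (\<exists>z. length z \<le> length x \<and> improves J pr (select I z))"
        unfolding GRep_iff ex_improves_select[OF len] by (rule refl)
      finally show ?thesis
        using Some t unfolding g_def by (auto intro: exI[of _ "[]"])
    qed
  qed
qed

lemma consistent_answering_Pi2:
  assumes "closed_query S Q"
  shows "consistent_answering_lang S F Q \<in> Pi2_class"
proof -
  let ?e = "\<lambda>t. enc_list enc_fact (fst t) @ enc_list enc_fact_pair (snd t)"
  have p: "parses ?e parse_input" "polytime parse_input"
    using ptparser_input by (auto simp: ptparser_def)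
  have Q: "fv Q = {}" using assms by (simp add: closed_query_def)
  have ok: "polytime valid" using pt_valid[OF pt_id] .
  \<comment> \<open>\<open>h x y z\<close> means that the guess \<open>y\<close> is no
    counterexample: it selects no repair, or \<open>z\<close> improves on it, or it satisfies
    \<open>Q\<close>. On malformed words the value is \<open>False\<close>, so every
    \<open>y\<close> witnesses that they lie outside the language.\<close>
  define h where "h x y z = (case decode parse_input valid x of None \<Rightarrow> False
    | Some t \<Rightarrow> \<not> repair_test (fst t) (select (fst t) y) \<or>
        improves (select (fst t) y) (snd t) (select (fst t) z) \<or> set (select (fst t) y) \<Turnstile> Q)" for x y z
  show ?thesis
  proof (rule Pi2_I)
    show "polytime (\<lambda>p. h (fst p) (fst (snd p)) (snd (snd p)))"
      unfolding h_def by (intro pt pt_decode p ok pt_repair_test pt_improves pt_query Q)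
    fix x
    have L: "x \<in> consistent_answering_lang S F Q \<longleftrightarrow>
        (\<exists>I pr. decode parse_input valid x = Some (I, pr) \<and> (\<forall>A\<in>GRep F (set I) (set pr). A \<Turnstile> Q))"
    proof
      assume "x \<in> consistent_answering_lang S F Q"
      then obtain I pr where "(set I, set pr) \<in> consistent_answering S F Q" "distinct I" "distinct pr"
        "x = enc_list enc_fact I @ enc_list enc_fact_pair pr"
        unfolding consistent_answering_lang_def set_codes_def by blast
      then show "\<exists>I pr. decode parse_input valid x = Some (I, pr) \<and> (\<forall>A\<in>GRep F (set I) (set pr). A \<Turnstile> Q)"
        unfolding decode_iff[OF p(1)] fst_conv snd_conv valid_iff consistent_answering_def
        by (intro exI[of _ I] exI[of _ pr]) simp
    next
      assume "\<exists>I pr. decode parse_input valid x = Some (I, pr) \<and> (\<forall>A\<in>GRep F (set I) (set pr). A \<Turnstile> Q)"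
      then obtain I pr where J: "decode parse_input valid x = Some (I, pr)" "\<forall>A\<in>GRep F (set I) (set pr). A \<Turnstile> Q"
        by (elim exE conjE) (rule that)
      then have v: "valid (I, pr)" and x: "x = enc_list enc_fact I @ enc_list enc_fact_pair pr"
        unfolding decode_iff[OF p(1)] by simp_all
      have "enc_list enc_fact I \<in> set_codes enc_fact (set I)"
        "enc_list enc_fact_pair pr \<in> set_codes enc_fact_pair (set pr)"
        using v by (auto simp: set_codes_def valid_iff)
      from consistent_answering_lang_iff[OF this] v J(2) show "x \<in> consistent_answering_lang S F Q"
        unfolding x by (simp add: consistent_answering_def valid_iff)
    qed
    show "x \<notin> consistent_answering_lang S F Q \<longleftrightarrow>
        (\<exists>y. length y \<le> length x \<and> (\<forall>z. length z \<le> length (enc_pair x y) \<longrightarrow> \<not> h x y z))"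
    proof (cases "decode parse_input valid x")
      case None
      then have "\<not> h x y z" for y z by (simp add: h_def)
      with None L show ?thesis by (metis le0 list.size(3) option.distinct(1))
    next
      case (Some t)
      obtain I pr where t: "t = (I, pr)" by fastforce
      have "x = ?e t" using Some decode_iff[OF p(1)] by blast
      then have len: "length I \<le> length x" using length_enc_list[of I enc_fact] by (simp add: t)
      have len': "length I \<le> length (enc_pair x y)" for y using len length_enc_pair[of x y] by simp
      have "(\<forall>z. length z \<le> length (enc_pair x y) \<longrightarrow> \<not> h x y z) \<longleftrightarrow>
          set (select I y) \<in> GRep F (set I) (set pr) \<and> \<not> set (select I y) \<Turnstile> Q" for y
      proof -
        have "(\<forall>z. length z \<le> length (enc_pair x y) \<longrightarrow> \<not> h x y z) \<longleftrightarrow> repair_test I (select I y) \<and>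
            \<not> (\<exists>z. length z \<le> length (enc_pair x y) \<and> improves (select I y) pr (select I z)) \<and>
            \<not> set (select I y) \<Turnstile> Q"
          using Some t unfolding h_def by (auto intro: exI[of _ "[]"])
        then show ?thesis unfolding ex_improves_select[OF len'] GRep_iff by blast
      qed
      then have "(\<exists>y. length y \<le> length x \<and> (\<forall>z. length z \<le> length (enc_pair x y) \<longrightarrow> \<not> h x y z)) \<longleftrightarrow>
          (\<exists>A. A \<subseteq> set I \<and> A \<in> GRep F (set I) (set pr) \<and> \<not> A \<Turnstile> Q)"
        using ex_select[OF len, of "\<lambda>A. A \<in> GRep F (set I) (set pr) \<and> \<not> A \<Turnstile> Q"] by simp
      also have "\<dots> \<longleftrightarrow> \<not> (\<forall>A\<in>GRep F (set I) (set pr). A \<Turnstile> Q)"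
        by (auto simp: GRep_def is_repair_def)
      also have "\<dots> \<longleftrightarrow> x \<notin> consistent_answering_lang S F Q"
        using L Some t by auto
      finally show ?thesis by blast
    qed
  qed
qed

end

theorem proposition5:
  fixes S :: schema and F :: "denial set" and Q :: fmla
  assumes "wf_schema S"
    and "finite F" and "\<forall>d\<in>F. wf_denial S d"
    and "closed_query S Q"
  shows "repair_checking_lang S F \<in> coNP_class \<and>
         consistent_answering_lang S F Q \<in> Pi2_class"
proof -
  interpret database S F using assms(1-3) by unfold_locales
  show ?thesis using repair_checking_coNP consistent_answering_Pi2[OF assms(4)] by blast
qed

end
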